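(* Let $D,r\geq 2$ and consider completely positive maps on $\mathcal{M}_D(\mathbb{C})$. Let $\mathfrak{T}_{(r)}$ be the set of completely positive maps of Kraus rank $r$, $\mathfrak{T}_{(r)}^{(TP)}\subseteq\mathfrak{T}_{(r)}$ the trace-preserving ones, $\mathfrak{P}_{(r)}\subseteq\mathfrak{T}_{(r)}$ the primitive ones, $\mathfrak{P}_{(r)}^{(TP)}\subseteq\mathfrak{P}_{(r)}$ the trace-preserving primitive ones, $\mathfrak{I}_{(r)}\subseteq\mathfrak{T}_{(r)}$ the irreducible ones and $\mathfrak{I}_{(r)}^{(TP)}\subseteq\mathfrak{I}_{(r)}$ the trace-preserving irreducible ones. Then: 1. $\mathfrak{T}_{(r)}$ is path-connected. 2. $\mathfrak{P}_{(r)}$ is a path-connected, dense and relatively open subset of $\mathfrak{T}_{(r)}$. 3. $\mathfrak{P}_{(r)}^{(TP)}$ is a path-connected, dense and relatively open subset of $\mathfrak{T}_{(r)}^{(TP)}$. 4. $\mathfrak{I}_{(r)}$ is a path-connected, dense and relatively open subset of $\mathfrak{T}_{(r)}$. 5. $\mathfrak{I}_{(r)}^{(TP)}$ is a path-connected, dense and relatively open subset of $\mathfrak{T}_{(r)}^{(TP)}$. Furthermore, any two elements $\mathcal{T}^{(0)},\mathcal{T}^{(1)}$ of any one of the sets $\mathfrak{T}_{(r)},\mathfrak{P}_{(r)},\mathfrak{I}_{(r)},\mathfrak{P}_{(r)}^{(TP)},\mathfrak{I}_{(r)}^{(TP)}$ can be connected by a path $t\mapsto\mathcal{T}^{(t)}$,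 $t\in[0,1]$, lying within that set, such that the matrix entries of $\mathcal{T}^{(t)}$ (as a linear map on $\mathcal{M}_D(\mathbb{C})$) depend analytically on $t\in[0,1]$.
   Context: A linear map $\mathcal{T}:\mathcal{M}_D(\mathbb{C})\to\mathcal{M}_D(\mathbb{C})$ is completely positive (CP) iff it can be written $\mathcal{T}(X)=\sum_i A_iXA_i^\dagger$ with $A_i\in\mathcal{M}_D(\mathbb{C})$ (Kraus operators). Its Choi matrix is $\omega(\mathcal{T})=(\mathcal{T}\otimes\mathrm{id})(|\varphi\rangle\langle\varphi|)$ with $\varphi=\sum_{i}|ii\rangle$; the Kraus rank of $\mathcal{T}$ is the minimal number of Kraus operators, which equals $\mathrm{rank}\,\omega(\mathcal{T})$. The dual map is $\mathcal{T}^*(X)=\sum_iA_i^\dagger XA_i$; $\mathcal{T}$ is trace-preserving iff $\mathcal{T}^*(\mathbb{1})=\mathbb{1}$. The spectral radius of $\mathcal{T}$ is $\mu=\max\{|\lambda|:\lambda$ an eigenvalue of $\mathcal{T}\}$. A CP map is irreducible iff its spectral radius is a non-degenerate eigenvalue whose left and right eigenvectors are positive definite matrices (equivalently: if a Hermitian projector $P$ satisfies $\mathcal{T}(P\mathcal{M}_D(\mathbb{C})P)\subseteq P\mathcal{M}_D(\mathbb{C})P$ then $P\in\{0,\mathbb{1}\}$). A CP map is primitive iff there is $n\in\mathbb{N}$ with $\mathrm{rank}\,\omega(\mathcal{T}^n)=D^2$ (equivalently: the spectral radius is a non-degenerate eigenvalue with positive definite left and right eigenvectors and all other eigenvalues have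 strictly smaller modulus). Topology is that of the finite-dimensional space of linear maps. *)

theory Defs
  imports "HOL-Analysis.Analysis"
begin

text \<open>D x D complex matrices are \<open>complex^'n^'n\<close> with \<open>D = CARD('n)\<close>.
  A linear map on M_D(C) is represented by its matrix with respect to the
  matrix-unit basis: an element \<open>L :: complex^('n\<times>'n)^('n\<times>'n)\<close>, acting by
  \<open>(L X)_{ij} = \<Sum>_{k,l} L_{(i,j),(k,l)} X_{kl}\<close>.  The topology is the one of
  this finite-dimensional (Euclidean) space.\<close>

type_synonym 'n supop = "complex^('n\<times>'n)^('n\<times>'n)"

definition adj :: "complex^'n^'n \<Rightarrow> complex^'n^'n" where
  "adj A = (\<chi> i j. cnj (A $ j $ i))"

definition apply_map :: "'n::finite supop \<Rightarrow> complex^'n^'n \<Rightarrow> complex^'n^'n" where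
  "apply_map L X = (\<chi> i j. \<Sum>p\<in>UNIV. L $ (i, j) $ p * X $ fst p $ snd p)"

text \<open>Composition of maps corresponds to the matrix product; n-th power.\<close>
definition map_pow :: "'n::finite supop \<Rightarrow> nat \<Rightarrow> 'n supop" where
  "map_pow L n = ((\<lambda>M. L ** M) ^^ n) (mat 1)"

definition is_kraus_rep :: "'n::finite supop \<Rightarrow> (complex^'n^'n) list \<Rightarrow> bool" where
  "is_kraus_rep L As \<longleftrightarrow> (\<forall>X. apply_map L X = sum_list (map (\<lambda>A. A ** X ** adj A) As))"

definition is_CP :: "'n::finite supop \<Rightarrow> bool" where
  "is_CP L \<longleftrightarrow> (\<exists>As. is_kraus_rep L As)"

definition kraus_rank :: "'n::finite supop \<Rightarrow> nat" where
  "kraus_rank L = (LEAST r. \<exists>As. length As = r \<and> is_kraus_rep L As)"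

definition trace_preserving :: "'n::finite supop \<Rightarrow> bool" where
  "trace_preserving L \<longleftrightarrow> (\<forall>X. trace (apply_map L X) = trace X)"

definition irreducible_map :: "'n::finite supop \<Rightarrow> bool" where
  "irreducible_map L \<longleftrightarrow> is_CP L \<and>
     (\<forall>P::complex^'n^'n. P ** P = P \<and> adj P = P \<and>
        (\<forall>X. \<exists>Y. apply_map L (P ** X ** P) = P ** Y ** P)
        \<longrightarrow> P = 0 \<or> P = mat 1)"

text \<open>Primitive: some power has full Kraus rank D^2 (= rank of its Choi matrix).\<close>
definition primitive_map :: "'n::finite supop \<Rightarrow> bool" where
  "primitive_map L \<longleftrightarrow> is_CP L \<and> (\<exists>n. kraus_rank (map_pow L n) = CARD('n)^2)"

definition CP_rank :: "nat \<Rightarrow> 'n::finite supop set" where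
  "CP_rank r = {L. is_CP L \<and> kraus_rank L = r}"

definition CP_rank_TP :: "nat \<Rightarrow> 'n::finite supop set" where
  "CP_rank_TP r = {L \<in> CP_rank r. trace_preserving L}"

definition Prim_rank :: "nat \<Rightarrow> 'n::finite supop set" where
  "Prim_rank r = {L \<in> CP_rank r. primitive_map L}"

definition Prim_rank_TP :: "nat \<Rightarrow> 'n::finite supop set" where
  "Prim_rank_TP r = {L \<in> Prim_rank r. trace_preserving L}"

definition Irr_rank :: "nat \<Rightarrow> 'n::finite supop set" where
  "Irr_rank r = {L \<in> CP_rank r. irreducible_map L}"

definition Irr_rank_TP :: "nat \<Rightarrow> 'n::finite supop set" where
  "Irr_rank_TP r = {L \<in> Irr_rank r. trace_preserving L}"

definition real_analytic_on :: "real set \<Rightarrow> (real \<Rightarrow> complex) \<Rightarrow> bool" where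
  "real_analytic_on S f \<longleftrightarrow> (\<forall>t0\<in>S. \<exists>e>0. \<exists>c::nat \<Rightarrow> complex.
      \<forall>t. \<bar>t - t0\<bar> < e \<longrightarrow> (\<lambda>n. c n * of_real (t - t0) ^ n) sums f t)"

definition analytic_path_connected :: "'n::finite supop set \<Rightarrow> bool" where
  "analytic_path_connected S \<longleftrightarrow> (\<forall>L0\<in>S. \<forall>L1\<in>S. \<exists>g :: real \<Rightarrow> 'n supop.
      g 0 = L0 \<and> g 1 = L1 \<and> (\<forall>t\<in>{0..1}. g t \<in> S) \<and>
      (\<forall>a b. real_analytic_on {0..1} (\<lambda>t. g t $ a $ b)))"

definition dense_open_in :: "'a::topological_space set \<Rightarrow> 'a set \<Rightarrow> bool" where
  "dense_open_in P T \<longleftrightarrow> P \<subseteq> T \<and> T \<subseteq> closure P \<and> openin (top_of_set T) P"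

end

(* A tuple of r linearly independent Kraus operators is completed to an invertible matrix M of
   size D^2 whose rows are the vectorised operators; CP maps of Kraus rank r are exactly the images of
   invertible matrices.  For holomorphic curves M(z), "M(z) is invertible and suitable words of equal
   length in two of its Kraus operators span all matrices" is the non-vanishing of an entire function.
   A quadratic curve through two given points and an explicit primitive tuple therefore stays primitive
   in its interior after bending the real parameter slightly into the complex plane.

   In the trace-preserving case the maps on such a path are conjugated by the Perron eigenvector X of
   the dual map and divided by the Perron eigenvalue.  X exists by Brouwer's theorem and is unique, hence
   continuous in the parameter.  The resulting continuous path is approximated by a polynomial one with
   the same endpoints, and Gram-Schmidt restores trace preservation analytically; openness of
   primitivity and irreducibility does the rest.  Density follows from the identity theorem along an
   analytic path to a primitive trace-preserving map. *)

theory Submission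
  imports Defs "HOL-Complex_Analysis.Complex_Analysis"
begin

no_notation fps_nth (infixl \<open>$\<close> 75)

section \<open>The Hermitian form on complex vectors\<close>

text \<open>The zeros of an entire function of one variable are countable, hence can be bypassed in
  the complex plane, whereas a real path may run into them. Bypassing needs a test for primitivity
  free of complex conjugation: a determinant of words in the Kraus operators. The determinant of the
  Choi matrix of a power is not holomorphic in the Kraus operators, but is a polynomial in the
  entries of the map itself; it serves for openness and for the identity theorem.

  The obstacle in the trace-preserving case: multiplying all Kraus operators on the right so that
  \<open>gram\<close> becomes 1 is an analytic repair, but may destroy primitivity and
  irreducibility, which a similarity preserves. The similarity by Perron eigenvectors, in turn, is
  only shown to be continuous. So the similarity yields a continuous path of the right kind, and the
  right multiplication is applied to a polynomial path close to it. Both leave trace-preserving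
  tuples alone, so the endpoints survive. For density the right multiplication alone suffices, since
  the path has to stay primitive only at points arbitrarily close to its start.\<close>

definition cip :: "complex^'n \<Rightarrow> complex^'n \<Rightarrow> complex" where
  "cip u v = (\<Sum>i\<in>UNIV. cnj (u $ i) * v $ i)"

definition outer :: "complex^'n \<Rightarrow> complex^'n \<Rightarrow> complex^'n^'n" where
  "outer u v = (\<chi> i j. u $ i * cnj (v $ j))"

lemma cip_self: "cip u u = of_real ((norm u)\<^sup>2)"
proof -
  have "(norm u)\<^sup>2 = (\<Sum>i\<in>UNIV. (norm (u $ i))\<^sup>2)"
    by (simp add: norm_vec_def L2_set_def sum_nonneg)
  then show ?thesis
    by (simp add: cip_def complex_norm_square[symmetric] mult.commute)
qed

lemma cip_self_eq_0 [simp]: "cip u u = 0 \<longleftrightarrow> u = 0"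
  by (simp add: cip_self)

lemma cip_add_right: "cip u (v + w) = cip u v + cip u w"
  by (simp add: cip_def algebra_simps sum.distrib)

lemma cip_add_left: "cip (u + v) w = cip u w + cip v w"
  by (simp add: cip_def algebra_simps sum.distrib)

lemma cip_diff_right: "cip u (v - w) = cip u v - cip u w"
  by (simp add: cip_def algebra_simps sum_subtractf)

lemma cip_diff_left: "cip (u - v) w = cip u w - cip v w"
  by (simp add: cip_def algebra_simps sum_subtractf)

lemma cip_scale_right: "cip u (c *s v) = c * cip u v"
  by (simp add: cip_def algebra_simps sum_distrib_left)

lemma cip_scale_left: "cip (c *s u) v = cnj c * cip u v"
  by (simp add: cip_def algebra_simps sum_distrib_left)

lemma cip_scaleR_right: "cip u (c *\<^sub>R v) = of_real c * cip u v"
  by (simp add: cip_def sum_distrib_left scaleR_conv_of_real[where 'a=complex] mult_ac)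

lemma cip_scaleR_left: "cip (c *\<^sub>R u) v = of_real c * cip u v"
  by (simp add: cip_def sum_distrib_left scaleR_conv_of_real[where 'a=complex] mult_ac)

lemma cip_0_right [simp]: "cip u 0 = 0"
  by (simp add: cip_def)

lemma cip_0_left [simp]: "cip 0 u = 0"
  by (simp add: cip_def)

lemma cip_sum_right: "cip u (sum f S) = (\<Sum>x\<in>S. cip u (f x))"
  by (induction S rule: infinite_finite_induct) (auto simp: cip_add_right)

lemma cnj_cip: "cnj (cip u v) = cip v u"
  by (simp add: cip_def mult.commute)

lemma cip_axis_left: "cip (axis i 1) v = v $ i"
  by (simp add: cip_def axis_def if_distrib[of cnj] if_distrib[of "\<lambda>x. x * _"] cong: if_cong)

lemma cip_adj: "cip (A *v u) v = cip u (adj A *v v)"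
  unfolding cip_def adj_def matrix_vector_mult_def
  by (simp add: sum_distrib_left sum_distrib_right)
     (subst sum.swap, simp add: mult_ac)

lemma adj_adj [simp]: "adj (adj A) = A"
  by (simp add: adj_def vec_eq_iff)

lemma cip_adj': "cip (adj A *v u) v = cip u (A *v v)"
  by (simp add: cip_adj)

lemma adj_mult: "adj (A ** B) = adj B ** adj A"
  by (simp add: adj_def matrix_matrix_mult_def vec_eq_iff mult.commute)

lemma adj_add: "adj (A + B) = adj A + adj B"
  by (simp add: adj_def vec_eq_iff)

lemma adj_diff: "adj (A - B) = adj A - adj B"
  by (simp add: adj_def vec_eq_iff)

lemma adj_scaleR: "adj (c *\<^sub>R A) = c *\<^sub>R adj A"
  by (simp add: adj_def vec_eq_iff)

lemma adj_0 [simp]: "adj 0 = 0"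
  by (simp add: adj_def vec_eq_iff)

lemma adj_mat_1 [simp]: "adj (mat 1) = mat 1"
  by (simp add: adj_def vec_eq_iff mat_def)

lemma adj_sum: "adj (sum f S) = (\<Sum>x\<in>S. adj (f x))"
  by (induction S rule: infinite_finite_induct) (auto simp: adj_add)

lemma adj_outer [simp]: "adj (outer u v) = outer v u"
  by (simp add: adj_def outer_def vec_eq_iff mult.commute)

lemma outer_vec: "outer u v *v w = cip v w *s u"
  by (simp add: outer_def cip_def matrix_vector_mult_def vec_eq_iff sum_distrib_left
      sum_distrib_right mult_ac)

lemma matrix_eq_iff_vec: "(A :: complex^'n^'m) = B \<longleftrightarrow> (\<forall>v. A *v v = B *v v)"
  by (simp add: matrix_eq)

lemma matrix_eqI_cip: "(\<And>u v. cip u (A *v v) = cip u (B *v v)) \<Longrightarrow> A = B"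
  by (metis cip_axis_left matrix_eq_iff_vec vec_eq_iff)

section \<open>Orthogonal projections\<close>

text \<open>Gram-Schmidt by induction on \<open>F\<close>: a vector outside the old span adds the
  rank-one projector \<open>outer a a\<close> onto its normalised residual \<open>a\<close>. Here
  \<open>vec.span\<close> is the complex span.\<close>

lemma orthogonal_projection_span:
  fixes F :: "(complex^'n) set"
  assumes "finite F"
  shows "\<exists>P. P ** P = P \<and> adj P = P \<and> (\<forall>u. P *v u = u \<longleftrightarrow> u \<in> vec.span F)"
  using assms
proof (induction F)
  case empty
  show ?case by (rule exI[of _ 0]) auto
next
  case (insert v F)
  then obtain P where P: "P ** P = P" "adj P = P" "\<And>u. P *v u = u \<longleftrightarrow> u \<in> vec.span F"
    by blast
  have PP: "P *v (P *v u) = P *v u" for u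
    by (metis P(1) matrix_vector_mul_assoc)
  have sa: "cip (P *v u) w = cip u (P *v w)" for u w
    by (simp add: cip_adj P(2))
  have rng: "P *v u \<in> vec.span F" for u
    using PP P(3) by blast
  define w where "w = v - P *v v"
  show ?case
  proof (cases "w = 0")
    case True
    then have "v \<in> vec.span F" using P(3)[of v] by (simp add: w_def)
    then have "vec.span (insert v F) = vec.span F" by (rule vec.span_redundant)
    then show ?thesis using P by auto
  next
    case False
    define a where "a = (1 / norm w) *\<^sub>R w"
    have aw: "a = of_real (1 / norm w) *s w"
      by (simp add: a_def vec_eq_iff scaleR_conv_of_real[where 'a=complex])
    have aa: "cip a a = 1"
      using False by (simp add: a_def cip_scaleR_left cip_scaleR_right cip_self power2_eq_square)
    have Pw: "P *v w = 0" by (simp add: w_def matrix_vector_mult_diff_distrib PP)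
    have Pa: "P *v a = 0"
      using Pw by (simp add: aw vector_scalar_commute)
    define Q where "Q = P + outer a a"
    have Q: "Q *v u = P *v u + cip a u *s a" for u
      by (simp add: Q_def matrix_vector_mult_add_rdistrib outer_vec)
    have aP: "cip a (P *v u) = 0" for u
      by (metis Pa cip_0_left sa)
    have av: "cip a v = of_real (norm w)"
    proof -
      have "cip a v = cip a w" by (simp add: w_def cip_diff_right aP)
      also have "\<dots> = of_real (norm w)"
        using False by (simp add: a_def cip_scaleR_left cip_self power2_eq_square)
      finally show ?thesis .
    qed
    have wa: "w = of_real (norm w) *s a"
      using False by (simp add: a_def vec_eq_iff scaleR_conv_of_real[where 'a=complex])
    have "Q ** Q = Q"
    proof -
      have "Q *v (Q *v u) = Q *v u" for u
        by (simp add: Q matrix_vector_right_distrib cip_add_right PP aP vector_scalar_commute Pa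
            cip_scale_right aa)
      then show ?thesis
        by (simp add: matrix_eq_iff_vec matrix_vector_mul_assoc[symmetric])
    qed
    moreover have "adj Q = Q" by (simp add: Q_def adj_add P(2))
    moreover have "Q *v u = u \<longleftrightarrow> u \<in> vec.span (insert v F)" for u
    proof
      assume "Q *v u = u"
      then have u: "u = P *v u + cip a u *s a" by (simp add: Q)
      define k where "k = cip a u * of_real (1 / norm w)"
      have "cip a u *s a = k *s v - k *s (P *v v)"
        unfolding k_def by (subst (2) aw) (simp add: w_def vec_eq_iff algebra_simps)
      then have "u - k *s v = P *v u - k *s (P *v v)"
        using u by (metis add_diff_eq add_diff_cancel_left' diff_diff_eq2 diff_add_eq)
      moreover have "\<dots> \<in> vec.span F"
        by (intro vec.span_diff vec.span_scale rng)
      ultimately show "u \<in> vec.span (insert v F)"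
        unfolding vec.span_breakdown_eq by metis
    next
      assume "u \<in> vec.span (insert v F)"
      then obtain k where k: "u - k *s v \<in> vec.span F"
        unfolding vec.span_breakdown_eq by blast
      define y where "y = u - k *s v"
      have Py: "P *v y = y" using k P(3) by (simp add: y_def)
      have u: "u = y + k *s v" by (simp add: y_def)
      have Qy: "Q *v y = y" using aP[of y] by (simp add: Q Py)
      have Qv: "Q *v v = v"
        using wa by (simp add: Q av) (simp add: w_def algebra_simps)
      show "Q *v u = u"
        by (simp add: u matrix_vector_right_distrib vector_scalar_commute Qy Qv)
    qed
    ultimately show ?thesis by blast
  qed
qed

lemma orthogonal_projection_subspace:
  fixes W :: "(complex^'n) set"
  assumes "vec.subspace W"
  obtains P where "P ** P = P" "adj P = P" "\<And>u. P *v u = u \<longleftrightarrow> u \<in> W"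
proof -
  obtain B where B: "B \<subseteq> W" "vec.independent B" "W \<subseteq> vec.span B"
    using vec.basis_exists by metis
  have "finite B" using B(2) by (rule vec.finiteI_independent)
  moreover have "vec.span B = W"
    using B assms by (metis vec.span_minimal subset_antisym)
  ultimately show ?thesis
    using orthogonal_projection_span[of B] that by blast
qed

text \<open>The pairing is bilinear, as in the entries of \<open>M *v x\<close>, while the
  projection \<open>P\<close> belongs to the sesquilinear form; hence the witness is the conjugate
  of a residual vector.\<close>

lemma exists_orthogonal_vector:
  fixes F :: "(complex^'m) set"
  assumes "finite F" "card F < CARD('m)"
  obtains x where "x \<noteq> 0" "\<And>f. f \<in> F \<Longrightarrow> (\<Sum>i\<in>UNIV. f $ i * x $ i) = 0"
proof -
  obtain P where P: "P ** P = P" "adj P = P" "\<And>u. P *v u = u \<longleftrightarrow> u \<in> vec.span F"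
    using orthogonal_projection_span[OF assms(1)] by blast
  have "vec.span F \<noteq> UNIV"
    using vec.dim_le_card[of UNIV F] assms by (auto simp: vec_dim_card simp del: vec.dim_UNIV)
  then obtain u where u: "u \<notin> vec.span F" by blast
  define w where "w = u - P *v u"
  have "w \<noteq> 0" using u P(3)[of u] by (auto simp: w_def)
  moreover have "cip w f = 0" if "f \<in> F" for f
  proof -
    have f: "P *v f = f" using that P(3) by (simp add: vec.span_base)
    have "P *v w = 0"
      by (simp add: w_def matrix_vector_mult_diff_distrib matrix_vector_mul_assoc P(1))
    then have "cip (P *v w) f = 0" by simp
    then show ?thesis by (simp add: cip_adj P(2) f)
  qed
  ultimately show ?thesis
    using that[of "\<chi> i. cnj (w $ i)"] unfolding cip_def
    by (auto simp: vec_eq_iff mult.commute)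
qed

section \<open>Kraus families\<close>

text \<open>The matrix of the sum of the tensor products of \<open>A k\<close> with its entrywise
  conjugate. Index sets of any type are allowed, so that numbers, row indices of a matrix and words
  can all label Kraus operators.\<close>

definition kmap :: "'i set \<Rightarrow> ('i \<Rightarrow> complex^'n^'n) \<Rightarrow> 'n::finite supop" where
  "kmap I A = (\<chi> p q. \<Sum>k\<in>I. A k $ fst p $ fst q * cnj (A k $ snd p $ snd q))"

lemma sandwich_nth:
  "(A ** X ** adj A) $ i $ j = (\<Sum>q\<in>UNIV. A $ i $ fst q * cnj (A $ j $ snd q) * X $ fst q $ snd q)"
proof -
  have "(A ** X ** adj A) $ i $ j = (\<Sum>l\<in>UNIV. \<Sum>k\<in>UNIV. A $ i $ k * X $ k $ l * cnj (A $ j $ l))"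
    by (simp add: matrix_matrix_mult_def adj_def sum_distrib_right)
  also have "\<dots> = (\<Sum>k\<in>UNIV. \<Sum>l\<in>UNIV. A $ i $ k * cnj (A $ j $ l) * X $ k $ l)"
    by (subst sum.swap) (simp add: mult_ac)
  also have "\<dots> = (\<Sum>q\<in>UNIV \<times> UNIV. A $ i $ fst q * cnj (A $ j $ snd q) * X $ fst q $ snd q)"
    by (simp add: sum.cartesian_product case_prod_beta)
  finally show ?thesis by simp
qed

lemma apply_kmap: "apply_map (kmap I A) X = (\<Sum>k\<in>I. A k ** X ** adj (A k))"
proof -
  have "apply_map (kmap I A) X $ i $ j = (\<Sum>k\<in>I. A k ** X ** adj (A k)) $ i $ j" for i j
    unfolding sum_component sandwich_nth
    by (simp add: apply_map_def kmap_def sum_distrib_right) (rule sum.swap)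
  then show ?thesis by (simp add: vec_eq_iff)
qed

lemma supop_eqI:
  assumes "\<And>X. apply_map L X = apply_map L' X"
  shows "L = L'"
proof -
  have *: "apply_map L (\<chi> i j. if (i, j) = q then 1 else 0) $ i $ j = L $ (i, j) $ q" for L :: "'a supop" and i j q
    by (simp add: apply_map_def if_distrib[of "\<lambda>x. _ * x"] cong: if_cong)
  have "L $ (i, j) $ q = L' $ (i, j) $ q" for i j q
    using *[of L q i j] *[of L' q i j] assms by simp
  then show ?thesis by (simp add: vec_eq_iff)
qed

lemma is_kraus_rep_iff: "is_kraus_rep L As \<longleftrightarrow> L = kmap {..<length As} (\<lambda>i. As ! i)"
proof -
  have "apply_map (kmap {..<length As} (\<lambda>i. As ! i)) X = sum_list (map (\<lambda>A. A ** X ** adj A) As)" for X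
    by (simp add: apply_kmap sum_list_sum_nth atLeast0LessThan)
  then show ?thesis
    unfolding is_kraus_rep_def by (metis supop_eqI)
qed

lemma ex_kraus_list_iff:
  "(\<exists>As. length As = r \<and> is_kraus_rep L As) \<longleftrightarrow> (\<exists>A. L = kmap {..<r} A)"
proof
  assume "\<exists>A. L = kmap {..<r} A"
  then obtain A where A: "L = kmap {..<r} A" by blast
  have "kmap {..<r} A = kmap {..<r} (\<lambda>i. map A [0..<r] ! i)"
    unfolding kmap_def by (simp add: vec_eq_iff)
  then show "\<exists>As. length As = r \<and> is_kraus_rep L As"
    by (intro exI[of _ "map A [0..<r]"]) (simp add: is_kraus_rep_iff A)
qed (auto simp: is_kraus_rep_iff)

lemma is_CP_iff: "is_CP L \<longleftrightarrow> (\<exists>(r::nat) A. L = kmap {..<r} A)"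
  unfolding is_CP_def using ex_kraus_list_iff[of _ L] by metis

lemma kraus_rank_eq: "kraus_rank L = (LEAST r. \<exists>A. L = kmap {..<r} A)"
  unfolding kraus_rank_def ex_kraus_list_iff ..

lemma kmap_reindex:
  assumes "bij_betw h I J"
  shows "kmap J A = kmap I (A \<circ> h)"
  unfolding kmap_def by (simp add: sum.reindex_bij_betw[OF assms, symmetric])

lemma kmap_cong: "(\<And>k. k \<in> I \<Longrightarrow> A k = B k) \<Longrightarrow> kmap I A = kmap I B"
  unfolding kmap_def by simp

lemma kmap_finite_reindex:
  assumes "finite I"
  obtains B where "kmap I A = kmap {..<card I} B"
proof -
  obtain h where "bij_betw h {0..<card I} I" using ex_bij_betw_nat_finite[OF assms] by blast
  then show ?thesis using that kmap_reindex[of h _ I A] by (auto simp: atLeast0LessThan)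
qed

lemma is_CP_kmap: "finite I \<Longrightarrow> is_CP (kmap I A)"
  unfolding is_CP_iff using kmap_finite_reindex by metis

lemma kraus_rank_kmap_le:
  assumes "finite I"
  shows "kraus_rank (kmap I A) \<le> card I"
  unfolding kraus_rank_eq by (rule Least_le) (metis kmap_finite_reindex assms)

lemma kraus_rank_witness:
  assumes "is_CP L"
  obtains A where "L = kmap {..<kraus_rank L} A"
proof -
  have "\<exists>A. L = kmap {..<kraus_rank L} A"
    unfolding kraus_rank_eq using assms unfolding is_CP_iff by (rule LeastI_ex)
  then show ?thesis using that by blast
qed

text \<open>If \<open>A\<^sub>k\<close> is the combination of the other operators with coefficients \<open>d\<close>, then the Gram
  matrix of the remaining ones is \<open>1 + d d*\<close>, whose square root is \<open>1 + \<kappa> d d*\<close>.\<close>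

lemma kmap_remove_dependent:
  fixes A :: "'i \<Rightarrow> complex^'n^'n"
  assumes "finite I" "k \<in> I" "c k \<noteq> 0"
    and dep: "\<And>a b. (\<Sum>i\<in>I. c i * A i $ a $ b) = 0"
  shows "\<exists>B. kmap I A = kmap (I - {k}) B"
proof -
  define J where "J = I - {k}"
  define d where "d i = - c i / c k" for i
  have fJ: "finite J" and IJ: "I = insert k J" "k \<notin> J" using assms by (auto simp: J_def)
  have Ak: "(\<Sum>i\<in>J. d i * A i $ a $ b) = A k $ a $ b" for a b
  proof -
    have "c k * A k $ a $ b + (\<Sum>i\<in>J. c i * A i $ a $ b) = 0"
      using dep[of a b] fJ by (simp add: IJ)
    then have "A k $ a $ b = - (\<Sum>i\<in>J. c i * A i $ a $ b) / c k"
      using assms(3) by (simp add: field_simps add_eq_0_iff)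
    also have "\<dots> = (\<Sum>i\<in>J. d i * A i $ a $ b)"
      by (simp add: d_def sum_divide_distrib sum_negf)
    finally show ?thesis by simp
  qed
  define s where "s = (\<Sum>i\<in>J. (norm (d i))\<^sup>2)"
  \<comment> \<open>The positive root x of s x^2 + 2 x = 1, in a form that also covers s = 0. The
    equation says that 1 + x d d^H has square 1 + d d^H, where s is the squared norm of d.\<close>
  define \<kappa> where "\<kappa> = 1 / (1 + sqrt (1 + s))"
  have s0: "0 \<le> s" by (simp add: s_def sum_nonneg)
  have k: "2 * \<kappa> + \<kappa>\<^sup>2 * s = 1"
  proof -
    define q where "q = sqrt (1 + s)"
    have q: "q \<ge> 0" "s = q\<^sup>2 - 1" using s0 by (simp_all add: q_def)
    have "\<kappa> = 1 / (1 + q)" by (simp add: \<kappa>_def q_def)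
    then have kq: "\<kappa> * (1 + q) = 1" using q(1) by simp
    have "2 * \<kappa> + \<kappa>\<^sup>2 * s = 2 * \<kappa> + (\<kappa> * (1 + q)) * (\<kappa> * (q - 1))"
      unfolding q(2) by (simp add: algebra_simps power2_eq_square)
    also have "\<dots> = 1" unfolding kq using kq by (simp add: algebra_simps)
    finally show ?thesis .
  qed
  have kc: "2 * complex_of_real \<kappa> + (complex_of_real \<kappa>)\<^sup>2 * of_real s = 1"
    using arg_cong[OF k, of complex_of_real] by simp
  have sc: "(\<Sum>i\<in>J. d i * cnj (d i)) = complex_of_real s"
    by (simp add: s_def complex_norm_square del: of_real_power)
  define B where "B i = (\<chi> a b. A i $ a $ b + of_real \<kappa> * cnj (d i) * A k $ a $ b)" for i
  have "(\<Sum>i\<in>J. B i $ x $ y * cnj (B i $ x' $ y')) = (\<Sum>i\<in>I. A i $ x $ y * cnj (A i $ x' $ y'))"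
    for x y x' y'
  proof -
    define w where "w = A k $ x $ y"
    define w' where "w' = A k $ x' $ y'"
    have 1: "(\<Sum>i\<in>J. d i * A i $ x $ y) = w" by (simp add: Ak w_def)
    have 2: "(\<Sum>i\<in>J. cnj (d i) * cnj (A i $ x' $ y')) = cnj w'"
      using arg_cong[OF Ak[of x' y'], of cnj] by (simp add: w'_def)
    have "(\<Sum>i\<in>J. B i $ x $ y * cnj (B i $ x' $ y')) =
      (\<Sum>i\<in>J. A i $ x $ y * cnj (A i $ x' $ y')
        + of_real \<kappa> * cnj w' * (d i * A i $ x $ y)
        + of_real \<kappa> * w * (cnj (d i) * cnj (A i $ x' $ y'))
        + (of_real \<kappa>)\<^sup>2 * w * cnj w' * (d i * cnj (d i)))"
      by (intro sum.cong) (simp_all add: B_def w_def w'_def algebra_simps power2_eq_square)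
    also have "\<dots> = (\<Sum>i\<in>J. A i $ x $ y * cnj (A i $ x' $ y'))
        + of_real \<kappa> * cnj w' * w + of_real \<kappa> * w * cnj w' + (of_real \<kappa>)\<^sup>2 * w * cnj w' * of_real s"
      by (simp only: sum.distrib sum_distrib_left[symmetric] 1 2 sc)
    also have "\<dots> = (\<Sum>i\<in>J. A i $ x $ y * cnj (A i $ x' $ y'))
        + (2 * of_real \<kappa> + (of_real \<kappa>)\<^sup>2 * of_real s) * (w * cnj w')"
      by (simp add: algebra_simps)
    also have "\<dots> = (\<Sum>i\<in>I. A i $ x $ y * cnj (A i $ x' $ y'))"
      using fJ by (simp only: kc IJ(1) sum.insert[OF fJ IJ(2)] w_def w'_def) simp
    finally show ?thesis .
  qed
  then have "kmap I A = kmap J B"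
    unfolding kmap_def by simp
  then show ?thesis by (auto simp: J_def)
qed

text \<open>A non-trivial relation would allow one operator to be dropped, against the minimality of
  \<open>r\<close>.\<close>

lemma minimal_kraus_independent:
  fixes A :: "nat \<Rightarrow> complex^'n^'n"
  assumes L: "kmap {..<r} A = L" "kraus_rank L = r"
    and dep: "\<And>a b. (\<Sum>i<r. c i * A i $ a $ b) = 0" and k: "k < r"
  shows "c k = 0"
proof (rule ccontr)
  assume "c k \<noteq> 0"
  then obtain B where "L = kmap ({..<r} - {k}) B"
    using kmap_remove_dependent[of "{..<r}" k c A] k dep L(1) by auto
  then have "kraus_rank L \<le> card ({..<r} - {k})"
    using kraus_rank_kmap_le[of "{..<r} - {k}" B] by simp
  then show False using k L(2) by simp
qed

section \<open>Minimal Kraus families as rows of an invertible matrix\<close>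

definition rowmat :: "complex^('n \<times> 'n)^'k \<Rightarrow> 'k \<Rightarrow> complex^'n^'n" where
  "rowmat M k = (\<chi> i j. M $ k $ (i, j))"

lemma rows_extend_invertible:
  fixes v :: "'m::finite \<Rightarrow> complex^'m"
  assumes ind: "\<forall>c. (\<Sum>i\<in>I. c i *s v i) = 0 \<longrightarrow> (\<forall>i\<in>I. c i = 0)"
  obtains M :: "complex^'m^'m" where "det M \<noteq> 0" "\<And>i. i \<in> I \<Longrightarrow> M $ i = v i"
proof -
  have inj: "inj_on v I"
  proof (rule inj_onI, rule ccontr)
    fix i j assume ij: "i \<in> I" "j \<in> I" "v i = v j" "i \<noteq> j"
    define c :: "'m \<Rightarrow> complex" where "c = (\<lambda>k. if k = i then 1 else if k = j then -1 else 0)"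
    have "(\<Sum>k\<in>I. c k *s v k) = (\<Sum>k\<in>{i, j}. c k *s v k)"
      by (rule sum.mono_neutral_right) (use ij in \<open>auto simp: c_def\<close>)
    also have "\<dots> = 0" using ij by (simp add: c_def)
    finally show False using ind[rule_format, of c i] ij by (simp add: c_def)
  qed
  have S: "vec.independent (v ` I)"
    unfolding vec.independent_explicit
  proof (intro conjI allI impI ballI)
    fix c x assume "(\<Sum>x\<in>v ` I. c x *s x) = 0" "x \<in> v ` I"
    then show "c x = 0" using ind[rule_format, of "c \<circ> v"] by (auto simp: sum.reindex[OF inj])
  qed simp
  define B where "B = vec.extend_basis (v ` I)"
  have B: "vec.independent B" "v ` I \<subseteq> B" "vec.span B = UNIV"
    using S by (simp_all add: B_def vec.independent_extend_basis vec.extend_basis_superset)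
  have fB: "finite B" by (rule vec.finiteI_independent[OF B(1)])
  have cB: "card B = CARD('m)"
    using vec.dim_eq_card[of B UNIV] B by (simp add: vec_dim_card del: vec.dim_UNIV)
  have "card (UNIV - I) = card (B - v ` I)"
    using B(2) by (simp add: card_Diff_subset cB card_image[OF inj])
  then obtain g where g: "bij_betw g (UNIV - I) (B - v ` I)"
    using finite_same_card_bij[of "UNIV - I" "B - v ` I"] fB by auto
  define h where "h i = (if i \<in> I then v i else g i)" for i
  have h: "bij_betw h UNIV B"
  proof -
    have "bij_betw h (I \<union> (UNIV - I)) (v ` I \<union> (B - v ` I))"
    proof (rule bij_betw_combine)
      show "bij_betw h I (v ` I)"
        using inj by (auto simp: bij_betw_def h_def inj_on_def)
      show "bij_betw h (UNIV - I) (B - v ` I)"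
        using g by (rule bij_betw_cong[THEN iffD1, rotated]) (simp add: h_def)
    qed auto
    then show ?thesis using B(2) by (simp add: Un_absorb1)
  qed
  define M :: "complex^'m^'m" where "M = (\<chi> i. h i)"
  have "\<exists>N. M ** N = mat 1"
    unfolding matrix_right_invertible_independent_rows
  proof (intro allI impI)
    fix c i assume "(\<Sum>i\<in>UNIV. c i *s row i M) = 0"
    then have "(\<Sum>i\<in>UNIV. c i *s h i) = 0" by (simp add: M_def row_def vec_nth_inverse)
    then have "(\<Sum>x\<in>B. c (inv h x) *s x) = 0"
      using h by (simp add: sum.reindex_bij_betw[OF h, symmetric] bij_betw_def inv_f_f)
    then have "c (inv h (h i)) = 0"
      using B(1) h unfolding vec.independent_explicit by (auto simp: bij_betw_def)
    then show "c i = 0" using h by (simp add: bij_betw_def inv_f_f)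
  qed
  then have "det M \<noteq> 0"
    using invertible_det_nz invertible_right_inverse by blast
  then show ?thesis using that[of M] by (simp add: M_def h_def)
qed

text \<open>Independent Kraus operators live in a space of dimension D^2. For larger
  \<open>r\<close> all sets of the theorem are empty; as soon as one element is given, an index set
  of size \<open>r\<close> exists among the D^2 row indices.\<close>

lemma CP_rank_bound:
  fixes L :: "'n::finite supop"
  assumes "L \<in> CP_rank r"
  shows "r \<le> CARD('n \<times> 'n)"
proof (rule ccontr)
  assume r: "\<not> r \<le> CARD('n \<times> 'n)"
  obtain A where A: "L = kmap {..<r} A"
    using assms kraus_rank_witness[of L] by (auto simp: CP_rank_def)
  define v :: "nat \<Rightarrow> complex^('n \<times> 'n)" where "v i = (\<chi> p. A i $ fst p $ snd p)" for i
  have ind: "c k = 0" if "(\<Sum>i<r. c i *s v i) = 0" "k < r" for c k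
  proof (rule minimal_kraus_independent)
    show "kmap {..<r} A = L" "kraus_rank L = r" "k < r" using A assms that by (auto simp: CP_rank_def)
    show "(\<Sum>i<r. c i * A i $ a $ b) = 0" for a b
      using arg_cong[OF that(1), of "\<lambda>x. x $ (a, b)"] by (simp add: v_def)
  qed
  have inj: "inj_on v {..<r}"
  proof (rule inj_onI, rule ccontr)
    fix i j assume ij: "i \<in> {..<r}" "j \<in> {..<r}" "v i = v j" "i \<noteq> j"
    define c :: "nat \<Rightarrow> complex" where "c = (\<lambda>k. if k = i then 1 else if k = j then -1 else 0)"
    have "(\<Sum>k<r. c k *s v k) = (\<Sum>k\<in>{i, j}. c k *s v k)"
      by (rule sum.mono_neutral_right) (use ij in \<open>auto simp: c_def\<close>)
    also have "\<dots> = 0" using ij by (simp add: c_def)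
    finally show False using ind[of c i] ij by (simp add: c_def)
  qed
  have "vec.independent (v ` {..<r})"
    unfolding vec.independent_explicit
  proof (intro conjI allI impI ballI)
    fix c x assume "(\<Sum>x\<in>v ` {..<r}. c x *s x) = 0" "x \<in> v ` {..<r}"
    then show "c x = 0" using ind[of "c \<circ> v"] by (auto simp: sum.reindex[OF inj])
  qed simp
  then have "card (v ` {..<r}) \<le> CARD('n \<times> 'n)"
    by (metis vec.dim_eq_card_independent vec_dim_card vec.dim_subset subset_UNIV)
  then show False using r by (simp add: card_image[OF inj])
qed

text \<open>The set \<open>I\<close> is prescribed rather than produced, so that two maps can be
  represented over the same rows and joined by a path of matrices.\<close>

theorem CP_rank_obtain:
  fixes L :: "'n::finite supop" and I :: "('n \<times> 'n) set"
  assumes "L \<in> CP_rank r" "card I = r"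
  obtains M where "det M \<noteq> 0" "L = kmap I (rowmat M)"
proof -
  obtain A where A: "L = kmap {..<r} A"
    using assms kraus_rank_witness[of L] by (auto simp: CP_rank_def)
  obtain h where h: "bij_betw h I {..<r}"
    using assms(2) ex_bij_betw_finite_nat[of I] by (auto simp: atLeast0LessThan)
  define v :: "'n \<times> 'n \<Rightarrow> complex^('n \<times> 'n)" where "v i = (\<chi> p. A (h i) $ fst p $ snd p)" for i
  have ind: "c k = 0" if c: "(\<Sum>i\<in>I. c i *s v i) = 0" "k \<in> I" for c k
  proof -
    have "c (inv_into I h (h k)) = 0"
    proof (rule minimal_kraus_independent[of r A L "\<lambda>i. c (inv_into I h i)"])
      show "kmap {..<r} A = L" "kraus_rank L = r" using A assms by (auto simp: CP_rank_def)
      show "h k < r" using h c by (auto simp: bij_betw_def)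
      show "(\<Sum>i<r. c (inv_into I h i) * A i $ a $ b) = 0" for a b
      proof -
        have "(\<Sum>i<r. c (inv_into I h i) * A i $ a $ b) = (\<Sum>i\<in>I. c i * A (h i) $ a $ b)"
          unfolding sum.reindex_bij_betw[OF h, symmetric]
          by (intro sum.cong) (use h in \<open>auto simp: bij_betw_def\<close>)
        also have "\<dots> = 0" using arg_cong[OF c(1), of "\<lambda>x. x $ (a, b)"] by (simp add: v_def)
        finally show ?thesis .
      qed
    qed
    then show ?thesis using c h by (simp add: bij_betw_def)
  qed
  obtain M where M: "det M \<noteq> 0" "\<And>i. i \<in> I \<Longrightarrow> M $ i = v i"
    using rows_extend_invertible[where I = I and v = v] ind by blast
  have "L = kmap I (A \<circ> h)" using A kmap_reindex[OF h, of A] by simp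
  also have "\<dots> = kmap I (rowmat M)"
    by (rule kmap_cong) (simp add: rowmat_def M(2) v_def vec_eq_iff)
  finally show ?thesis using that M(1) by blast
qed

text \<open>The right-hand side is the quadratic form of the Choi matrix, so the sum of squares on
  the left depends on the map only and not on the chosen Kraus family.\<close>

lemma sum_norm_pairing:
  fixes A :: "'i \<Rightarrow> complex^'n^'n" and v :: "complex^('n \<times> 'n)"
  shows "of_real (\<Sum>k\<in>I. (norm (\<Sum>p\<in>UNIV. A k $ fst p $ snd p * v $ p))\<^sup>2) =
    (\<Sum>p\<in>UNIV. \<Sum>q\<in>UNIV. kmap I A $ (fst p, fst q) $ (snd p, snd q) * v $ p * cnj (v $ q))"
proof -
  have "of_real (\<Sum>k\<in>I. (norm (\<Sum>p\<in>UNIV. A k $ fst p $ snd p * v $ p))\<^sup>2) =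
    (\<Sum>k\<in>I. \<Sum>p\<in>UNIV. \<Sum>q\<in>UNIV. A k $ fst p $ snd p * v $ p * (cnj (A k $ fst q $ snd q) * cnj (v $ q)))"
    by (simp add: complex_norm_square sum_product del: of_real_power)
  also have "\<dots> = (\<Sum>p\<in>UNIV. \<Sum>q\<in>UNIV. \<Sum>k\<in>I. A k $ fst p $ snd p * v $ p * (cnj (A k $ fst q $ snd q) * cnj (v $ q)))"
    by (subst sum.swap, intro sum.cong refl, rule sum.swap)
  also have "\<dots> = (\<Sum>p\<in>UNIV. \<Sum>q\<in>UNIV. kmap I A $ (fst p, fst q) $ (snd p, snd q) * v $ p * cnj (v $ q))"
    by (simp add: kmap_def sum_distrib_left sum_distrib_right mult_ac)
  finally show ?thesis .
qed

text \<open>Two Kraus families of one map have the same annihilator, that is, the same linear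
  span.\<close>

lemma kmap_pairing_zero_iff:
  assumes "kmap I A = kmap J B" "finite I" "finite J"
    and "\<And>k. k \<in> I \<Longrightarrow> (\<Sum>p\<in>UNIV. A k $ fst p $ snd p * v $ p) = 0" and "k \<in> J"
  shows "(\<Sum>p\<in>UNIV. B k $ fst p $ snd p * v $ p) = 0"
proof -
  have "complex_of_real (\<Sum>k\<in>J. (norm (\<Sum>p\<in>UNIV. B k $ fst p $ snd p * v $ p))\<^sup>2) =
     complex_of_real (\<Sum>k\<in>I. (norm (\<Sum>p\<in>UNIV. A k $ fst p $ snd p * v $ p))\<^sup>2)"
    unfolding sum_norm_pairing assms(1) ..
  also have "\<dots> = 0" by (simp add: assms(4))
  finally have "(\<Sum>k\<in>J. (norm (\<Sum>p\<in>UNIV. B k $ fst p $ snd p * v $ p))\<^sup>2) = 0"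
    by (simp only: of_real_eq_0_iff)
  then show ?thesis
    using assms(3,5) by (subst (asm) sum_nonneg_eq_0_iff) auto
qed

text \<open>With fewer than \<open>card I\<close> Kraus operators, these and the rows of
  \<open>M\<close> outside \<open>I\<close> would be fewer than D^2 vectors, so a non-zero
  \<open>x\<close> annihilates them all. It then annihilates the rows in \<open>I\<close> too, and
  \<open>M *v x = 0\<close> contradicts invertibility.\<close>

theorem CP_rank_kmap:
  fixes M :: "complex^('n \<times> 'n)^('n::finite \<times> 'n)"
  assumes "det M \<noteq> 0"
  shows "kmap I (rowmat M) \<in> CP_rank (card I)"
proof -
  let ?L = "kmap I (rowmat M)"
  have cp: "is_CP ?L" by (simp add: is_CP_kmap)
  have "card I \<le> kraus_rank ?L"
  proof (rule ccontr)
    assume less: "\<not> card I \<le> kraus_rank ?L"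
    obtain B where B: "?L = kmap {..<kraus_rank ?L} B" using kraus_rank_witness[OF cp] by blast
    define F :: "(complex^('n \<times> 'n)) set"
      where "F = (\<lambda>i. \<chi> p. B i $ fst p $ snd p) ` {..<kraus_rank ?L} \<union> (\<lambda>k. M $ k) ` (UNIV - I)"
    have "card F \<le> kraus_rank ?L + card (UNIV - I)"
      unfolding F_def by (rule order.trans[OF card_Un_le add_mono]) (auto intro: card_image_le[THEN order.trans])
    also have "\<dots> < CARD('n \<times> 'n)"
      using less card_mono[of UNIV I] by (simp add: card_Diff_subset)
    finally have "card F < CARD('n \<times> 'n)" .
    moreover have "finite F" by (simp add: F_def)
    ultimately obtain x where x: "x \<noteq> 0" "\<And>f. f \<in> F \<Longrightarrow> (\<Sum>i\<in>UNIV. f $ i * x $ i) = 0"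
      using exists_orthogonal_vector by metis
    have "(M *v x) $ k = 0" for k
    proof (cases "k \<in> I")
      case True
      have "(\<Sum>p\<in>UNIV. rowmat M k $ fst p $ snd p * x $ p) = 0"
      proof (rule kmap_pairing_zero_iff[OF B[symmetric] _ _ _ True])
        fix i assume "i \<in> {..<kraus_rank ?L}"
        then have "(\<chi> p. B i $ fst p $ snd p) \<in> F" by (auto simp: F_def)
        from x(2)[OF this] show "(\<Sum>p\<in>UNIV. B i $ fst p $ snd p * x $ p) = 0" by simp
      qed auto
      then show ?thesis by (simp add: rowmat_def matrix_vector_mult_def)
    next
      case False
      then show ?thesis using x(2)[of "M $ k"] by (simp add: F_def matrix_vector_mult_def)
    qed
    then have "M *v x = 0" by (simp add: vec_eq_iff)
    then show False using x(1) assms invertible_det_nz[of M]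
      by (metis invertible_left_inverse matrix_left_invertible_ker)
  qed
  then show ?thesis using cp kraus_rank_kmap_le[of I "rowmat M"]
    by (simp add: CP_rank_def antisym)
qed

section \<open>Choi matrices and spanning families\<close>

text \<open>That the matrices \<open>B w\<close> span the whole matrix space, put dually: the trace
  form is non-degenerate, so a family spans exactly when its annihilator is zero.\<close>

definition spanning :: "'i set \<Rightarrow> ('i \<Rightarrow> complex^'n^'n) \<Rightarrow> bool" where
  "spanning J B \<longleftrightarrow> (\<forall>X. (\<forall>w\<in>J. trace (B w ** X) = 0) \<longrightarrow> X = 0)"

text \<open>Realignment of the entries of \<open>L\<close>: with p = (i,k) and q = (j,l) the entry
  is the (i,j) entry of the image of the matrix unit E_kl, as in (T tensor id) applied to the
  unnormalised maximally entangled projector.\<close>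

definition choi :: "'n::finite supop \<Rightarrow> complex^('n \<times> 'n)^('n \<times> 'n)" where
  "choi L = (\<chi> p q. L $ (fst p, fst q) $ (snd p, snd q))"

lemma trace_zero: "trace (0 :: complex^'k^'k) = 0"
  by (simp add: trace_def)

lemma trace_pairing:
  "trace (B ** X) = (\<Sum>p\<in>UNIV. B $ fst p $ snd p * (\<chi> p. X $ snd p $ fst p) $ p)"
proof -
  have "trace (B ** X) = (\<Sum>p\<in>UNIV \<times> UNIV. B $ fst p $ snd p * X $ snd p $ fst p)"
    by (simp add: trace_def matrix_matrix_mult_def sum.cartesian_product case_prod_beta)
  then show ?thesis by simp
qed

lemma full_altdef:
  fixes B :: "'i \<Rightarrow> complex^'n^'n"
  shows "spanning J B \<longleftrightarrow> (\<forall>v. (\<forall>w\<in>J. (\<Sum>p\<in>UNIV. B w $ fst p $ snd p * v $ p) = 0) \<longrightarrow> v = 0)"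
proof
  assume f: "spanning J B"
  show "\<forall>v. (\<forall>w\<in>J. (\<Sum>p\<in>UNIV. B w $ fst p $ snd p * v $ p) = 0) \<longrightarrow> v = 0"
  proof (intro allI impI)
    fix v :: "complex^('n \<times> 'n)"
    assume v: "\<forall>w\<in>J. (\<Sum>p\<in>UNIV. B w $ fst p $ snd p * v $ p) = 0"
    have "(\<chi> i j. v $ (j, i)) = 0"
      using f[unfolded spanning_def, rule_format, of "\<chi> i j. v $ (j, i)"] v
      by (simp add: trace_pairing)
    then show "v = 0" by (simp add: vec_eq_iff)
  qed
next
  assume *: "\<forall>v. (\<forall>w\<in>J. (\<Sum>p\<in>UNIV. B w $ fst p $ snd p * v $ p) = 0) \<longrightarrow> v = 0"
  show "spanning J B"
    unfolding spanning_def
  proof (intro allI impI)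
    fix X assume "\<forall>w\<in>J. trace (B w ** X) = 0"
    then have "(\<chi> p. X $ snd p $ fst p) = 0"
      using *[rule_format, of "\<chi> p. X $ snd p $ fst p"] by (simp add: trace_pairing)
    then show "X = 0" by (simp add: vec_eq_iff)
  qed
qed

lemma det_nz_iff_ker: "det (A :: 'a::field^'m^'m) \<noteq> 0 \<longleftrightarrow> (\<forall>x. A *v x = 0 \<longrightarrow> x = 0)"
  by (metis invertible_det_nz invertible_left_inverse matrix_left_invertible_ker)

text \<open>The Choi matrix is the sum of v v^H over the vectorised operators v, a positive
  semidefinite matrix. Its kernel is therefore, up to conjugation, the annihilator of the
  family.\<close>

lemma det_choi_iff_full:
  fixes B :: "'i \<Rightarrow> complex^'n^'n"
  assumes "finite J"
  shows "det (choi (kmap J B)) \<noteq> 0 \<longleftrightarrow> spanning J B"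
  unfolding det_nz_iff_ker full_altdef
proof (intro iffI allI impI)
  fix v :: "complex^('n \<times> 'n)"
  assume ker: "\<forall>x. choi (kmap J B) *v x = 0 \<longrightarrow> x = 0"
    and v: "\<forall>w\<in>J. (\<Sum>p\<in>UNIV. B w $ fst p $ snd p * v $ p) = 0"
  have "(choi (kmap J B) *v (\<chi> q. cnj (v $ q))) $ p
    = (\<Sum>w\<in>J. B w $ fst p $ snd p * cnj (\<Sum>q\<in>UNIV. B w $ fst q $ snd q * v $ q))" for p
    by (simp add: choi_def kmap_def matrix_vector_mult_def sum_distrib_left sum_distrib_right mult_ac)
       (rule sum.swap)
  then have "choi (kmap J B) *v (\<chi> q. cnj (v $ q)) = 0"
    using v by (simp add: vec_eq_iff del: cnj_sum)
  then have "(\<chi> q. cnj (v $ q)) = 0" using ker by blast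
  then show "v = 0" by (simp add: vec_eq_iff)
next
  fix x :: "complex^('n \<times> 'n)"
  assume spanning: "\<forall>v. (\<forall>w\<in>J. (\<Sum>p\<in>UNIV. B w $ fst p $ snd p * v $ p) = 0) \<longrightarrow> v = 0"
    and x: "choi (kmap J B) *v x = 0"
  define v where "v = (\<chi> q. cnj (x $ q))"
  have 0: "(\<Sum>q\<in>UNIV. kmap J B $ (fst p, fst q) $ (snd p, snd q) * cnj (v $ q)) = 0" for p
    using x by (simp add: vec_eq_iff choi_def matrix_vector_mult_def v_def)
  have "complex_of_real (\<Sum>k\<in>J. (norm (\<Sum>p\<in>UNIV. B k $ fst p $ snd p * v $ p))\<^sup>2)
    = (\<Sum>p\<in>UNIV. v $ p * (\<Sum>q\<in>UNIV. kmap J B $ (fst p, fst q) $ (snd p, snd q) * cnj (v $ q)))"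
    unfolding sum_norm_pairing by (simp add: sum_distrib_left mult_ac)
  also have "\<dots> = 0" by (simp only: 0) simp
  finally have "(\<Sum>k\<in>J. (norm (\<Sum>p\<in>UNIV. B k $ fst p $ snd p * v $ p))\<^sup>2) = 0"
    by (simp only: of_real_eq_0_iff)
  then have "\<forall>k\<in>J. (\<Sum>p\<in>UNIV. B k $ fst p $ snd p * v $ p) = 0"
    using assms by (subst (asm) sum_nonneg_eq_0_iff) auto
  then have "v = 0" using spanning by blast
  then show "x = 0" by (simp add: v_def vec_eq_iff)
qed

lemma full_rowmat_iff: "spanning I (rowmat M) \<longleftrightarrow> (\<forall>v. (\<forall>k\<in>I. (M *v v) $ k = 0) \<longrightarrow> v = 0)"
  by (simp add: full_altdef rowmat_def matrix_vector_mult_def)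

text \<open>In the backward direction \<open>r\<close> rows of an invertible matrix already have
  zero annihilator; fewer than D^2 vectors cannot achieve that.\<close>

lemma kraus_rank_full_iff_choi:
  fixes L :: "'n::finite supop"
  assumes "is_CP L"
  shows "kraus_rank L = CARD('n)^2 \<longleftrightarrow> det (choi L) \<noteq> 0"
proof
  assume "kraus_rank L = CARD('n)^2"
  then have "L \<in> CP_rank (card (UNIV :: ('n \<times> 'n) set))"
    using assms by (simp add: CP_rank_def card_cartesian_product power2_eq_square)
  then obtain M where M: "det M \<noteq> 0" "L = kmap (UNIV :: ('n \<times> 'n) set) (rowmat M)"
    using CP_rank_obtain by metis
  have "spanning UNIV (rowmat M)"
    using M(1) by (simp add: full_rowmat_iff det_nz_iff_ker vec_eq_iff)
  then show "det (choi L) \<noteq> 0" by (simp add: M(2) det_choi_iff_full)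
next
  assume d: "det (choi L) \<noteq> 0"
  have LC: "L \<in> CP_rank (kraus_rank L)" using assms by (simp add: CP_rank_def)
  have le: "kraus_rank L \<le> CARD('n \<times> 'n)" by (rule CP_rank_bound[OF LC])
  then obtain I :: "('n \<times> 'n) set" where I: "card I = kraus_rank L"
    using obtain_subset_with_card_n by metis
  obtain M where M: "det M \<noteq> 0" "L = kmap I (rowmat M)"
    using CP_rank_obtain[OF LC I] by metis
  have f: "spanning I (rowmat M)" using d by (simp add: M(2) det_choi_iff_full)
  have "CARD('n \<times> 'n) \<le> kraus_rank L"
  proof (rule ccontr)
    assume "\<not> CARD('n \<times> 'n) \<le> kraus_rank L"
    then have "card ((\<lambda>k. M $ k) ` I) < CARD('n \<times> 'n)"
      using I card_image_le[of I "\<lambda>k. M $ k"] by auto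
    then obtain x where x: "x \<noteq> 0" "\<And>f. f \<in> (\<lambda>k. M $ k) ` I \<Longrightarrow> (\<Sum>i\<in>UNIV. f $ i * x $ i) = 0"
      using exists_orthogonal_vector[of "(\<lambda>k. M $ k) ` I"] by auto
    then show False
      using f by (auto simp: full_rowmat_iff matrix_vector_mult_def)
  qed
  then show "kraus_rank L = CARD('n)^2"
    using le by (simp add: card_cartesian_product power2_eq_square)
qed

lemma kraus_rank_full_iff:
  fixes B :: "'i \<Rightarrow> complex^'n^'n"
  assumes "finite J"
  shows "kraus_rank (kmap J B) = CARD('n)^2 \<longleftrightarrow> spanning J B"
  using assms by (simp add: kraus_rank_full_iff_choi is_CP_kmap det_choi_iff_full)

section \<open>Words in the Kraus operators\<close>

primrec word :: "('i \<Rightarrow> complex^'n^'n) \<Rightarrow> 'i list \<Rightarrow> complex^'n^'n" where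
  "word A [] = mat 1"
| "word A (k # ks) = A k ** word A ks"

definition wset :: "'i set \<Rightarrow> nat \<Rightarrow> 'i list set" where
  "wset I n = {xs. set xs \<subseteq> I \<and> length xs = n}"

lemma finite_wset: "finite I \<Longrightarrow> finite (wset I n)"
  unfolding wset_def by (rule finite_lists_length_eq)

lemma wset_Suc: "wset I (Suc n) = (\<lambda>(k, w). k # w) ` (I \<times> wset I n)"
  by (auto simp: wset_def length_Suc_conv image_iff)

lemma apply_map_mult: "apply_map (L ** L') X = apply_map L (apply_map L' X)"
proof -
  have "apply_map (L ** L') X $ i $ j = apply_map L (apply_map L' X) $ i $ j" for i j
    by (simp add: apply_map_def matrix_matrix_mult_def sum_distrib_left sum_distrib_right mult_ac)
       (rule sum.swap)
  then show ?thesis by (simp add: vec_eq_iff)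
qed

lemma matrix_add_rdistrib': "(A + B) ** (C :: 'a::semiring_1^'k^'m) = A ** C + B ** C"
  by (simp add: matrix_matrix_mult_def vec_eq_iff distrib_right sum.distrib)

lemma matrix_diff_rdistrib': "(A - B) ** (C :: 'a::ring_1^'k^'m) = A ** C - B ** C"
  by (simp add: matrix_matrix_mult_def vec_eq_iff left_diff_distrib sum_subtractf)

lemma matrix_vector_sum_left: "sum f S *v (v :: 'a::semiring_1^'k) = (\<Sum>x\<in>S. f x *v v)"
  by (induction S rule: infinite_finite_induct) (auto simp: matrix_vector_mult_add_rdistrib)

lemma matrix_mult_sum_left: "sum f S ** (B :: 'a::semiring_1^'k^'m) = (\<Sum>x\<in>S. f x ** B)"
  by (induction S rule: infinite_finite_induct) (auto simp: matrix_add_rdistrib')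

lemma matrix_mult_sum_right: "(B :: 'a::semiring_1^'k^'m) ** sum f S = (\<Sum>x\<in>S. B ** f x)"
  by (induction S rule: infinite_finite_induct) (auto simp: matrix_add_ldistrib)

lemma map_pow_kmap:
  fixes A :: "'i \<Rightarrow> complex^'n^'n"
  shows "map_pow (kmap I A) n = kmap (wset I n) (word A)"
proof (induction n)
  case 0
  have "wset I 0 = {[]}" by (auto simp: wset_def)
  moreover have "apply_map (mat 1) X = X" for X :: "complex^'n^'n"
    by (simp add: apply_map_def mat_def vec_eq_iff if_distrib[of "\<lambda>x. x * _"] cong: if_cong)
  ultimately show ?case
    by (intro supop_eqI) (simp add: map_pow_def apply_kmap)
next
  case (Suc n)
  show ?case
  proof (rule supop_eqI)
    fix X
    have "apply_map (map_pow (kmap I A) (Suc n)) X = apply_map (kmap I A) (apply_map (map_pow (kmap I A) n) X)"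
      by (simp add: map_pow_def apply_map_mult)
    also have "\<dots> = (\<Sum>k\<in>I. \<Sum>w\<in>wset I n. word A (k # w) ** X ** adj (word A (k # w)))"
      by (simp add: Suc apply_kmap matrix_mult_sum_left matrix_mult_sum_right adj_mult matrix_mul_assoc)
    also have "\<dots> = (\<Sum>w\<in>wset I (Suc n). word A w ** X ** adj (word A w))"
      unfolding wset_Suc
      by (subst sum.reindex) (auto simp: inj_on_def sum.cartesian_product case_prod_beta)
    finally show "apply_map (map_pow (kmap I A) (Suc n)) X = apply_map (kmap (wset I (Suc n)) (word A)) X"
      by (simp add: apply_kmap)
  qed
qed

lemma primitive_kmap_iff:
  assumes "finite I"
  shows "primitive_map (kmap I A) \<longleftrightarrow> (\<exists>n. spanning (wset I n) (word A))"
  using assms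
  by (simp add: primitive_map_def is_CP_kmap map_pow_kmap kraus_rank_full_iff finite_wset)

text \<open>For each fixed \<open>n\<close> this is the non-vanishing of a polynomial in the entries
  of \<open>L\<close>: the source of openness, and along analytic paths the input to the identity
  theorem.\<close>

lemma primitive_iff_choi:
  "primitive_map L \<longleftrightarrow> is_CP L \<and> (\<exists>n. det (choi (map_pow L n)) \<noteq> 0)"
proof -
  have "is_CP (map_pow L n)" if "is_CP L" for n
    using that by (auto simp: is_CP_iff[of L] map_pow_kmap intro!: is_CP_kmap finite_wset)
  then show ?thesis
    by (auto simp: primitive_map_def kraus_rank_full_iff_choi)
qed

section \<open>Invariant subspaces\<close>

definition irr :: "'i set \<Rightarrow> ('i \<Rightarrow> complex^'n^'n) \<Rightarrow> bool" where
  "irr I A \<longleftrightarrow> (\<forall>W. vec.subspace W \<and> (\<forall>k\<in>I. \<forall>v\<in>W. A k *v v \<in> W) \<longrightarrow> W = {0} \<or> W = UNIV)"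

lemma irrD:
  assumes "irr I A" "vec.subspace W" "\<And>k v. k \<in> I \<Longrightarrow> v \<in> W \<Longrightarrow> A k *v v \<in> W"
  shows "W = {0} \<or> W = UNIV"
  using assms unfolding irr_def by blast

lemma subspace_fixed: "vec.subspace {u :: complex^'n. P *v u = u}"
  by (auto simp: vec.subspace_def matrix_vector_right_distrib vector_scalar_commute)

text \<open>The quadratic form of the sum at \<open>u\<close> is the sum of the squared norms of
  \<open>adj (B k) *v u\<close>.\<close>

lemma sum_mult_adj_eq_0:
  fixes B :: "'i \<Rightarrow> complex^'n^'n"
  assumes "(\<Sum>k\<in>I. B k ** adj (B k)) = 0" "finite I" "k \<in> I"
  shows "B k = 0"
proof -
  have "adj (B k) *v u = 0" for u
  proof -
    have "of_real (\<Sum>k\<in>I. (norm (adj (B k) *v u))\<^sup>2) = cip u ((\<Sum>k\<in>I. B k ** adj (B k)) *v u)"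
      by (simp add: matrix_vector_sum_left cip_sum_right cip_self[symmetric]
          matrix_vector_mul_assoc[symmetric] cip_adj' del: of_real_power)
    then have "(\<Sum>k\<in>I. (norm (adj (B k) *v u))\<^sup>2) = 0"
      using assms(1) by (simp del: of_real_sum)
    then show ?thesis using assms(2,3) by (subst (asm) sum_nonneg_eq_0_iff) auto
  qed
  then have "adj (B k) = 0" by (simp add: matrix_eq_iff_vec)
  then show ?thesis by (metis adj_0 adj_adj)
qed

text \<open>A subspace and its orthogonal projector P correspond. Invariance of the range means A P
  = P A P for every Kraus operator A, which gives the condition on the map. Conversely that
  condition is tested on X = 1 only: compressing the image of P by 1 - P gives zero, but also the
  sum of \<open>B k ** adj (B k)\<close> with B = (1 - P) A P, so every B vanishes.\<close>

lemma irreducible_kmap_iff: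
  fixes A :: "'i \<Rightarrow> complex^'n^'n"
  assumes I: "finite I"
  shows "irreducible_map (kmap I A) \<longleftrightarrow> irr I A"
proof
  assume L: "irreducible_map (kmap I A)"
  show "irr I A"
    unfolding irr_def
  proof (intro allI impI, elim conjE)
    fix W :: "(complex^'n) set"
    assume W: "vec.subspace W" and inv: "\<forall>k\<in>I. \<forall>v\<in>W. A k *v v \<in> W"
    obtain P where P: "P ** P = P" "adj P = P" "\<And>u. P *v u = u \<longleftrightarrow> u \<in> W"
      using orthogonal_projection_subspace[OF W] by metis
    have PW: "P *v u \<in> W" for u by (metis P(1,3) matrix_vector_mul_assoc)
    have AP: "P ** (A k ** P) = A k ** P" if "k \<in> I" for k
      using that inv PW P(3) by (simp add: matrix_eq_iff_vec matrix_vector_mul_assoc[symmetric])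
    have PA: "P ** adj (A k) ** P = P ** adj (A k)" if "k \<in> I" for k
      using arg_cong[OF AP[OF that], of adj] by (simp add: adj_mult P(2))
    have "\<exists>Y. apply_map (kmap I A) (P ** X ** P) = P ** Y ** P" for X
    proof
      have "apply_map (kmap I A) (P ** X ** P) = (\<Sum>k\<in>I. (A k ** P) ** X ** (P ** adj (A k)))"
        by (simp add: apply_kmap matrix_mul_assoc)
      also have "\<dots> = (\<Sum>k\<in>I. (P ** (A k ** P)) ** X ** (P ** adj (A k) ** P))"
        by (intro sum.cong refl) (simp only: AP PA)
      also have "\<dots> = P ** (\<Sum>k\<in>I. A k ** P ** X ** P ** adj (A k)) ** P"
        by (simp add: matrix_mult_sum_left matrix_mult_sum_right matrix_mul_assoc)
      finally show "apply_map (kmap I A) (P ** X ** P) = P ** (\<Sum>k\<in>I. A k ** P ** X ** P ** adj (A k)) ** P" .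
    qed
    then have "P = 0 \<or> P = mat 1" using L P unfolding irreducible_map_def by blast
    then show "W = {0} \<or> W = UNIV" using P(3) by (metis (no_types, lifting) UNIV_eq_I
        insertI1 matrix_vector_mul_lid matrix_vector_mult_0 singletonD subsetI subset_antisym)
  qed
next
  assume irr: "irr I A"
  show "irreducible_map (kmap I A)"
    unfolding irreducible_map_def
  proof (intro conjI allI impI; (elim conjE)?)
    show "is_CP (kmap I A)" by (rule is_CP_kmap[OF I])
    fix P :: "complex^'n^'n"
    assume P: "P ** P = P" "adj P = P" and inv: "\<forall>X. \<exists>Y. apply_map (kmap I A) (P ** X ** P) = P ** Y ** P"
    obtain Y where "apply_map (kmap I A) (P ** mat 1 ** P) = P ** Y ** P" using inv by blast
    then have Y: "(\<Sum>k\<in>I. A k ** P ** adj (A k)) = P ** Y ** P" by (simp add: apply_kmap P)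
    define B where "B k = (mat 1 - P) ** A k ** P" for k
    have Q: "(mat 1 - P) ** P = 0" by (simp add: matrix_diff_rdistrib' P)
    have "(\<Sum>k\<in>I. B k ** adj (B k)) = (\<Sum>k\<in>I. (mat 1 - P) ** (A k ** (P ** P) ** adj (A k)) ** (mat 1 - P))"
      by (simp add: B_def adj_mult adj_diff P(2) matrix_mul_assoc)
    also have "\<dots> = (mat 1 - P) ** (P ** Y ** P) ** (mat 1 - P)"
      unfolding P(1) Y[symmetric] by (simp add: matrix_mult_sum_left matrix_mult_sum_right)
    also have "\<dots> = 0" by (simp add: matrix_mul_assoc Q)
    finally have B0: "B k = 0" if "k \<in> I" for k using sum_mult_adj_eq_0[OF _ I that] by blast
    have "A k *v v \<in> {u. P *v u = u}" if "k \<in> I" "v \<in> {u. P *v u = u}" for k v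
    proof -
      have "B k *v v = A k *v v - P *v (A k *v v)"
        using that(2) by (simp add: B_def matrix_vector_mul_assoc[symmetric] matrix_vector_mult_diff_rdistrib)
      then show ?thesis using B0[OF that(1)] by simp
    qed
    then have "{u. P *v u = u} = {0} \<or> {u. P *v u = u} = UNIV"
      using irrD[OF irr subspace_fixed] by blast
    then show "P = 0 \<or> P = mat 1"
    proof
      assume 0: "{u. P *v u = u} = {0}"
      have "P *v u = 0" for u
        using 0 P(1) by (metis (mono_tags) matrix_vector_mul_assoc mem_Collect_eq singletonD)
      then show ?thesis by (simp add: matrix_eq_iff_vec)
    qed (auto simp: matrix_eq_iff_vec set_eq_iff)
  qed
qed

text \<open>Words preserve an invariant subspace, so every P Y (1 - P) is trace-orthogonal to all
  words and hence zero. A non-trivial projector is refuted by the rank-one choice Y =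
  \<open>outer u z\<close> with \<open>u\<close> in the subspace and \<open>z\<close> orthogonal to
  it.\<close>

lemma full_words_irr:
  fixes A :: "'i \<Rightarrow> complex^'n^'n"
  assumes "spanning (wset I n) (word A)"
  shows "irr I A"
  unfolding irr_def
proof (intro allI impI, elim conjE)
  fix W :: "(complex^'n) set"
  assume W: "vec.subspace W" and inv: "\<forall>k\<in>I. \<forall>v\<in>W. A k *v v \<in> W"
  obtain P where P: "P ** P = P" "adj P = P" "\<And>u. P *v u = u \<longleftrightarrow> u \<in> W"
    using orthogonal_projection_subspace[OF W] by metis
  have PW: "P *v u \<in> W" for u by (metis P(1,3) matrix_vector_mul_assoc)
  have wW: "word A w *v v \<in> W" if "set w \<subseteq> I" "v \<in> W" for w v
    using that inv by (induction w) (auto simp: matrix_vector_mul_assoc[symmetric])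
  have wP: "P ** (word A w ** P) = word A w ** P" if "set w \<subseteq> I" for w
    using that wW PW P(3) by (simp add: matrix_eq_iff_vec matrix_vector_mul_assoc[symmetric])
  have PY: "P ** Y ** (mat 1 - P) = 0" for Y
  proof -
    have "trace (word A w ** (P ** Y ** (mat 1 - P))) = 0" if "w \<in> wset I n" for w
    proof -
      have "trace (word A w ** (P ** Y ** (mat 1 - P))) = trace ((word A w ** P ** Y) ** (mat 1 - P))"
        by (simp add: matrix_mul_assoc)
      also have "\<dots> = trace ((mat 1 - P) ** (word A w ** P ** Y))"
        by (rule trace_mul_sym)
      also have "(mat 1 - P) ** (word A w ** P ** Y) = (word A w ** P - P ** (word A w ** P)) ** Y"
        by (simp add: matrix_diff_rdistrib' matrix_mul_assoc)
      also have "\<dots> = 0" using that wP by (simp add: wset_def)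
      finally show ?thesis by (simp add: trace_zero)
    qed
    then show ?thesis using assms unfolding spanning_def by blast
  qed
  show "W = {0} \<or> W = UNIV"
  proof (rule ccontr)
    assume "\<not> ?thesis"
    then obtain u v where u: "u \<in> W" "u \<noteq> 0" and v: "v \<notin> W"
      using vec.subspace_0[OF W] by blast
    define z where "z = v - P *v v"
    have z: "z \<noteq> 0" using v P(3)[of v] by (auto simp: z_def)
    have Pz: "P *v z = 0"
      by (simp add: z_def matrix_vector_mult_diff_distrib matrix_vector_mul_assoc P(1))
    have "(P ** outer u z ** (mat 1 - P)) *v z = cip z z *s u"
      using u(1) by (simp add: matrix_vector_mul_assoc[symmetric] matrix_vector_mult_diff_rdistrib Pz
          outer_vec vector_scalar_commute P(3))
    then have "cip z z *s u = 0" by (simp add: PY)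
    then show False using z u(2) by (simp only: vector_mul_eq_0 cip_self_eq_0) simp
  qed
qed

section \<open>Similarity transformations\<close>

lemma scaleR_matrix_mult_left: "(c *\<^sub>R A) ** (B :: complex^'k^'m) = c *\<^sub>R (A ** B)"
  by (simp add: matrix_matrix_mult_def vec_eq_iff scaleR_sum_right)

lemma scaleR_matrix_mult_right: "A ** (c *\<^sub>R (B :: complex^'k^'m)) = c *\<^sub>R (A ** B)"
  by (simp add: matrix_matrix_mult_def vec_eq_iff scaleR_sum_right)

lemma scaleR_matrix_vec: "(c *\<^sub>R (A :: complex^'k^'m)) *v x = c *\<^sub>R (A *v x)"
  by (simp add: matrix_vector_mult_def vec_eq_iff scaleR_sum_right)

lemma scaleR_matrix_vec_right: "(A :: complex^'k^'m) *v (c *\<^sub>R x) = c *\<^sub>R (A *v x)"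
  by (simp add: matrix_vector_mult_def vec_eq_iff scaleR_sum_right)

lemma trace_scaleR: "trace (c *\<^sub>R (A :: complex^'k^'k)) = c *\<^sub>R trace A"
  by (simp add: trace_def scaleR_sum_right)

text \<open>Inner factors \<open>G ** H\<close> cancel, and the scalar depends on the length of the
  word alone. So words of equal length are conjugated together and rescaled by the same
  factor.\<close>

lemma word_similar:
  fixes A :: "'i \<Rightarrow> complex^'n^'n" and H G :: "complex^'n^'n"
  assumes "H ** G = mat 1"
  shows "word (\<lambda>k. c *\<^sub>R (H ** A k ** G)) w = c ^ length w *\<^sub>R (H ** word A w ** G)"
proof -
  have GH: "G ** H = mat 1" using assms matrix_left_right_inverse by blast
  show ?thesis
  proof (induction w)
    case (Cons k w)
    have "H ** A k ** G ** (H ** word A w ** G) = H ** A k ** (G ** H) ** word A w ** G"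
      by (simp only: matrix_mul_assoc)
    then show ?case
      by (simp add: Cons scaleR_matrix_mult_left scaleR_matrix_mult_right GH matrix_mul_assoc mult.commute)
  qed (simp add: assms)
qed

lemma full_similar:
  fixes A :: "'i \<Rightarrow> complex^'n^'n" and H G :: "complex^'n^'n"
  assumes HG: "H ** G = mat 1" and c: "c \<noteq> 0" and f: "spanning (wset I n) (word A)"
  shows "spanning (wset I n) (word (\<lambda>k. c *\<^sub>R (H ** A k ** G)))"
  unfolding spanning_def
proof (intro allI impI)
  fix X :: "complex^'n^'n"
  assume X: "\<forall>w\<in>wset I n. trace (word (\<lambda>k. c *\<^sub>R (H ** A k ** G)) w ** X) = 0"
  have "trace (word A w ** (G ** X ** H)) = 0" if "w \<in> wset I n" for w
  proof -
    have "trace (word A w ** (G ** X ** H)) = trace ((word A w ** G ** X) ** H)"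
      by (simp add: matrix_mul_assoc)
    also have "\<dots> = trace (H ** (word A w ** G ** X))"
      by (rule trace_mul_sym)
    also have "\<dots> = trace (H ** word A w ** G ** X)"
      by (simp add: matrix_mul_assoc)
    finally show ?thesis
      using X that c by (simp add: word_similar[OF HG] scaleR_matrix_mult_left trace_scaleR)
  qed
  then have GXH: "G ** X ** H = 0" using f unfolding spanning_def by blast
  have "X = H ** G ** X ** (H ** G)" by (simp add: HG)
  also have "\<dots> = H ** (G ** X ** H) ** G" by (simp only: matrix_mul_assoc)
  finally show "X = 0" by (simp add: GXH)
qed

text \<open>The preimage under \<open>H\<close> of a subspace invariant for the new family is
  invariant for the old one.\<close>

lemma irr_similar:
  fixes A :: "'i \<Rightarrow> complex^'n^'n" and H G :: "complex^'n^'n"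
  assumes HG: "H ** G = mat 1" and c: "c \<noteq> 0" and irr: "irr I A"
  shows "irr I (\<lambda>k. c *\<^sub>R (H ** A k ** G))"
  unfolding irr_def
proof (intro allI impI, elim conjE)
  fix W :: "(complex^'n) set"
  assume W: "vec.subspace W" and inv: "\<forall>k\<in>I. \<forall>v\<in>W. (c *\<^sub>R (H ** A k ** G)) *v v \<in> W"
  have GH: "G ** H = mat 1" using HG matrix_left_right_inverse by blast
  have GHv: "G *v (H *v u) = u" and HGv: "H *v (G *v u) = u" for u
    by (simp_all add: matrix_vector_mul_assoc HG GH)
  have scl: "c *\<^sub>R u = of_real c *s u" for u :: "complex^'n" and c
    by (simp add: vec_eq_iff scaleR_conv_of_real[where 'a=complex])
  have S: "vec.subspace {u. H *v u \<in> W}"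
    using W by (auto simp: vec.subspace_def matrix_vector_right_distrib vector_scalar_commute)
  have "A k *v u \<in> {u. H *v u \<in> W}" if k: "k \<in> I" and u: "u \<in> {u. H *v u \<in> W}" for k u
  proof -
    have "(c *\<^sub>R (H ** A k ** G)) *v (H *v u) \<in> W" using inv k u by auto
    then have "c *\<^sub>R (H *v (A k *v u)) \<in> W"
      by (simp add: scaleR_matrix_vec matrix_vector_mul_assoc[symmetric] GHv)
    then have "of_real (1 / c) *s (of_real c *s (H *v (A k *v u))) \<in> W"
      unfolding scl by (rule vec.subspace_scale[OF W])
    then show ?thesis using c by (simp add: vector_smult_assoc)
  qed
  then have "{u. H *v u \<in> W} = {0} \<or> {u. H *v u \<in> W} = UNIV"
    using irrD[OF irr S] by blast
  then show "W = {0} \<or> W = UNIV"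
  proof
    assume 0: "{u. H *v u \<in> W} = {0}"
    have "v = 0" if "v \<in> W" for v
    proof -
      have "G *v v \<in> {u. H *v u \<in> W}" using that by (simp add: HGv)
      then have "G *v v = 0" using 0 by blast
      then show ?thesis by (metis HGv matrix_vector_mult_0_right)
    qed
    then show ?thesis using vec.subspace_0[OF W] by blast
  next
    assume "{u. H *v u \<in> W} = UNIV"
    then have "v \<in> W" for v by (metis HGv UNIV_I mem_Collect_eq)
    then show ?thesis by blast
  qed
qed

section \<open>Algebras of complex-valued functions\<close>

text \<open>Entire functions, functions real-analytic on a set and functions continuous on a set all
  form such an algebra. Determinants and words are polynomials in the entries, so one argument
  serves the three classes.\<close>

locale fun_alg =
  fixes C :: "('x \<Rightarrow> complex) \<Rightarrow> bool"
  assumes C_const: "C (\<lambda>x. c)"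
    and C_add: "C f \<Longrightarrow> C g \<Longrightarrow> C (\<lambda>x. f x + g x)"
    and C_mult: "C f \<Longrightarrow> C g \<Longrightarrow> C (\<lambda>x. f x * g x)"
begin

lemma C_diff: "C f \<Longrightarrow> C g \<Longrightarrow> C (\<lambda>x. f x - g x)"
  using C_add[of f "\<lambda>x. (-1) * g x"] C_mult[OF C_const[of "-1"], of g] by simp

lemma C_sum: "(\<And>i. i \<in> I \<Longrightarrow> C (f i)) \<Longrightarrow> C (\<lambda>x. \<Sum>i\<in>I. f i x)"
  by (induction I rule: infinite_finite_induct) (auto intro: C_const C_add)

lemma C_prod: "(\<And>i. i \<in> I \<Longrightarrow> C (f i)) \<Longrightarrow> C (\<lambda>x. \<Prod>i\<in>I. f i x)"
  by (induction I rule: infinite_finite_induct) (auto intro: C_const C_mult)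

lemma C_det:
  assumes "\<And>i j. C (\<lambda>x. F x $ i $ j)"
  shows "C (\<lambda>x. det (F x))"
  unfolding det_def by (intro C_sum C_mult C_const C_prod assms)

lemma C_matrix_mult:
  assumes "\<And>i j. C (\<lambda>x. F x $ i $ j)" "\<And>i j. C (\<lambda>x. G x $ i $ j)"
  shows "C (\<lambda>x. (F x ** G x) $ i $ j)"
  unfolding matrix_matrix_mult_def by (simp, intro C_sum C_mult assms)

lemma C_word:
  assumes "\<And>k i j. C (\<lambda>x. A x k $ i $ j)"
  shows "C (\<lambda>x. word (A x) w $ i $ j)"
  by (induction w arbitrary: i j) (auto intro: C_matrix_mult assms C_const simp: mat_def)

end

definition pd :: "complex^'n^'n \<Rightarrow> bool" where
  "pd X \<longleftrightarrow> adj X = X \<and> (\<forall>v. v \<noteq> 0 \<longrightarrow> 0 < Re (cip v (X *v v)))"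

lemma cip_herm_real: "adj X = X \<Longrightarrow> cip v (X *v v) \<in> \<real>"
  by (metis cip_adj cnj_cip Reals_cnj_iff)

lemma pd_mat_1: "pd (mat 1)"
  by (simp add: pd_def cip_self)

text \<open>The two extra closure properties are what Gram-Schmidt consumes. Continuous and
  real-analytic functions have them; holomorphic functions are not closed under conjugation.\<close>

locale star_alg = fun_alg C for C :: "('x \<Rightarrow> complex) \<Rightarrow> bool" +
  fixes S :: "'x set"
  assumes C_cnj: "C f \<Longrightarrow> C (\<lambda>x. cnj (f x))"
    and C_inv_csqrt: "C f \<Longrightarrow> (\<And>x. x \<in> S \<Longrightarrow> f x \<in> \<real> \<and> 0 < Re (f x)) \<Longrightarrow> C (\<lambda>x. inverse (csqrt (f x)))"
begin

lemma C_adj: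
  assumes "\<And>i j. C (\<lambda>x. F x $ i $ j)"
  shows "C (\<lambda>x. adj (F x) $ i $ j)"
  unfolding adj_def by (simp add: C_cnj assms)

lemma C_kmap:
  assumes "\<And>k i j. k \<in> I \<Longrightarrow> C (\<lambda>x. A x k $ i $ j)"
  shows "C (\<lambda>x. kmap I (A x) $ p $ q)"
  unfolding kmap_def by (simp, intro C_sum C_mult C_cnj assms)

lemma C_cip:
  assumes "\<And>i. C (\<lambda>x. u x $ i)" "\<And>i. C (\<lambda>x. v x $ i)"
  shows "C (\<lambda>x. cip (u x) (v x))"
  unfolding cip_def by (intro C_sum C_mult C_cnj assms)

lemma C_matrix_vec:
  assumes "\<And>i j. C (\<lambda>x. F x $ i $ j)" "\<And>i. C (\<lambda>x. v x $ i)"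
  shows "C (\<lambda>x. (F x *v v x) $ i)"
  unfolding matrix_vector_mult_def by (simp, intro C_sum C_mult assms)

end

section \<open>Gram-Schmidt orthonormalisation with respect to a positive definite form\<close>

definition gs_next :: "complex^'n^'n \<Rightarrow> 'n list \<Rightarrow> ('n \<Rightarrow> complex^'n) \<Rightarrow> 'n \<Rightarrow> complex^'n" where
  "gs_next H js g j = axis j 1 - (\<Sum>k\<in>set js. cip (g k) (H *v axis j 1) *s g k)"

text \<open>The list is worked off from its end; indices not yet treated carry 0. Normalising by
  \<open>csqrt\<close> keeps all entries inside an algebra of complex-valued functions.\<close>

primrec gs :: "complex^'n^'n \<Rightarrow> 'n list \<Rightarrow> 'n \<Rightarrow> complex^'n" where
  "gs H [] = (\<lambda>j. 0)"
| "gs H (j # js) = (gs H js)(j := inverse (csqrt (cip (gs_next H js (gs H js) j) (H *v gs_next H js (gs H js) j)))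
      *s gs_next H js (gs H js) j)"

text \<open>Triangularity. It makes coordinate \<open>j\<close> of the next residual equal to 1, so
  that the residual is non-zero and can be normalised.\<close>

lemma gs_support: "distinct js \<Longrightarrow> k \<in> set js \<Longrightarrow> a \<notin> set js \<Longrightarrow> gs H js k $ a = 0"
  by (induction js arbitrary: k a) (auto simp: gs_next_def axis_def)

lemma gs_next_nz: "distinct (j # js) \<Longrightarrow> gs_next H js (gs H js) j $ j = 1"
  by (simp add: gs_next_def gs_support)

lemma gs_next_pos:
  assumes "distinct (j # js)" "pd H"
  shows "cip (gs_next H js (gs H js) j) (H *v gs_next H js (gs H js) j) \<in> \<real>"
    and "0 < Re (cip (gs_next H js (gs H js) j) (H *v gs_next H js (gs H js) j))"
proof -
  have "gs_next H js (gs H js) j \<noteq> 0" using gs_next_nz[OF assms(1), of H] by auto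
  then show "0 < Re (cip (gs_next H js (gs H js) j) (H *v gs_next H js (gs H js) j))"
    using assms(2) by (simp add: pd_def)
qed (use assms(2) in \<open>simp add: cip_herm_real pd_def\<close>)

lemma gs_orthonormal:
  assumes "pd H" "distinct js" "i \<in> set js" "j \<in> set js"
  shows "cip (gs H js i) (H *v gs H js j) = (if i = j then 1 else 0)"
  using assms(2-)
proof (induction js arbitrary: i j)
  case (Cons k js)
  define g where "g = gs H js"
  define w where "w = gs_next H js g k"
  define q where "q = cip w (H *v w)"
  define t where "t = inverse (csqrt q)"
  have H: "adj H = H" using assms(1) by (simp add: pd_def)
  have sym: "cip u (H *v v) = cnj (cip v (H *v u))" for u v
    by (metis H cip_adj cnj_cip)
  have IH: "cip (g i) (H *v g j) = (if i = j then 1 else 0)" if "i \<in> set js" "j \<in> set js" for i j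
    using Cons that by (simp add: g_def)
  have gw: "cip (g i) (H *v w) = 0" if "i \<in> set js" for i
  proof -
    have "cip (g i) (H *v w) = cip (g i) (H *v axis k 1)
        - (\<Sum>l\<in>set js. cip (g l) (H *v axis k 1) * cip (g i) (H *v g l))"
      by (simp add: w_def gs_next_def matrix_vector_mult_diff_distrib cip_diff_right
          vec.sum vector_scalar_commute cip_sum_right cip_scale_right)
    also have "(\<Sum>l\<in>set js. cip (g l) (H *v axis k 1) * cip (g i) (H *v g l))
        = (\<Sum>l\<in>set js. if l = i then cip (g l) (H *v axis k 1) else 0)"
      by (intro sum.cong) (auto simp: IH that)
    finally show ?thesis using that by simp
  qed
  have wg: "cip w (H *v g i) = 0" if "i \<in> set js" for i
    using gw[OF that] sym[of w "g i"] by simp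
  have q: "q \<in> \<real>" "0 < Re q"
    using gs_next_pos[OF Cons.prems(1) assms(1)] by (simp_all add: q_def w_def g_def)
  obtain R where R: "q = of_real R" "0 < R" using q by (auto elim!: Reals_cases)
  have t: "t = of_real (1 / sqrt R)"
    using R(2) by (simp add: t_def R(1) csqrt_of_real_nonneg divide_inverse)
  have ttq: "cnj t * t * q = 1"
  proof -
    have "cnj t * t * q = of_real (1 / sqrt R * (1 / sqrt R) * R)"
      by (simp only: t R(1) complex_cnj_complex_of_real of_real_mult)
    also have "1 / sqrt R * (1 / sqrt R) * R = 1" using R(2) by simp
    finally show ?thesis by simp
  qed
  have g': "gs H (k # js) i = (if i = k then t *s w else g i)" for i
    by (simp add: g_def w_def q_def t_def)
  have k: "k \<notin> set js" using Cons.prems by simp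
  show ?case
    using Cons.prems(2,3) k ttq
    by (auto simp del: gs.simps simp: g' IH gw wg cip_scale_left cip_scale_right vector_scalar_commute q_def mult_ac)
qed simp

lemma gs_mat_1:
  assumes "distinct js" "j \<in> set js"
  shows "gs (mat 1) js j = axis j 1"
  using assms
proof (induction js arbitrary: j)
  case (Cons k js)
  have k: "k \<notin> set js" using Cons.prems by simp
  have cip_ax: "cip (axis i 1) (axis k 1) = (if i = k then 1 else 0)" for i k :: 'a
    by (simp add: cip_axis_left) (simp add: axis_def)
  have "(\<Sum>l\<in>set js. cip (gs (mat 1) js l) (axis k 1) *s gs (mat 1) js l) = 0"
    using Cons k by (intro sum.neutral) (auto simp: cip_ax)
  then have "gs_next (mat 1) js (gs (mat 1) js) k = axis k 1"
    by (simp add: gs_next_def)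
  then show ?case using Cons by (cases "j = k") (simp_all add: cip_ax)
qed simp

lemma (in star_alg) C_gs:
  assumes F: "\<And>i j. C (\<lambda>x. F x $ i $ j)" and pd: "\<And>x. x \<in> S \<Longrightarrow> pd (F x)"
    and "distinct js"
  shows "C (\<lambda>x. gs (F x) js k $ a)"
  using assms(3)
proof (induction js arbitrary: k a)
  case Nil
  then show ?case by (simp add: C_const)
next
  case (Cons j js)
  have IH: "C (\<lambda>x. gs (F x) js k $ a)" for k a using Cons by simp
  have ax: "C (\<lambda>x. axis j 1 $ a)" for a by (rule C_const)
  have nx: "C (\<lambda>x. gs_next (F x) js (gs (F x) js) j $ a)" for a
    unfolding gs_next_def by (simp, intro C_diff C_sum C_mult C_cip IH C_matrix_vec F ax)
  have "C (\<lambda>x. inverse (csqrt (cip (gs_next (F x) js (gs (F x) js) j) (F x *v gs_next (F x) js (gs (F x) js) j))))"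
    by (intro C_inv_csqrt C_cip C_matrix_vec F nx conjI gs_next_pos Cons.prems pd)
  then show ?case by (cases "k = j") (auto intro!: C_mult nx IH)
qed

text \<open>The orthonormalised vectors are the columns. The enumeration of the index type does not
  depend on \<open>H\<close>, so the entries vary with \<open>H\<close> as regularly as Gram-Schmidt
  does.\<close>

definition gsmat :: "complex^'n^'n \<Rightarrow> complex^'n^'n" where
  "gsmat H = (\<chi> a j. gs H (SOME js. set js = UNIV \<and> distinct js) j $ a)"

lemma some_enum: "set (SOME js :: 'n::finite list. set js = UNIV \<and> distinct js) = UNIV
    \<and> distinct (SOME js :: 'n::finite list. set js = UNIV \<and> distinct js)"
  by (rule someI_ex) (rule finite_distinct_list[OF finite])

lemma gsmat:
  assumes "pd H"
  shows "adj (gsmat H) ** H ** gsmat H = mat 1"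
proof -
  let ?js = "SOME js :: 'a list. set js = UNIV \<and> distinct js"
  have js: "set ?js = UNIV" "distinct ?js" using some_enum by blast+
  have "(adj (gsmat H) ** H ** gsmat H) $ i $ j = (mat 1 :: complex^'a^'a) $ i $ j" for i j
  proof -
    have "(adj (gsmat H) ** (H ** gsmat H)) $ i $ j = cip (gs H ?js i) (H *v gs H ?js j)"
      by (simp add: adj_def matrix_matrix_mult_def cip_def matrix_vector_mult_def gsmat_def)
    also have "\<dots> = mat 1 $ i $ j"
      using gs_orthonormal[OF assms, of ?js i j] js by (simp add: mat_def)
    finally show ?thesis by (simp add: matrix_mul_assoc)
  qed
  then show ?thesis by (simp add: vec_eq_iff)
qed

text \<open>The reason why both normalisations below fix trace-preserving tuples and hence the
  endpoints of paths.\<close>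

lemma gsmat_mat_1 [simp]: "gsmat (mat 1) = mat 1"
proof -
  have "gs (mat 1) (SOME js :: 'a list. set js = UNIV \<and> distinct js) j = axis j 1" for j :: 'a
    using some_enum by (intro gs_mat_1) auto
  then show ?thesis by (simp add: gsmat_def vec_eq_iff mat_def axis_def)
qed

lemma (in star_alg) C_gsmat:
  assumes "\<And>i j. C (\<lambda>x. F x $ i $ j)" "\<And>x. x \<in> S \<Longrightarrow> pd (F x)"
  shows "C (\<lambda>x. gsmat (F x) $ i $ j)"
  unfolding gsmat_def by (simp, rule C_gs[OF assms conjunct2[OF some_enum]])

section \<open>An explicit primitive family\<close>

text \<open>Lagrange interpolation: a polynomial of degree D - 1 that vanishes at all nodes except
  \<open>d b\<close> combines the given relations into a non-zero multiple of
  \<open>x b\<close>.\<close>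

lemma vandermonde_ker:
  fixes d :: "'n::finite \<Rightarrow> complex"
  assumes "inj d" and z: "\<And>s. s < CARD('n) \<Longrightarrow> (\<Sum>a\<in>UNIV. d a ^ s * x a) = 0"
  shows "x b = 0"
proof -
  define p where "p = (\<Prod>m\<in>UNIV - {b}. [:- d m, 1:])"
  have deg: "degree p = CARD('n) - 1"
    by (simp add: p_def degree_prod_eq_sum_degree)
  have pz: "poly p (d a) = 0" if "a \<noteq> b" for a
    using that by (auto simp: p_def poly_prod)
  have pb: "poly p (d b) \<noteq> 0"
    using assms(1) by (auto simp: p_def poly_prod inj_def)
  have "(\<Sum>a\<in>UNIV. poly p (d a) * x a) = (\<Sum>a\<in>UNIV. if a = b then poly p (d b) * x b else 0)"
    by (intro sum.cong) (auto simp: pz)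
  then have "poly p (d b) * x b = (\<Sum>a\<in>UNIV. poly p (d a) * x a)" by simp
  also have "\<dots> = (\<Sum>a\<in>UNIV. \<Sum>s\<le>degree p. coeff p s * (d a ^ s * x a))"
    by (simp add: poly_altdef sum_distrib_right mult.assoc)
  also have "\<dots> = (\<Sum>s\<le>degree p. coeff p s * (\<Sum>a\<in>UNIV. d a ^ s * x a))"
    by (subst sum.swap) (simp add: sum_distrib_left)
  also have "\<dots> = 0"
  proof (intro sum.neutral ballI)
    fix s assume "s \<in> {..degree p}"
    then have "s \<le> CARD('n) - 1" using deg by simp
    moreover have "0 < CARD('n)" by (simp add: card_gt_0_iff)
    ultimately have "s < CARD('n)" by linarith
    then show "coeff p s * (\<Sum>a\<in>UNIV. d a ^ s * x a) = 0" by (simp only: z mult_zero_right)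
  qed
  finally show ?thesis using pb by simp
qed

definition elem_index :: "'n::finite \<Rightarrow> nat" where
  "elem_index = (SOME f. bij_betw f UNIV {0..<CARD('n)})"

lemma bij_enum: "bij_betw (elem_index :: 'n::finite \<Rightarrow> nat) UNIV {0..<CARD('n)}"
  unfolding elem_index_def by (rule someI_ex[where P = "\<lambda>f. bij_betw f UNIV {0..<CARD('n)}"], rule ex_bij_betw_finite_nat) simp

lemma enum_less: "elem_index (a :: 'n::finite) < CARD('n)"
  using bij_enum[where 'n='n] by (auto simp: bij_betw_def)

lemma inj_enum: "inj (elem_index :: 'n::finite \<Rightarrow> nat)"
  using bij_enum by (auto simp: bij_betw_def)

lemma enum_surj: "s < CARD('n) \<Longrightarrow> \<exists>a :: 'n::finite. elem_index a = s"
  using bij_enum[where 'n='n] by (metis atLeast0LessThan bij_betw_def imageE lessThan_iff)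

text \<open>The word l^a k^m l^b, where (a,b) runs through all pairs of exponents below D. The
  padding by k gives all D^2 words the common length 2D, and m is at least 2.\<close>

definition twoword :: "'i \<Rightarrow> 'i \<Rightarrow> ('n::finite \<times> 'n) \<Rightarrow> 'i list" where
  "twoword k l p = replicate (elem_index (fst p)) l @
     replicate (2 * CARD('n) - elem_index (fst p) - elem_index (snd p)) k @ replicate (elem_index (snd p)) l"

lemma twoword_wset:
  fixes p :: "'n::finite \<times> 'n"
  shows "k \<in> I \<Longrightarrow> l \<in> I \<Longrightarrow> twoword k l p \<in> wset I (2 * CARD('n))"
  using enum_less[of "fst p"] enum_less[of "snd p"]
  by (auto simp: twoword_def wset_def)

text \<open>Non-zero exactly when the D^2 words form a basis of the matrix space. This is sufficient
  for primitivity, and unlike the determinant of a Choi matrix it is polynomial in the Kraus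
  operators without conjugates, hence holomorphic along holomorphic curves.\<close>

definition wdet :: "'i \<Rightarrow> 'i \<Rightarrow> ('i \<Rightarrow> complex^'n^'n) \<Rightarrow> complex" where
  "wdet k l A = det (\<chi> p q. word A (twoword k l p) $ fst q $ snd q :: complex^('n \<times> 'n)^('n \<times> 'n))"

lemma wdet_full:
  fixes A :: "'i \<Rightarrow> complex^'n^'n"
  assumes "wdet k l A \<noteq> 0" "k \<in> I" "l \<in> I"
  shows "spanning (wset I (2 * CARD('n))) (word A)"
  unfolding full_altdef
proof (intro allI impI)
  fix v :: "complex^('n \<times> 'n)"
  assume v: "\<forall>w\<in>wset I (2 * CARD('n)). (\<Sum>p\<in>UNIV. word A w $ fst p $ snd p * v $ p) = 0"
  have "twoword k l p \<in> wset I (2 * CARD('n))" for p :: "'n \<times> 'n"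
    by (rule twoword_wset[OF assms(2,3)])
  then have "(\<Sum>q\<in>UNIV. word A (twoword k l p) $ fst q $ snd q * v $ q) = 0" for p :: "'n \<times> 'n"
    using v by blast
  then have "(\<chi> p q. word A (twoword k l p) $ fst q $ snd q :: complex^('n \<times> 'n)^('n \<times> 'n)) *v v = 0"
    by (simp add: vec_eq_iff matrix_vector_mult_def)
  then show "v = 0" using assms(1) unfolding wdet_def det_nz_iff_ker by blast
qed

lemma (in fun_alg) C_wdet:
  assumes "\<And>k i j. C (\<lambda>x. A x k $ i $ j)"
  shows "C (\<lambda>x. wdet k l (A x))"
  unfolding wdet_def by (rule C_det) (simp add: C_word assms)

lemma word_append: "word A (v @ w) = word A v ** word A w"
  by (induction v) (simp_all add: matrix_mul_assoc)

text \<open>Operator \<open>k\<close> is the projector onto the uniform vector, with all entries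
  1/D, and \<open>l\<close> is diagonal with distinct entries. Powers of \<open>k\<close> collapse,
  so the word l^a k^m l^b has entries d_i^a d_j^b / D, and the matrix of words is a multiple of a
  tensor product of two Vandermonde matrices.\<close>

lemma exists_primitive_matrix:
  fixes k l :: "'n::finite \<times> 'n"
  assumes D: "CARD('n) \<ge> 2" and kl: "k \<noteq> l"
  obtains E :: "complex^('n \<times> 'n)^('n \<times> 'n)" where "det E \<noteq> 0" "wdet k l (rowmat E) \<noteq> 0"
proof -
  \<comment> \<open>The nodes are 1, ..., D: besides being distinct they are non-zero, which is used
    for the independence of the two operators. An off-diagonal position, available since D is at
    least 2, separates them.\<close>
  define d :: "'n \<Rightarrow> complex" where "d a = of_nat (Suc (elem_index a))" for a
  have injd: "inj d" using inj_enum by (auto simp: d_def inj_def)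
  have d0: "d a \<noteq> 0" for a unfolding d_def by (metis nat.distinct(1) of_nat_eq_0_iff)
  define v :: "'n \<times> 'n \<Rightarrow> complex^('n \<times> 'n)" where
    "v i = (if i = k then (\<chi> q. 1 / of_nat CARD('n)) else (\<chi> q. if fst q = snd q then d (fst q) else 0))" for i
  obtain a b :: 'n where ab: "a \<noteq> b"
    using D by (metis One_nat_def Suc_1 card_le_Suc0_iff_eq UNIV_I finite not_less_eq_eq)
  have ind: "c i = 0" if c: "(\<Sum>i\<in>{k, l}. c i *s v i) = 0" and i: "i \<in> {k, l}" for c i
  proof -
    have e: "c k * v k $ q + c l * v l $ q = 0" for q
      using arg_cong[OF c, of "\<lambda>x. x $ q"] kl by simp
    have ck: "c k = 0" using e[of "(a, b)"] ab kl by (simp add: v_def)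
    have "c l = 0" using e[of "(a, a)"] kl d0[of a] by (simp add: v_def ck)
    then show ?thesis using ck i by auto
  qed
  obtain E :: "complex^('n \<times> 'n)^('n \<times> 'n)" where E: "det E \<noteq> 0" "\<And>i. i \<in> {k, l} \<Longrightarrow> E $ i = v i"
    using rows_extend_invertible[where I = "{k, l}" and v = v] ind by blast
  have Ek: "rowmat E k = (\<chi> i j. 1 / of_nat CARD('n))"
    by (simp add: rowmat_def E(2) v_def)
  have El: "rowmat E l = (\<chi> i j. if i = j then d i else 0)"
    using kl by (simp add: rowmat_def E(2) v_def vec_eq_iff)
  have wl: "word (rowmat E) (replicate m l) = (\<chi> i j. if i = j then d i ^ m else 0)" for m
  proof (induction m)
    case (Suc m)
    then show ?case
      by (simp add: El matrix_matrix_mult_def vec_eq_iff if_distrib[of "\<lambda>x. x * _"] if_distrib[of "\<lambda>x. _ * x"] cong: if_cong)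
  qed (simp add: mat_def vec_eq_iff)
  have wk: "word (rowmat E) (replicate (Suc m) k) = rowmat E k" for m
  proof (induction m)
    case (Suc m)
    have "rowmat E k ** rowmat E k = rowmat E k"
      by (simp add: Ek matrix_matrix_mult_def vec_eq_iff)
    then show ?case using Suc by simp
  qed simp
  have W: "word (rowmat E) (twoword k l p) $ i $ j = d i ^ elem_index (fst p) * (1 / of_nat CARD('n)) * d j ^ elem_index (snd p)"
    for p :: "'n \<times> 'n" and i j
  proof -
    have "2 * CARD('n) - elem_index (fst p) - elem_index (snd p) = Suc (2 * CARD('n) - elem_index (fst p) - elem_index (snd p) - 1)"
      using enum_less[of "fst p"] enum_less[of "snd p"] by simp
    then have "word (rowmat E) (replicate (2 * CARD('n) - elem_index (fst p) - elem_index (snd p)) k) = rowmat E k"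
      by (metis wk)
    then have "word (rowmat E) (twoword k l p) =
       (\<chi> i j. if i = j then d i ^ elem_index (fst p) else 0) ** rowmat E k ** (\<chi> i j. if i = j then d i ^ elem_index (snd p) else 0)"
      unfolding twoword_def word_append wl by (simp add: matrix_mul_assoc)
    then show ?thesis
      by (simp add: Ek matrix_matrix_mult_def sum_divide_distrib[symmetric] if_distrib[of "\<lambda>x. x * _"] if_distrib[of "\<lambda>x. _ * x"] cong: if_cong)
  qed
  have "wdet k l (rowmat E) \<noteq> 0"
    unfolding wdet_def det_nz_iff_ker
  proof (intro allI impI)
    fix x :: "complex^('n \<times> 'n)"
    assume x: "(\<chi> p q. word (rowmat E) (twoword k l p) $ fst q $ snd q :: complex^('n \<times> 'n)^('n \<times> 'n)) *v x = 0"
    have st: "(\<Sum>i\<in>UNIV. d i ^ s * (\<Sum>j\<in>UNIV. d j ^ t * x $ (i, j))) = 0"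
      if s: "s < CARD('n)" and t: "t < CARD('n)" for s t
    proof -
      obtain a b :: 'n where ab: "elem_index a = s" "elem_index b = t"
        using enum_surj[OF s] enum_surj[OF t] by blast
      have "0 = (\<Sum>q\<in>UNIV \<times> UNIV. d (fst q) ^ s * (1 / of_nat CARD('n)) * d (snd q) ^ t * x $ q)"
        using arg_cong[OF x, of "\<lambda>y. y $ (a, b)"] by (simp add: matrix_vector_mult_def W ab)
      also have "\<dots> = (1 / of_nat CARD('n)) * (\<Sum>i\<in>UNIV. \<Sum>j\<in>UNIV. d i ^ s * d j ^ t * x $ (i, j))"
        unfolding sum.cartesian_product by (simp add: sum_distrib_left case_prod_beta mult_ac)
      finally have "(1 / of_nat CARD('n)) * (\<Sum>i\<in>UNIV. \<Sum>j\<in>UNIV. d i ^ s * d j ^ t * x $ (i, j)) = 0"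
        by (rule sym)
      then have "1 / of_nat CARD('n) = (0 :: complex) \<or> (\<Sum>i\<in>UNIV. \<Sum>j\<in>UNIV. d i ^ s * d j ^ t * x $ (i, j)) = 0"
        by (rule mult_eq_0_iff[THEN iffD1])
      then have "(\<Sum>i\<in>UNIV. \<Sum>j\<in>UNIV. d i ^ s * d j ^ t * x $ (i, j)) = 0"
        by (rule disjE) simp_all
      then show ?thesis by (simp add: sum_distrib_left mult_ac)
    qed
    have "(\<Sum>j\<in>UNIV. d j ^ t * x $ (i, j)) = 0" if "t < CARD('n)" for i t
      using vandermonde_ker[OF injd, of "\<lambda>i. \<Sum>j\<in>UNIV. d j ^ t * x $ (i, j)"] st that by blast
    then have "x $ (i, j) = 0" for i j
      using vandermonde_ker[OF injd, of "\<lambda>j. x $ (i, j)"] by blast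
    then show "x = 0" by (simp add: vec_eq_iff)
  qed
  then show ?thesis using that E(1) by blast
qed

section \<open>Real-analytic functions\<close>

text \<open>Real analyticity through holomorphic extensions makes the closure properties immediate.\<close>

definition real_analytic_at :: "real \<Rightarrow> (real \<Rightarrow> complex) \<Rightarrow> bool" where
  "real_analytic_at t0 f \<longleftrightarrow> (\<exists>e>0. \<exists>F. F holomorphic_on ball (of_real t0) e \<and> (\<forall>t. \<bar>t - t0\<bar> < e \<longrightarrow> f t = F (of_real t)))"

lemma of_real_in_ball: "complex_of_real t \<in> ball (of_real t0) e \<longleftrightarrow> \<bar>t - t0\<bar> < e"
  by (simp add: dist_commute dist_real_def)

lemma ra_holomorphic:
  assumes "F holomorphic_on UNIV"
  shows "real_analytic_at t0 (\<lambda>t. F (of_real t))"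
  unfolding real_analytic_at_def using assms by (intro exI[of _ 1] exI[of _ F]) (auto intro: holomorphic_on_subset)

lemma ra_common:
  assumes "real_analytic_at t0 f" "real_analytic_at t0 g"
  obtains e F G where "e > 0" "F holomorphic_on ball (of_real t0) e" "G holomorphic_on ball (of_real t0) e"
    "\<And>t. \<bar>t - t0\<bar> < e \<Longrightarrow> f t = F (of_real t)" "\<And>t. \<bar>t - t0\<bar> < e \<Longrightarrow> g t = G (of_real t)"
proof -
  obtain d F where F: "d > 0" "F holomorphic_on ball (of_real t0) d" "\<And>t. \<bar>t - t0\<bar> < d \<Longrightarrow> f t = F (of_real t)"
    using assms(1) unfolding real_analytic_at_def by blast
  obtain e G where G: "e > 0" "G holomorphic_on ball (of_real t0) e" "\<And>t. \<bar>t - t0\<bar> < e \<Longrightarrow> g t = G (of_real t)"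
    using assms(2) unfolding real_analytic_at_def by blast
  show ?thesis
    by (rule that[of "min d e" F G])
       (use F G in \<open>auto intro: holomorphic_on_subset\<close>)
qed

lemma ra_const: "real_analytic_at t0 (\<lambda>t. c)"
  by (rule ra_holomorphic[of "\<lambda>z. c"]) simp

lemma ra_add:
  assumes "real_analytic_at t0 f" "real_analytic_at t0 g"
  shows "real_analytic_at t0 (\<lambda>t. f t + g t)"
proof -
  obtain e F G where *: "e > 0" "F holomorphic_on ball (of_real t0) e" "G holomorphic_on ball (of_real t0) e"
    "\<And>t. \<bar>t - t0\<bar> < e \<Longrightarrow> f t = F (of_real t)" "\<And>t. \<bar>t - t0\<bar> < e \<Longrightarrow> g t = G (of_real t)"
    using ra_common[OF assms] by blast
  show ?thesis unfolding real_analytic_at_def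
    by (intro exI[of _ e] exI[of _ "\<lambda>z. F z + G z"] conjI holomorphic_on_add *) (use * in auto)
qed

lemma ra_mult:
  assumes "real_analytic_at t0 f" "real_analytic_at t0 g"
  shows "real_analytic_at t0 (\<lambda>t. f t * g t)"
proof -
  obtain e F G where *: "e > 0" "F holomorphic_on ball (of_real t0) e" "G holomorphic_on ball (of_real t0) e"
    "\<And>t. \<bar>t - t0\<bar> < e \<Longrightarrow> f t = F (of_real t)" "\<And>t. \<bar>t - t0\<bar> < e \<Longrightarrow> g t = G (of_real t)"
    using ra_common[OF assms] by blast
  show ?thesis unfolding real_analytic_at_def
    by (intro exI[of _ e] exI[of _ "\<lambda>z. F z * G z"] conjI holomorphic_on_mult *) (use * in auto)
qed

text \<open>Schwarz reflection: cnj o F o cnj is holomorphic, and on the real line it agrees with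
  the conjugate of F. A ball with real centre is stable under conjugation.\<close>

lemma ra_cnj:
  assumes "real_analytic_at t0 f"
  shows "real_analytic_at t0 (\<lambda>t. cnj (f t))"
proof -
  obtain e F where *: "e > 0" "F holomorphic_on ball (of_real t0) e" "\<And>t. \<bar>t - t0\<bar> < e \<Longrightarrow> f t = F (of_real t)"
    using assms unfolding real_analytic_at_def by blast
  have "cnj ` ball (of_real t0) e \<subseteq> ball (of_real t0) e"
  proof safe
    fix z :: complex assume "z \<in> ball (of_real t0) e"
    moreover have "norm (of_real t0 - cnj z) = norm (of_real t0 - z)"
      by (metis complex_cnj_complex_of_real complex_cnj_diff complex_mod_cnj)
    ultimately show "cnj z \<in> ball (of_real t0) e" by (simp add: dist_norm)
  qed
  then have "cnj \<circ> F \<circ> cnj holomorphic_on ball (of_real t0) e"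
    by (intro holomorphic_on_compose_cnj_cnj holomorphic_on_subset[OF *(2)]) auto
  then show ?thesis unfolding real_analytic_at_def
    by (intro exI[of _ e] exI[of _ "cnj \<circ> F \<circ> cnj"] conjI *) (use * in auto)
qed

text \<open>On a smaller ball the extension has positive real part, away from the branch cut of the
  root and from zero.\<close>

lemma ra_inv_csqrt:
  assumes "real_analytic_at t0 f" "f t0 \<in> \<real>" "0 < Re (f t0)"
  shows "real_analytic_at t0 (\<lambda>t. inverse (csqrt (f t)))"
proof -
  obtain e F where *: "e > 0" "F holomorphic_on ball (of_real t0) e" "\<And>t. \<bar>t - t0\<bar> < e \<Longrightarrow> f t = F (of_real t)"
    using assms(1) unfolding real_analytic_at_def by blast
  have "continuous_on (ball (of_real t0) e) F"
    using *(2) by (rule holomorphic_on_imp_continuous_on)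
  then have "isCont F (of_real t0)"
    using *(1) by (simp add: continuous_on_eq_continuous_at)
  then obtain d where d: "d > 0" "\<And>z. dist z (of_real t0) < d \<Longrightarrow> dist (F z) (F (of_real t0)) < Re (f t0)"
    using assms(3) unfolding continuous_at_eps_delta by (auto simp: dist_commute)
  define m where "m = min d e"
  have m: "m > 0" "m \<le> e" "m \<le> d" using d(1) *(1) by (auto simp: m_def)
  have pos: "0 < Re (F z)" if "z \<in> ball (of_real t0) m" for z
  proof -
    have "dist (F z) (F (of_real t0)) < Re (f t0)"
      using that m by (intro d) (simp add: dist_commute)
    moreover have "F (of_real t0) = f t0" using *(3)[of t0] *(1) by simp
    ultimately have "\<bar>Re (F z) - Re (f t0)\<bar> < Re (f t0)"
      using abs_Re_le_cmod[of "F z - f t0"] by (simp add: dist_norm)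
    then show ?thesis by linarith
  qed
  have F: "F holomorphic_on ball (of_real t0) m"
    using m(2) by (intro holomorphic_on_subset[OF *(2)] subset_ball)
  have np: "F z \<notin> \<real>\<^sub>\<le>\<^sub>0" if "z \<in> ball (of_real t0) m" for z
    using pos[OF that] by (auto elim!: nonpos_Reals_cases)
  have nz: "F z \<noteq> 0" if "z \<in> ball (of_real t0) m" for z using pos[OF that] by auto
  have "(\<lambda>z. inverse (csqrt (F z))) holomorphic_on ball (of_real t0) m"
    using np nz by (intro holomorphic_intros F) auto
  then show ?thesis unfolding real_analytic_at_def
    by (intro exI[of _ m] exI[of _ "\<lambda>z. inverse (csqrt (F z))"] conjI m) (use * m in auto)
qed

interpretation analytic: star_alg "\<lambda>f. \<forall>t0\<in>S. real_analytic_at t0 f" S for S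
  by unfold_locales (auto intro: ra_const ra_add ra_mult ra_cnj ra_inv_csqrt)

interpretation continuous: star_alg "\<lambda>f :: 'x::topological_space \<Rightarrow> complex. continuous_on S f" S for S
proof
  fix f :: "'x \<Rightarrow> complex"
  assume f: "continuous_on S f" and pos: "\<And>x. x \<in> S \<Longrightarrow> f x \<in> \<real> \<and> 0 < Re (f x)"
  have "f x \<notin> \<real>\<^sub>\<le>\<^sub>0" if "x \<in> S" for x using pos[OF that] by (auto elim!: nonpos_Reals_cases)
  moreover have nz: "f x \<noteq> 0" if "x \<in> S" for x using pos[OF that] by auto
  ultimately have "continuous_on S (\<lambda>x. csqrt (f x))"
    by (intro continuous_on_compose2[OF continuous_on_csqrt f]) auto
  then show "continuous_on S (\<lambda>x. inverse (csqrt (f x)))"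
    using nz by (intro continuous_on_inverse) auto
qed (auto intro!: continuous_intros)

interpretation entire: fun_alg "\<lambda>f. f holomorphic_on UNIV"
  by unfold_locales (auto intro!: holomorphic_intros)

section \<open>Power series, continuity and zeros of real-analytic functions\<close>

lemma ra_real_analytic:
  assumes "\<forall>t0\<in>S. real_analytic_at t0 f"
  shows "real_analytic_on S f"
  unfolding real_analytic_on_def
proof
  fix t0 assume "t0 \<in> S"
  then obtain e F where *: "e > 0" "F holomorphic_on ball (of_real t0) e" "\<And>t. \<bar>t - t0\<bar> < e \<Longrightarrow> f t = F (of_real t)"
    using assms unfolding real_analytic_at_def by blast
  have "(\<lambda>n. ((deriv ^^ n) F (of_real t0) / fact n) * of_real (t - t0) ^ n) sums f t" if t: "\<bar>t - t0\<bar> < e" for t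
    using holomorphic_power_series[OF *(2), of "of_real t"] *(3)[OF t] t
    unfolding of_real_in_ball by simp
  then show "\<exists>e>0. \<exists>c. \<forall>t. \<bar>t - t0\<bar> < e \<longrightarrow> (\<lambda>n. c n * of_real (t - t0) ^ n) sums f t"
    by (intro exI[of _ e] conjI exI[of _ "\<lambda>n. (deriv ^^ n) F (of_real t0) / fact n"] allI impI *(1))
qed

lemma ra_isCont:
  assumes "real_analytic_at t0 f"
  shows "isCont f t0"
proof -
  obtain e F where *: "e > 0" "F holomorphic_on ball (of_real t0) e" "\<And>t. \<bar>t - t0\<bar> < e \<Longrightarrow> f t = F (of_real t)"
    using assms unfolding real_analytic_at_def by blast
  have "isCont F (of_real t0)"
    using holomorphic_on_imp_continuous_on[OF *(2)] *(1) by (simp add: continuous_on_eq_continuous_at)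
  moreover have "isCont complex_of_real t0" by (intro continuous_intros)
  ultimately have "isCont (\<lambda>t. F (of_real t)) t0" by (rule isCont_o2[rotated])
  moreover have "\<forall>\<^sub>F t in nhds t0. F (of_real t) = f t"
    unfolding eventually_nhds_metric using * by (auto simp: dist_real_def)
  ultimately show ?thesis by (subst (asm) isCont_cong)
qed

lemma ra_dichotomy:
  assumes "real_analytic_at t0 f"
  shows "(\<exists>e>0. \<forall>t. \<bar>t - t0\<bar> < e \<longrightarrow> f t = 0) \<or> (\<exists>e>0. \<forall>t. 0 < \<bar>t - t0\<bar> \<and> \<bar>t - t0\<bar> < e \<longrightarrow> f t \<noteq> 0)"
proof -
  obtain e F where *: "e > 0" "F holomorphic_on ball (of_real t0) e" "\<And>t. \<bar>t - t0\<bar> < e \<Longrightarrow> f t = F (of_real t)"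
    using assms unfolding real_analytic_at_def by blast
  consider "F (of_real t0) \<noteq> 0" | "\<forall>z\<in>ball (of_real t0) e. F z = 0" | \<beta> where "F (of_real t0) = 0" "\<beta> \<in> ball (of_real t0) e" "F \<beta> \<noteq> 0"
    by blast
  then show ?thesis
  proof cases
    case 1
    then have "f t0 \<noteq> 0" using *(1) *(3)[of t0] by simp
    then obtain d where "d > 0" "\<And>t. dist t0 t < d \<Longrightarrow> f t \<noteq> 0"
      using continuous_at_avoid[OF ra_isCont[OF assms]] by blast
    then show ?thesis by (intro disjI2 exI[of _ d]) (auto simp: dist_real_def abs_minus_commute)
  next
    case 2
    then show ?thesis using * by (intro disjI1 exI[of _ e]) (auto simp: of_real_in_ball simp del: mem_ball)
  next
    case 3
    have cb: "of_real t0 \<in> ball (complex_of_real t0) e" using *(1) by simp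
    obtain r where r: "0 < r" "ball (complex_of_real t0) r \<subseteq> ball (of_real t0) e"
      "\<And>z. z \<in> ball (of_real t0) r - {of_real t0} \<Longrightarrow> F z \<noteq> 0"
      by (rule isolated_zeros[OF *(2) open_ball connected_ball cb 3]) (rule that, assumption, assumption, blast)
    have "f t \<noteq> 0" if "0 < \<bar>t - t0\<bar>" "\<bar>t - t0\<bar> < r" for t
    proof -
      have b: "complex_of_real t \<in> ball (of_real t0) r" using that(2) unfolding of_real_in_ball .
      then have "complex_of_real t \<in> ball (of_real t0) e" using r(2) by blast
      then have "f t = F (of_real t)" using *(3) unfolding of_real_in_ball by blast
      moreover have "F (of_real t) \<noteq> 0" using r(3) b that(1) by auto
      ultimately show ?thesis by simp
    qed
    then show ?thesis using r(1) by blast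
  qed
qed

text \<open>The identity theorem by connectedness of (0,1]: \<open>U\<close>, where \<open>p\<close>
  vanishes locally, and \<open>V\<close>, where it has no zeros in a punctured neighbourhood, are
  open, cover the interval and are disjoint on it. The point 1 lies in \<open>V\<close>; if the
  claim failed, the midpoint of (0, min \<epsilon> 1) would lie in \<open>U\<close>.\<close>

lemma ra_nonzero_near_0:
  assumes "\<And>t. t \<in> {0..1} \<Longrightarrow> real_analytic_at t p" "p 1 \<noteq> 0" "0 < \<epsilon>"
  obtains t where "0 < t" "t < \<epsilon>" "t \<le> 1" "p t \<noteq> 0"
proof (rule ccontr)
  assume c: "\<not> thesis"
  note result = that
  define U where "U = {t. \<exists>e>0. \<forall>s. \<bar>s - t\<bar> < e \<longrightarrow> p s = 0}"
  define V where "V = {t. \<exists>e>0. \<forall>s. 0 < \<bar>s - t\<bar> \<and> \<bar>s - t\<bar> < e \<longrightarrow> p s \<noteq> 0}"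
  have oU: "open U"
    unfolding open_dist
  proof safe
    fix t assume "t \<in> U"
    then obtain e where e: "e > 0" "\<And>s. \<bar>s - t\<bar> < e \<Longrightarrow> p s = 0" by (auto simp: U_def)
    have "y \<in> U" if y: "dist y t < e" for y
    proof -
      have "p s = 0" if "\<bar>s - y\<bar> < e - \<bar>y - t\<bar>" for s
        using that by (intro e) linarith
      then show ?thesis using y unfolding U_def dist_real_def by (auto intro!: exI[of _ "e - \<bar>y - t\<bar>"])
    qed
    then show "\<exists>e>0. \<forall>y. dist y t < e \<longrightarrow> y \<in> U" using e(1) by blast
  qed
  have oV: "open V"
    unfolding open_dist
  proof safe
    fix t assume tV: "t \<in> V"
    then obtain e where e: "e > 0" "\<And>s. 0 < \<bar>s - t\<bar> \<Longrightarrow> \<bar>s - t\<bar> < e \<Longrightarrow> p s \<noteq> 0" by (auto simp: V_def)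
    have "y \<in> V" if y: "dist y t < e" for y
    proof (cases "y = t")
      case False
      have "p s \<noteq> 0" if "\<bar>s - y\<bar> < min (e - \<bar>y - t\<bar>) \<bar>y - t\<bar>" for s
        using that by (intro e) linarith+
      moreover have "min (e - \<bar>y - t\<bar>) \<bar>y - t\<bar> > 0" using False y by (auto simp: dist_real_def)
      ultimately show ?thesis unfolding V_def by blast
    qed (use tV in simp)
    then show "\<exists>e>0. \<forall>y. dist y t < e \<longrightarrow> y \<in> V" using e(1) by blast
  qed
  have disj: "U \<inter> V \<inter> {0<..1} = {}"
  proof safe
    fix t assume "t \<in> U" "t \<in> V"
    then obtain d e where de: "d > 0" "\<And>s. \<bar>s - t\<bar> < d \<Longrightarrow> p s = 0" "e > 0" "\<And>s. 0 < \<bar>s - t\<bar> \<Longrightarrow> \<bar>s - t\<bar> < e \<Longrightarrow> p s \<noteq> 0"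
      unfolding U_def V_def by auto
    have "\<bar>(t + min d e / 2) - t\<bar> < d" "0 < \<bar>(t + min d e / 2) - t\<bar>" "\<bar>(t + min d e / 2) - t\<bar> < e"
      using de(1,3) by (auto simp: min_def)
    then have False using de by blast
    then show "t \<in> {}" ..
  qed
  have cover: "{0<..1} \<subseteq> U \<union> V"
  proof
    fix t :: real assume "t \<in> {0<..1}"
    then have "real_analytic_at t p" by (intro assms) auto
    then show "t \<in> U \<union> V" using ra_dichotomy unfolding U_def V_def by auto
  qed
  have "connected {0<..1::real}" by simp
  then have dj: "U \<inter> {0<..1} = {} \<or> V \<inter> {0<..1} = {}"
    by (rule connectedD[OF _ oU oV disj cover])
  have "1 \<notin> U"
  proof
    assume "1 \<in> U"
    then obtain e where "e > 0" "\<And>s. \<bar>s - 1\<bar> < e \<Longrightarrow> p s = 0" by (auto simp: U_def)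
    from this(2)[of 1] this(1) show False using assms(2) by simp
  qed
  then have "1 \<in> V" using subsetD[OF cover, of 1] by auto
  moreover have "min \<epsilon> 1 / 2 \<in> U"
  proof -
    have "p s = 0" if "\<bar>s - min \<epsilon> 1 / 2\<bar> < min \<epsilon> 1 / 2" for s
    proof (rule ccontr)
      assume "p s \<noteq> 0"
      moreover have "0 < s" "s < \<epsilon>" "s \<le> 1" using that assms(3) by (auto simp: min_def abs_less_iff abs_if split: if_splits)
      ultimately show False using c result by blast
    qed
    then show ?thesis using assms(3) unfolding U_def by (auto intro!: exI[of _ "min \<epsilon> 1 / 2"])
  qed
  ultimately show False using dj assms(3) by (auto simp: disjoint_iff)
qed

section \<open>Analytic paths with primitive interior\<close>

lemma countable_zeros_entire:
  assumes "q holomorphic_on UNIV" "q z0 \<noteq> 0"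
  shows "countable {z. q z = 0}"
proof (cases "q constant_on UNIV")
  case True
  then have "{z. q z = 0} = {}" using assms(2) by (auto simp: constant_on_def)
  then show ?thesis by simp
next
  case False
  then show ?thesis using holomorphic_countable_zeros[OF assms(1)] by (simp add: fsigma_UNIV connected_UNIV)
qed

text \<open>The curves \<open>t + i s t (1 - t)\<close>, \<open>0 < t < 1\<close>, are pairwise disjoint for different \<open>s\<close>.\<close>

lemma avoiding_curve:
  assumes "q holomorphic_on UNIV" "q z0 \<noteq> 0"
  obtains s :: real where "\<And>t. 0 < t \<Longrightarrow> t < 1 \<Longrightarrow> q (of_real t + \<i> * of_real (s * (t * (1 - t)))) \<noteq> 0"
proof -
  define B where "B = (\<lambda>z. Im z / (Re z * (1 - Re z))) ` {z. q z = 0}"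
  have "countable B" unfolding B_def by (intro countable_image countable_zeros_entire[OF assms])
  then have "UNIV - B \<noteq> {}" using uncountable_UNIV_real by (metis Diff_eq_empty_iff countable_subset)
  then obtain s where s: "s \<notin> B" by blast
  show ?thesis
  proof (rule that[of s])
    fix t :: real assume t: "0 < t" "t < 1"
    show "q (of_real t + \<i> * of_real (s * (t * (1 - t)))) \<noteq> 0" (is "q ?z \<noteq> 0")
    proof
      assume "q ?z = 0"
      then have "Im ?z / (Re ?z * (1 - Re ?z)) \<in> B" unfolding B_def by blast
      moreover have "Im ?z / (Re ?z * (1 - Re ?z)) = s" using t by simp
      ultimately show False using s by simp
    qed
  qed
qed

text \<open>Only the open interval avoids the zeros of \<open>q\<close>, so the endpoints may be
  zeros. A path can thus start at a map that is not primitive, as density and the sets of all and of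
  irreducible maps require.\<close>

lemma primitive_interior_path:
  fixes M0 M1 :: "complex^('n \<times> 'n)^('n::finite \<times> 'n)"
  assumes D: "CARD('n) \<ge> 2" and kl: "k \<noteq> l"
  obtains M :: "real \<Rightarrow> complex^('n \<times> 'n)^('n \<times> 'n)"
  where "M 0 = M0" "M 1 = M1" "\<And>t0 i j. real_analytic_at t0 (\<lambda>t. M t $ i $ j)"
    "\<And>t. 0 < t \<Longrightarrow> t < 1 \<Longrightarrow> det (M t) \<noteq> 0 \<and> wdet k l (rowmat (M t)) \<noteq> 0"
proof -
  obtain E :: "complex^('n \<times> 'n)^('n \<times> 'n)" where E: "det E \<noteq> 0" "wdet k l (rowmat E) \<noteq> 0"
    using exists_primitive_matrix[OF D kl] by blast
  \<comment> \<open>The factor 4 z (1 - z) vanishes at 0 and 1 and equals 1 at 1/2, where the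
    bracket moves the midpoint of the chord to \<open>E\<close>.\<close>
  define N :: "complex \<Rightarrow> complex^('n \<times> 'n)^('n \<times> 'n)" where "N z = (\<chi> i j. (1 - z) * M0 $ i $ j + z * M1 $ i $ j
      + 4 * z * (1 - z) * (E $ i $ j - (M0 $ i $ j + M1 $ i $ j) / 2))" for z
  have hol: "(\<lambda>z. N z $ i $ j) holomorphic_on UNIV" for i j
    unfolding N_def by (simp, intro holomorphic_intros)
  define q where "q z = det (N z) * wdet k l (rowmat (N z))" for z
  have "q holomorphic_on UNIV"
    unfolding q_def by (intro entire.C_mult entire.C_det entire.C_wdet hol) (simp add: rowmat_def hol)
  moreover have "N (1/2) = E" by (simp add: N_def vec_eq_iff field_simps)
  then have "q (1/2) \<noteq> 0" using E by (simp add: q_def)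
  ultimately obtain s :: real where s: "\<And>t. 0 < t \<Longrightarrow> t < 1 \<Longrightarrow> q (of_real t + \<i> * of_real (s * (t * (1 - t)))) \<noteq> 0"
    using avoiding_curve by metis
  \<comment> \<open>The bent parameter curve as an entire function of a complex argument, so that
    the composition with \<open>N\<close> is real-analytic at every point, the endpoints
    included.\<close>
  define c where "c z = z + \<i> * (of_real s * (z * (1 - z)))" for z :: complex
  have c: "c (of_real t) = of_real t + \<i> * of_real (s * (t * (1 - t)))" for t
    by (simp add: c_def)
  have "c holomorphic_on UNIV" unfolding c_def by (intro holomorphic_intros)
  then have "(\<lambda>z. N (c z) $ i $ j) holomorphic_on UNIV" for i j
    using holomorphic_on_compose_gen[OF _ hol, of c UNIV] by (simp add: o_def)
  then have an: "real_analytic_at t0 (\<lambda>t. N (c (of_real t)) $ i $ j)" for t0 i j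
    by (rule ra_holomorphic)
  show ?thesis
  proof (rule that[of "\<lambda>t. N (c (of_real t))"])
    show "N (c (of_real 0)) = M0" "N (c (of_real 1)) = M1"
      by (simp_all add: c_def N_def vec_eq_iff)
    fix t :: real assume "0 < t" "t < 1"
    then have "q (c (of_real t)) \<noteq> 0" using s unfolding c by blast
    then show "det (N (c (of_real t))) \<noteq> 0 \<and> wdet k l (rowmat (N (c (of_real t)))) \<noteq> 0"
      by (simp add: q_def)
  qed (rule an)
qed

section \<open>Openness of primitivity and irreducibility\<close>

lemma continuous_on_matrix:
  fixes f :: "'x::topological_space \<Rightarrow> complex^'k^'m"
  assumes "\<And>i j. continuous_on S (\<lambda>x. f x $ i $ j)"
  shows "continuous_on S f"
proof -
  have "continuous_on S (\<lambda>x. \<chi> i j. f x $ i $ j)"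
    by (intro continuous_on_vec_lambda assms)
  then show ?thesis by simp
qed

lemma continuous_on_entry: "continuous_on S f \<Longrightarrow> continuous_on S (\<lambda>x. f x $ i $ j :: complex)"
  by (intro continuous_intros)

lemma (in fun_alg) C_map_pow:
  assumes "\<And>i j. C (\<lambda>x. F x $ i $ j)"
  shows "C (\<lambda>x. map_pow (F x) n $ i $ j)"
proof (induction n arbitrary: i j)
  case 0
  then show ?case by (simp add: map_pow_def C_const)
next
  case (Suc n)
  have "map_pow (F x) (Suc n) = F x ** map_pow (F x) n" for x by (simp add: map_pow_def)
  then show ?case by (simp add: C_matrix_mult assms Suc)
qed

lemma (in fun_alg) C_det_choi:
  assumes "\<And>i j. C (\<lambda>x. F x $ i $ j)"
  shows "C (\<lambda>x. det (choi (map_pow (F x) n)))"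
  by (rule C_det) (simp add: choi_def C_map_pow assms)

lemma open_primitive: "open {L. \<exists>n. det (choi (map_pow L n)) \<noteq> 0}"
proof -
  have "open {L :: 'n::finite supop. det (choi (map_pow L n)) \<noteq> 0}" for n
    by (intro open_Collect_neq continuous.C_det_choi continuous_intros)
  then have "open (\<Union>n. {L :: 'n::finite supop. det (choi (map_pow L n)) \<noteq> 0})" by blast
  then show ?thesis by (simp add: Collect_ex_eq)
qed

section \<open>Compactness of the set of non-trivial projections\<close>

lemma norm_matrix_le:
  fixes M :: "complex^'k^'m"
  assumes "\<And>i j. norm (M $ i $ j) \<le> B"
  shows "norm M \<le> of_nat CARD('m) * (of_nat CARD('k) * B)"
proof -
  have "norm (M $ i) \<le> of_nat CARD('k) * B" for i
  proof -
    have "norm (M $ i) \<le> (\<Sum>j\<in>UNIV. norm (M $ i $ j))"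
      unfolding norm_vec_def by (rule L2_set_le_sum) auto
    also have "\<dots> \<le> (\<Sum>j\<in>(UNIV :: 'k set). B)" by (intro sum_mono assms)
    finally show ?thesis by simp
  qed
  then have "(\<Sum>i\<in>UNIV. norm (M $ i)) \<le> (\<Sum>i\<in>(UNIV :: 'm set). of_nat CARD('k) * B)"
    by (intro sum_mono)
  moreover have "norm M \<le> (\<Sum>i\<in>UNIV. norm (M $ i))"
    unfolding norm_vec_def[of M] by (rule L2_set_le_sum) auto
  ultimately show ?thesis by simp
qed

lemma matrix_vec_axis: "(P :: complex^'n^'m) *v axis j 1 = column j P"
  by (simp add: matrix_vector_mult_def column_def axis_def vec_eq_iff if_distrib[of "\<lambda>x. _ * x"] cong: if_cong)

text \<open>For column c_j of an orthogonal projection, the squared norm of c_j is the diagonal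
  entry P_jj, which is at most the norm of c_j; so that norm is at most 1.\<close>

lemma projection_entry_le_1:
  fixes P :: "complex^'n^'n"
  assumes "P ** P = P" "adj P = P"
  shows "norm (P $ i $ j) \<le> 1"
proof -
  have "cip (P *v axis j 1) (P *v axis j 1) = cip (axis j 1) (adj P *v (P *v axis j 1))"
    by (rule cip_adj)
  also have "\<dots> = cip (axis j 1) (P *v axis j 1)"
    by (simp add: assms matrix_vector_mul_assoc)
  also have "\<dots> = P $ j $ j"
    by (simp add: cip_axis_left matrix_vec_axis column_def)
  finally have e: "P $ j $ j = of_real ((norm (column j P))\<^sup>2)"
    by (simp add: cip_self matrix_vec_axis)
  have le: "norm (P $ k $ j) \<le> norm (column j P)" for k
    using Finite_Cartesian_Product.norm_nth_le[of "column j P" k] by (simp add: column_def)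
  have "(norm (column j P))\<^sup>2 \<le> norm (column j P)"
    using le[of j] unfolding e by (simp add: norm_power)
  moreover have "norm (column j P) * 1 < norm (column j P) * norm (column j P)" if "1 < norm (column j P)"
    using that by (intro mult_strict_left_mono) auto
  ultimately have "norm (column j P) \<le> 1"
    by (force simp: power2_eq_square)
  then show ?thesis using le[of i] by simp
qed

type_synonym 'n pvv = "(complex^'n^'n) \<times> (complex^'n) \<times> (complex^'n)"

definition proj_set :: "'n::finite pvv set" where
  "proj_set = {(P, u, v). P ** P = P \<and> adj P = P \<and> norm u = 1 \<and> norm v = 1 \<and> P *v u = u \<and> P *v v = 0}"

text \<open>The unit vectors witnessing that the projection is neither \<open>0\<close> nor \<open>1\<close> make the set closed.\<close>

lemma proj_set_iff:
  fixes P :: "complex^'n^'n"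
  shows "(\<exists>u v. (P, u, v) \<in> proj_set) \<longleftrightarrow> P ** P = P \<and> adj P = P \<and> P \<noteq> 0 \<and> P \<noteq> mat 1"
proof
  assume "\<exists>u v. (P, u, v) \<in> proj_set"
  then show "P ** P = P \<and> adj P = P \<and> P \<noteq> 0 \<and> P \<noteq> mat 1"
    by (auto simp: proj_set_def)
next
  assume P: "P ** P = P \<and> adj P = P \<and> P \<noteq> 0 \<and> P \<noteq> mat 1"
  have "\<exists>x. P *v x \<noteq> 0"
    using P by (metis matrix_eq_iff_vec matrix_vector_mult_0)
  then obtain x where x: "P *v x \<noteq> 0" by blast
  have "\<exists>y. P *v y \<noteq> y"
    using P by (metis matrix_eq_iff_vec matrix_vector_mul_lid)
  then obtain y where y: "P *v y \<noteq> y" by blast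
  define u where "u = (1 / norm (P *v x)) *\<^sub>R (P *v x)"
  define v where "v = (1 / norm (y - P *v y)) *\<^sub>R (y - P *v y)"
  have "norm u = 1" "norm v = 1" using x y by (simp_all add: u_def v_def)
  moreover have "P *v u = u" "P *v v = 0"
    using P by (simp_all add: u_def v_def scaleR_matrix_vec_right matrix_vector_mult_diff_distrib matrix_vector_mul_assoc)
  ultimately show "\<exists>u v. (P, u, v) \<in> proj_set" using P by (auto simp: proj_set_def)
qed

lemma compact_proj_set: "compact (proj_set :: 'n::finite pvv set)"
proof -
  have c1: "continuous_on UNIV (\<lambda>x :: 'n pvv. fst x $ i $ j)" for i j
    by (intro continuous_intros)
  have c2: "continuous_on UNIV (\<lambda>x :: 'n pvv. fst (snd x) $ i)" for i by (intro continuous_intros)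
  have c3: "continuous_on UNIV (\<lambda>x :: 'n pvv. snd (snd x) $ i)" for i by (intro continuous_intros)
  have eq: "proj_set = {x :: 'n pvv. (\<forall>i j. (fst x ** fst x) $ i $ j = fst x $ i $ j)
      \<and> (\<forall>i j. adj (fst x) $ i $ j = fst x $ i $ j) \<and> norm (fst (snd x)) = 1 \<and> norm (snd (snd x)) = 1
      \<and> (\<forall>i. (fst x *v fst (snd x)) $ i = fst (snd x) $ i) \<and> (\<forall>i. (fst x *v snd (snd x)) $ i = 0)}"
    by (auto simp: proj_set_def vec_eq_iff)
  have "closed (proj_set :: 'n pvv set)"
    unfolding eq
    by (intro closed_Collect_conj closed_Collect_all closed_Collect_eq continuous.C_matrix_mult
        continuous.C_adj continuous.C_matrix_vec c1 c2 c3 continuous_intros)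
  moreover have "bounded (proj_set :: 'n pvv set)"
  proof (rule bounded_subset)
    have "bounded (cball (0 :: complex^'n^'n) (of_nat CARD('n) * (of_nat CARD('n) * 1)))"
      by (rule bounded_cball)
    then show "bounded (cball (0 :: complex^'n^'n) (of_nat CARD('n) * (of_nat CARD('n) * 1)) \<times> cball (0 :: complex^'n) 1 \<times> cball (0 :: complex^'n) 1)"
      by (intro bounded_Times bounded_cball)
    show "proj_set \<subseteq> cball (0 :: complex^'n^'n) (of_nat CARD('n) * (of_nat CARD('n) * 1)) \<times> cball (0 :: complex^'n) 1 \<times> cball (0 :: complex^'n) 1"
    proof
      fix x :: "'n pvv" assume "x \<in> proj_set"
      then obtain P u v where x: "x = (P, u, v)" "P ** P = P" "adj P = P" "norm u = 1" "norm v = 1"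
        by (auto simp: proj_set_def)
      have "norm P \<le> of_nat CARD('n) * (of_nat CARD('n) * 1)"
        by (rule norm_matrix_le) (rule projection_entry_le_1[OF x(2,3)])
      then show "x \<in> cball (0 :: complex^'n^'n) (of_nat CARD('n) * (of_nat CARD('n) * 1)) \<times> cball (0 :: complex^'n) 1 \<times> cball (0 :: complex^'n) 1"
        using x by simp
    qed
  qed
  ultimately show ?thesis by (simp add: compact_eq_bounded_closed)
qed

text \<open>The existential over \<open>Y\<close> in \<open>irreducible_map\<close> becomes the
  equation P L(P X P) P = L(P X P), a closed condition on the pair of map and projection.\<close>

definition reducible :: "'n::finite supop set" where
  "reducible = {L. \<exists>z\<in>proj_set. \<forall>X. fst z ** apply_map L (fst z ** X ** fst z) ** fst z = apply_map L (fst z ** X ** fst z)}"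

lemma irreducible_iff: "irreducible_map L \<longleftrightarrow> is_CP L \<and> L \<notin> reducible"
proof -
  have *: "(\<exists>Y. A = P ** Y ** P) \<longleftrightarrow> P ** A ** P = A" if "P ** P = P" for A P :: "complex^'n^'n"
  proof
    assume "\<exists>Y. A = P ** Y ** P"
    then obtain Y where "A = P ** Y ** P" by blast
    then have "P ** A ** P = (P ** P) ** Y ** (P ** P)" by (simp add: matrix_mul_assoc)
    then show "P ** A ** P = A" using that \<open>A = _\<close> by simp
  qed metis
  have "L \<in> reducible \<longleftrightarrow> (\<exists>P. P ** P = P \<and> adj P = P \<and> P \<noteq> 0 \<and> P \<noteq> mat 1 \<and>
      (\<forall>X. P ** apply_map L (P ** X ** P) ** P = apply_map L (P ** X ** P)))"
  proof -
    have "L \<in> reducible \<longleftrightarrow> (\<exists>P. (\<exists>u v. (P, u, v) \<in> proj_set) \<and>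
        (\<forall>X. P ** apply_map L (P ** X ** P) ** P = apply_map L (P ** X ** P)))"
      unfolding reducible_def by force
    then show ?thesis unfolding proj_set_iff by (simp only: conj_assoc)
  qed
  also have "\<dots> \<longleftrightarrow> (\<exists>P. P ** P = P \<and> adj P = P \<and> P \<noteq> 0 \<and> P \<noteq> mat 1 \<and>
      (\<forall>X. \<exists>Y. apply_map L (P ** X ** P) = P ** Y ** P))"
    using * by metis
  finally show ?thesis unfolding irreducible_map_def by blast
qed

text \<open>The projection of a closed set along the compact factor \<open>proj_set\<close> is
  closed.\<close>

lemma closed_reducible: "closed (reducible :: 'n::finite supop set)"
proof -
  define R where "R = {x :: 'n supop \<times> 'n pvv. \<forall>X. \<forall>i j. (fst (snd x) ** apply_map (fst x) (fst (snd x) ** X ** fst (snd x)) ** fst (snd x)) $ i $ j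
     = apply_map (fst x) (fst (snd x) ** X ** fst (snd x)) $ i $ j}"
  have c1: "continuous_on UNIV (\<lambda>x :: 'n supop \<times> 'n pvv. fst (snd x) $ i $ j)" for i j by (intro continuous_intros)
  have c2: "continuous_on UNIV (\<lambda>x :: 'n supop \<times> 'n pvv. fst x $ i $ j)" for i j by (intro continuous_intros)
  have c3: "continuous_on UNIV (\<lambda>x :: 'n supop \<times> 'n pvv. (fst (snd x) ** X ** fst (snd x)) $ i $ j)" for X i j
    by (intro continuous.C_matrix_mult c1 continuous_on_const)
  have c4: "continuous_on UNIV (\<lambda>x :: 'n supop \<times> 'n pvv. apply_map (fst x) (fst (snd x) ** X ** fst (snd x)) $ i $ j)" for X i j
    unfolding apply_map_def by (simp, intro continuous_on_sum continuous_on_mult c2 c3)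
  have "closed R"
    unfolding R_def
    by (intro closed_Collect_all closed_Collect_eq continuous.C_matrix_mult c1 c4)
  have red: "reducible = {L. \<exists>z\<in>proj_set. (L, z) \<in> R}"
    unfolding reducible_def R_def by (simp add: vec_eq_iff)
  show ?thesis
    unfolding closed_sequential_limits
  proof (intro allI impI, elim conjE)
    fix f :: "nat \<Rightarrow> 'n supop" and L
    assume f: "\<forall>n. f n \<in> reducible" and lim: "f \<longlonglongrightarrow> L"
    have "\<forall>n. \<exists>z. z \<in> proj_set \<and> (f n, z) \<in> R" using f unfolding red by blast
    from choice[OF this] obtain z where z: "\<And>n. z n \<in> proj_set" "\<And>n. (f n, z n) \<in> R"
      by blast
    obtain w s where w: "w \<in> proj_set" "strict_mono s" "(z \<circ> s) \<longlonglongrightarrow> w"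
      using compact_proj_set z(1) unfolding compact_def by blast
    have "(\<lambda>n. (f (s n), z (s n))) \<longlonglongrightarrow> (L, w)"
      using LIMSEQ_subseq_LIMSEQ[OF lim w(2)] w(3) by (intro tendsto_Pair) (simp_all add: o_def)
    then have "(L, w) \<in> R"
      by (rule closed_sequentially[OF \<open>closed R\<close>, rotated]) (rule z(2))
    then show "L \<in> reducible" using w(1) unfolding red by blast
  qed
qed

section \<open>The sets without trace preservation\<close>

lemma ra_continuous_matrix:
  assumes "\<And>i j t0. t0 \<in> S \<Longrightarrow> real_analytic_at t0 (\<lambda>t. g t $ i $ j)"
  shows "continuous_on S g"
  by (intro continuous_on_matrix continuous_at_imp_continuous_on ballI ra_isCont assms)

lemma analytic_pathsI:
  fixes Z :: "'n::finite supop set"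
  assumes "\<And>L0 L1. L0 \<in> Z \<Longrightarrow> L1 \<in> Z \<Longrightarrow> \<exists>g. g 0 = L0 \<and> g 1 = L1 \<and> (\<forall>t\<in>{0..1}. g t \<in> Z)
    \<and> (\<forall>a b. \<forall>t0\<in>{0..1}. real_analytic_at t0 (\<lambda>t. g t $ a $ b))"
  shows "analytic_path_connected Z \<and> path_connected Z"
proof
  show "analytic_path_connected Z"
    unfolding analytic_path_connected_def using assms ra_real_analytic by meson
  show "path_connected Z"
    unfolding path_connected_def
  proof (intro ballI)
    fix L0 L1 assume "L0 \<in> Z" "L1 \<in> Z"
    then obtain g where g: "g 0 = L0" "g 1 = L1" "\<forall>t\<in>{0..1}. g t \<in> Z" "\<forall>a b. \<forall>t0\<in>{0..1}. real_analytic_at t0 (\<lambda>t. g t $ a $ b)"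
      using assms by blast
    have "path g" unfolding path_def using g(4) by (intro ra_continuous_matrix) auto
    then show "\<exists>g. path g \<and> path_image g \<subseteq> Z \<and> pathstart g = L0 \<and> pathfinish g = L1"
      using g by (intro exI[of _ g]) (auto simp: path_image_def pathstart_def pathfinish_def)
  qed
qed

lemma index_set:
  assumes "r \<ge> 2" "r \<le> CARD('n \<times> 'n)"
  obtains I :: "('n::finite \<times> 'n) set" and k l where "card I = r" "k \<in> I" "l \<in> I" "k \<noteq> l"
proof -
  obtain I :: "('n \<times> 'n) set" where I: "card I = r"
    using obtain_subset_with_card_n assms(2) by metis
  then obtain k l where "k \<in> I" "l \<in> I" "k \<noteq> l"
    using assms(1) by (metis One_nat_def Suc_1 card_le_Suc0_iff_eq finite not_less_eq_eq)
  then show ?thesis using that I by blast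
qed

lemma Prim_rankI:
  fixes M :: "complex^('n \<times> 'n)^('n::finite \<times> 'n)"
  assumes "det M \<noteq> 0" "wdet k l (rowmat M) \<noteq> 0" "k \<in> I" "l \<in> I"
  shows "kmap I (rowmat M) \<in> Prim_rank (card I)"
  using CP_rank_kmap[OF assms(1), of I] wdet_full[OF assms(2-)]
  by (auto simp: Prim_rank_def primitive_kmap_iff)

lemma CP_rank_path:
  fixes M0 M1 :: "complex^('n \<times> 'n)^('n::finite \<times> 'n)" and I :: "('n \<times> 'n) set"
  assumes D: "CARD('n) \<ge> 2" and I: "card I \<ge> 2"
  obtains M :: "real \<Rightarrow> complex^('n \<times> 'n)^('n \<times> 'n)"
  where "M 0 = M0" "M 1 = M1" "\<And>t0 i j. real_analytic_at t0 (\<lambda>t. M t $ i $ j)"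
    "\<And>t. 0 < t \<Longrightarrow> t < 1 \<Longrightarrow> det (M t) \<noteq> 0"
    "\<And>t. 0 < t \<Longrightarrow> t < 1 \<Longrightarrow> kmap I (rowmat (M t)) \<in> Prim_rank (card I)"
proof -
  obtain k l where kl: "k \<in> I" "l \<in> I" "k \<noteq> l"
    using I by (metis One_nat_def Suc_1 card_le_Suc0_iff_eq finite not_less_eq_eq)
  obtain M :: "real \<Rightarrow> complex^('n \<times> 'n)^('n \<times> 'n)" where M: "M 0 = M0" "M 1 = M1"
     "\<And>t0 i j. real_analytic_at t0 (\<lambda>t. M t $ i $ j)"
     "\<And>t. 0 < t \<Longrightarrow> t < 1 \<Longrightarrow> det (M t) \<noteq> 0 \<and> wdet k l (rowmat (M t)) \<noteq> 0"
    using primitive_interior_path[OF D kl(3)] by blast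
  show ?thesis
    by (rule that[of M]) (use M kl Prim_rankI in blast)+
qed

lemma ra_kmap:
  assumes "\<And>i j. \<forall>t0\<in>S. real_analytic_at t0 (\<lambda>t. M t $ i $ j)"
  shows "\<forall>t0\<in>S. real_analytic_at t0 (\<lambda>t. kmap I (rowmat (M t)) $ p $ q)"
  by (rule analytic.C_kmap) (simp add: rowmat_def assms)

lemma CP_rank_analytic_path:
  fixes L0 L1 :: "'n::finite supop"
  assumes D: "CARD('n) \<ge> 2" and r: "r \<ge> 2" and L: "L0 \<in> CP_rank r" "L1 \<in> CP_rank r"
  obtains g where "g 0 = L0" "g 1 = L1" "\<And>t. 0 < t \<Longrightarrow> t < 1 \<Longrightarrow> g t \<in> Prim_rank r"
    "\<And>t0 a b. real_analytic_at t0 (\<lambda>t. g t $ a $ b)"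
proof -
  obtain I :: "('n \<times> 'n) set" where I: "card I = r"
    using index_set[OF r CP_rank_bound[OF L(1)]] by metis
  obtain M0 where M0: "L0 = kmap I (rowmat M0)" using CP_rank_obtain[OF L(1) I] by metis
  obtain M1 where M1: "L1 = kmap I (rowmat M1)" using CP_rank_obtain[OF L(2) I] by metis
  have I2: "card I \<ge> 2" using I r by simp
  obtain M where M: "M 0 = M0" "M 1 = M1" "\<And>t0 i j. real_analytic_at t0 (\<lambda>t. M t $ i $ j)"
     "\<And>t. 0 < t \<Longrightarrow> t < 1 \<Longrightarrow> kmap I (rowmat (M t)) \<in> Prim_rank (card I)"
    using CP_rank_path[OF D I2, of M0 M1] by blast
  show ?thesis
  proof (rule that[of "\<lambda>t. kmap I (rowmat (M t))"])
    show "real_analytic_at t0 (\<lambda>t. kmap I (rowmat (M t)) $ a $ b)" for t0 a b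
      using ra_kmap[of "{t0}" M I a b] M(3) by simp
  qed (use M M0 M1 I in auto)
qed

lemma primitive_imp_irreducible: "primitive_map L \<Longrightarrow> irreducible_map L"
proof -
  assume L: "primitive_map L"
  then obtain s :: nat and A where A: "L = kmap {..<s} A" by (auto simp: primitive_map_def is_CP_iff)
  then show ?thesis
    using L full_words_irr by (auto simp: primitive_kmap_iff irreducible_kmap_iff)
qed

lemma Prim_subset_Irr: "Prim_rank r \<subseteq> Irr_rank r"
  by (auto simp: Prim_rank_def Irr_rank_def primitive_imp_irreducible)

text \<open>The interior of the constructed path is primitive whatever the endpoints are, so all
  maps, primitive maps and irreducible maps of rank \<open>r\<close> are treated at once.\<close>

lemma paths_between_Prim_CP:
  fixes Z :: "'n::finite supop set"
  assumes D: "CARD('n) \<ge> 2" and r: "r \<ge> 2" and Z: "Prim_rank r \<subseteq> Z" "Z \<subseteq> CP_rank r"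
  shows "analytic_path_connected Z \<and> path_connected Z"
proof (rule analytic_pathsI)
  fix L0 L1 assume L: "L0 \<in> Z" "L1 \<in> Z"
  obtain g where g: "g 0 = L0" "g 1 = L1" "\<And>t. 0 < t \<Longrightarrow> t < 1 \<Longrightarrow> g t \<in> Prim_rank r"
    "\<And>t0 a b. real_analytic_at t0 (\<lambda>t. g t $ a $ b)"
    using CP_rank_analytic_path[OF D r, of L0 L1] L Z(2) by blast
  have "g t \<in> Z" if "t \<in> {0..1}" for t
  proof (cases "t = 0 \<or> t = 1")
    case False
    then have "0 < t" "t < 1" using that by auto
    then show ?thesis using g(3) Z(1) by blast
  qed (use g(1,2) L in auto)
  then show "\<exists>g. g 0 = L0 \<and> g 1 = L1 \<and> (\<forall>t\<in>{0..1}. g t \<in> Z) \<and> (\<forall>a b. \<forall>t0\<in>{0..1}. real_analytic_at t0 (\<lambda>t. g t $ a $ b))"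
    using g by blast
qed

lemma closure_from_path:
  fixes g :: "real \<Rightarrow> 'a::metric_space"
  assumes "isCont g 0" "\<And>\<epsilon>. \<epsilon> > 0 \<Longrightarrow> \<exists>t. 0 < t \<and> t < \<epsilon> \<and> g t \<in> Z"
  shows "g 0 \<in> closure Z"
  unfolding closure_approachable
proof (intro allI impI)
  fix e :: real assume "e > 0"
  then obtain d where d: "d > 0" "\<And>t. dist t 0 < d \<Longrightarrow> dist (g t) (g 0) < e"
    using assms(1) unfolding continuous_at_eps_delta by blast
  obtain t where "0 < t" "t < d" "g t \<in> Z" using assms(2)[OF d(1)] by blast
  then show "\<exists>y\<in>Z. dist y (g 0) < e" using d(2)[of t] by auto
qed

lemma ra_isCont_matrix:
  assumes "\<And>i j. real_analytic_at t0 (\<lambda>t. g t $ i $ j)"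
  shows "isCont g t0"
proof -
  have "isCont (\<lambda>t. \<chi> i j. g t $ i $ j) t0"
    unfolding isCont_def
    by (intro tendsto_vec_lambda) (use ra_isCont[OF assms] in \<open>simp add: isCont_def\<close>)
  then show ?thesis by simp
qed

text \<open>A loop from \<open>L\<close> to itself with primitive interior already supplies
  primitive maps arbitrarily close to \<open>L\<close>.\<close>

lemma Prim_dense:
  fixes Z :: "'n::finite supop set"
  assumes D: "CARD('n) \<ge> 2" and r: "r \<ge> 2" and Z: "Prim_rank r \<subseteq> Z"
  shows "CP_rank r \<subseteq> closure Z"
proof
  fix L :: "'n supop" assume L: "L \<in> CP_rank r"
  obtain g where g: "g 0 = L" "g 1 = L" "\<And>t. 0 < t \<Longrightarrow> t < 1 \<Longrightarrow> g t \<in> Prim_rank r"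
    "\<And>t0 a b. real_analytic_at t0 (\<lambda>t. g t $ a $ b)"
    using CP_rank_analytic_path[OF D r L L] by blast
  have "g 0 \<in> closure Z"
  proof (rule closure_from_path)
    show "isCont g 0" by (rule ra_isCont_matrix) (rule g(4))
    fix \<epsilon> :: real assume "\<epsilon> > 0"
    then have "0 < min \<epsilon> 1 / 2" "min \<epsilon> 1 / 2 < \<epsilon>" "min \<epsilon> 1 / 2 < 1" by (auto simp: min_def)
    then show "\<exists>t. 0 < t \<and> t < \<epsilon> \<and> g t \<in> Z" using g(3) Z by blast
  qed
  then show "L \<in> closure Z" by (simp add: g(1))
qed

lemma Prim_rank_open: "Prim_rank r = CP_rank r \<inter> {L. \<exists>n. det (choi (map_pow L n)) \<noteq> 0}"
  by (auto simp: Prim_rank_def CP_rank_def primitive_iff_choi)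

lemma Irr_rank_open: "Irr_rank r = CP_rank r \<inter> - reducible"
  by (auto simp: Irr_rank_def CP_rank_def irreducible_iff)

section \<open>Perron eigenvectors of the dual map\<close>

definition psd :: "complex^'n^'n \<Rightarrow> bool" where
  "psd X \<longleftrightarrow> adj X = X \<and> (\<forall>v. 0 \<le> Re (cip v (X *v v)))"

definition dmap :: "'i set \<Rightarrow> ('i \<Rightarrow> complex^'n^'n) \<Rightarrow> complex^'n^'n \<Rightarrow> complex^'n^'n" where
  "dmap I A X = (\<Sum>k\<in>I. adj (A k) ** X ** A k)"

text \<open>Otherwise the form would be negative at \<open>v - t w\<close> with w = X v and small t,
  because its linear term in t is -2 t times the squared norm of w.\<close>

lemma psd_ker:
  assumes "psd X" "Re (cip v (X *v v)) = 0"
  shows "X *v v = 0"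
proof (rule ccontr)
  assume nz: "X *v v \<noteq> 0"
  define w where "w = X *v v"
  define n where "n = (norm w)\<^sup>2"
  define q where "q = Re (cip w (X *v w))"
  \<comment> \<open>Any positive t with t q < 2 n would do; q + 1 in the denominator covers q =
    0.\<close>
  define t where "t = n / (q + 1)"
  have n: "n > 0" using nz by (simp add: n_def w_def)
  have q: "q \<ge> 0" using assms(1) by (simp add: q_def psd_def)
  have H: "adj X = X" using assms(1) by (simp add: psd_def)
  have vw: "cip v (X *v w) = of_real n"
    using cip_adj[of X v w] H by (simp add: cip_self n_def w_def)
  have wv: "cip w (X *v v) = of_real n" by (simp add: cip_self n_def w_def)
  have "cip (v - t *\<^sub>R w) (X *v (v - t *\<^sub>R w)) =
      cip v (X *v v) - of_real t * of_real n - of_real t * of_real n + of_real t * of_real t * cip w (X *v w)"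
    by (simp add: matrix_vector_mult_diff_distrib scaleR_matrix_vec_right cip_diff_left cip_diff_right
        cip_scaleR_left cip_scaleR_right vw wv algebra_simps)
  then have "Re (cip (v - t *\<^sub>R w) (X *v (v - t *\<^sub>R w))) = - 2 * t * n + t * t * q"
    by (simp add: assms(2) q_def)
  moreover have "0 \<le> Re (cip (v - t *\<^sub>R w) (X *v (v - t *\<^sub>R w)))" using assms(1) by (simp add: psd_def)
  ultimately have "2 * t * n \<le> t * (t * q)" by simp
  moreover have t0: "t > 0" using n q by (simp add: t_def)
  ultimately have "2 * n \<le> t * q" by simp
  moreover have "t * q \<le> n"
    using n q by (simp add: t_def divide_simps)
  ultimately show False using n by simp
qed

lemma cip_dmap: "cip v (dmap I A X *v v) = (\<Sum>k\<in>I. cip (A k *v v) (X *v (A k *v v)))"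
  by (simp add: dmap_def matrix_vector_sum_left cip_sum_right cip_adj[symmetric] matrix_vector_mul_assoc[symmetric])

lemma adj_dmap: "adj X = X \<Longrightarrow> adj (dmap I A X) = dmap I A X"
  by (simp add: dmap_def adj_sum adj_mult matrix_mul_assoc)

lemma psd_dmap: "psd X \<Longrightarrow> psd (dmap I A X)"
  by (simp add: psd_def adj_dmap cip_dmap sum_nonneg)

lemma psd_add: "psd X \<Longrightarrow> psd Y \<Longrightarrow> psd (X + Y)"
  by (simp add: psd_def adj_add matrix_vector_mult_add_rdistrib cip_add_right)

lemma psd_scaleR: "0 \<le> c \<Longrightarrow> psd X \<Longrightarrow> psd (c *\<^sub>R X)"
  by (simp add: psd_def adj_scaleR scaleR_matrix_vec cip_scaleR_right)

lemma matrix_diff_ldistrib': "(C :: 'a::ring_1^'k^'m) ** (A - B) = C ** A - C ** B"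
  by (simp add: matrix_matrix_mult_def vec_eq_iff right_diff_distrib sum_subtractf)

lemma dmap_diff: "dmap I A (X - Y) = dmap I A X - dmap I A Y"
  by (simp add: dmap_def sum_subtractf[symmetric] matrix_diff_ldistrib' matrix_diff_rdistrib')

lemma dmap_scaleR: "dmap I A (c *\<^sub>R X) = c *\<^sub>R dmap I A X"
  by (simp add: dmap_def scaleR_sum_right scaleR_matrix_mult_left scaleR_matrix_mult_right)

text \<open>The kernel of \<open>X\<close> is invariant: for v in it the non-negative terms <A_k v,
  X A_k v> sum to \<rho> <v, X v> = 0, so each A_k v is again in the kernel. By irreducibility the
  kernel is trivial.\<close>

lemma psd_eigenvector_pd:
  assumes irr: "irr I A" and I: "finite I" and X: "psd X" "X \<noteq> 0" and eig: "dmap I A X = \<rho> *\<^sub>R X"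
  shows "pd X"
proof -
  define W where "W = {v. X *v v = 0}"
  have "vec.subspace W"
    by (auto simp: W_def vec.subspace_def matrix_vector_right_distrib vector_scalar_commute)
  moreover have "A k *v v \<in> W" if k: "k \<in> I" and v: "v \<in> W" for k v
  proof -
    have "(\<Sum>k\<in>I. Re (cip (A k *v v) (X *v (A k *v v)))) = Re (cip v (dmap I A X *v v))"
      by (simp add: cip_dmap)
    also have "\<dots> = 0" using v by (simp add: eig scaleR_matrix_vec W_def)
    finally have "Re (cip (A k *v v) (X *v (A k *v v))) = 0"
      using I k X(1) by (subst (asm) sum_nonneg_eq_0_iff) (auto simp: psd_def)
    then show ?thesis using psd_ker[OF X(1)] by (simp add: W_def)
  qed
  ultimately have "W = {0} \<or> W = UNIV" by (rule irrD[OF irr])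
  moreover have "W \<noteq> UNIV"
    using X(2) by (auto simp: W_def matrix_eq_iff_vec set_eq_iff)
  ultimately have W: "W = {0}" by blast
  have "0 < Re (cip v (X *v v))" if "v \<noteq> 0" for v
  proof -
    have "X *v v \<noteq> 0" using W that by (auto simp: W_def)
    then have "Re (cip v (X *v v)) \<noteq> 0" using psd_ker[OF X(1)] by blast
    then show ?thesis using X(1) by (simp add: psd_def order.strict_iff_order)
  qed
  then show ?thesis using X(1) by (simp add: pd_def psd_def)
qed

text \<open>The trace is fixed at D rather than 1 so that the identity belongs to the set; the
  Perron eigenvector of the dual of an irreducible trace-preserving map is then exactly the
  identity.\<close>

definition dset :: "(complex^'n^'n) set" where
  "dset = {X. psd X \<and> trace X = of_nat CARD('n::finite)}"

lemma psd_diag: "psd X \<Longrightarrow> 0 \<le> Re (X $ i $ i)"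
proof -
  assume "psd X"
  then have "0 \<le> Re (cip (axis i 1) (X *v axis i 1))" by (simp add: psd_def)
  then show ?thesis by (simp add: cip_axis_left matrix_vec_axis column_def)
qed

lemma psd_diag_real: "psd X \<Longrightarrow> Im (X $ i $ i) = 0"
proof -
  assume "psd X"
  then have "adj X $ i $ i = X $ i $ i" by (simp add: psd_def)
  then have "cnj (X $ i $ i) = X $ i $ i" by (simp add: adj_def)
  then show ?thesis by (simp add: complex_eq_iff)
qed

lemma psd_trace: "psd X \<Longrightarrow> trace X = of_real (Re (trace X)) \<and> 0 \<le> Re (trace X)"
  by (simp add: complex_eq_iff trace_def psd_diag_real sum_nonneg psd_diag)

text \<open>Positivity of the form at u + v and at u - v. With \<open>\<i> *s v\<close> in place of
  \<open>v\<close> it bounds imaginary parts as well, which makes \<open>dset\<close>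
  bounded.\<close>

lemma psd_Re_le:
  assumes "psd X"
  shows "\<bar>Re (cip u (X *v v))\<bar> \<le> (Re (cip u (X *v u)) + Re (cip v (X *v v))) / 2"
proof -
  have sym: "Re (cip v (X *v u)) = Re (cip u (X *v v))"
    using cip_adj[of X u v] assms cnj_cip[of v "X *v u"]
    by (metis complex_cnj(1) complex.sel(1) psd_def complex_surj cnj.simps(1))
  have "0 \<le> Re (cip (u + v) (X *v (u + v)))" "0 \<le> Re (cip (u - v) (X *v (u - v)))"
    using assms by (simp_all add: psd_def)
  then show ?thesis
    by (simp add: matrix_vector_right_distrib matrix_vector_mult_diff_distrib cip_add_left cip_add_right
        cip_diff_left cip_diff_right sym abs_le_iff)
qed

lemma dset_entry:
  fixes X :: "complex^'n^'n"
  assumes "X \<in> dset"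
  shows "norm (X $ i $ j) \<le> 2 * of_nat CARD('n)"
proof -
  have X: "psd X" "trace X = of_nat CARD('n)" using assms by (auto simp: dset_def)
  have d: "Re (X $ i $ i) \<le> of_nat CARD('n)" for i
  proof -
    have "Re (X $ i $ i) \<le> (\<Sum>i\<in>UNIV. Re (X $ i $ i))"
      by (rule member_le_sum) (auto intro: psd_diag[OF X(1)])
    also have "\<dots> = Re (trace X)" by (simp add: trace_def)
    finally show ?thesis by (simp add: X(2))
  qed
  have "\<bar>Re (X $ i $ j)\<bar> \<le> of_nat CARD('n)"
    using psd_Re_le[OF X(1), of "axis i 1" "axis j 1"] d[of i] d[of j]
    by (simp add: cip_axis_left matrix_vec_axis column_def)
  moreover have "\<bar>Im (X $ i $ j)\<bar> \<le> of_nat CARD('n)"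
    using psd_Re_le[OF X(1), of "axis i 1" "\<i> *s axis j 1"] d[of i] d[of j]
    by (simp add: cip_axis_left matrix_vec_axis column_def vector_scalar_commute cip_scale_left cip_scale_right)
  ultimately show ?thesis using cmod_le[of "X $ i $ j"] by linarith
qed

lemma compact_dset: "compact (dset :: (complex^'n::finite^'n) set)"
proof -
  have c: "continuous_on UNIV (\<lambda>X :: complex^'n^'n. X $ i $ j)" for i j
    by (intro continuous_intros)
  have eq: "dset = {X :: complex^'n^'n. (\<forall>i j. adj X $ i $ j = X $ i $ j)
      \<and> (\<forall>v. 0 \<le> Re (cip v (X *v v))) \<and> (\<Sum>i\<in>UNIV. X $ i $ i) = of_nat CARD('n)}"
    by (auto simp: dset_def psd_def vec_eq_iff trace_def)
  have "closed (dset :: (complex^'n^'n) set)"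
    unfolding eq
    by (intro closed_Collect_conj closed_Collect_all closed_Collect_eq closed_Collect_le continuous.C_adj
        continuous_on_Re continuous.C_cip continuous.C_matrix_vec c continuous_on_const continuous_on_sum)
  moreover have "bounded (dset :: (complex^'n^'n) set)"
    unfolding bounded_iff using norm_matrix_le[OF dset_entry] by blast
  ultimately show ?thesis by (simp add: compact_eq_bounded_closed)
qed

lemma trace_add': "trace (A + B :: complex^'n^'n) = trace A + trace B"
  by (simp add: trace_def sum.distrib)

lemma convex_dset: "convex (dset :: (complex^'n::finite^'n) set)"
proof (rule convexI)
  fix X Y :: "complex^'n^'n" and u v :: real
  assume *: "X \<in> dset" "Y \<in> dset" "0 \<le> u" "0 \<le> v" "u + v = 1"
  have "trace (u *\<^sub>R X + v *\<^sub>R Y) = (of_real u + of_real v) * of_nat CARD('n)"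
    using * by (simp add: trace_add' trace_scaleR dset_def scaleR_conv_of_real[where 'a=complex] algebra_simps)
  also have "of_real u + of_real v = (1 :: complex)"
    using *(5) by (metis of_real_1 of_real_add)
  finally show "u *\<^sub>R X + v *\<^sub>R Y \<in> dset"
    using * by (simp add: dset_def psd_add psd_scaleR)
qed

lemma mat_1_dset: "mat 1 \<in> dset"
  by (simp add: dset_def psd_def cip_self trace_def mat_def[of 1, symmetric]) (simp add: mat_def)

lemma (in star_alg) C_dmap:
  assumes "\<And>k i j. k \<in> I \<Longrightarrow> C (\<lambda>x. A x k $ i $ j)" "\<And>i j. C (\<lambda>x. X x $ i $ j)"
  shows "C (\<lambda>x. dmap I (A x) (X x) $ i $ j)"
  unfolding dmap_def by (simp, intro C_sum C_matrix_mult C_adj assms)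

text \<open>Brouwer's theorem for the renormalised sum of \<open>X\<close> and its image under the
  dual map. Adding \<open>X\<close> keeps the trace at least D, so the division is legitimate even
  where the dual map vanishes. A fixed point is an eigenvector with eigenvalue \<open>s X\<close> /
  D - 1; the eigenvalue 0 would force every Kraus operator to vanish, since \<open>X\<close> is
  positive definite.\<close>

lemma perron_exists:
  fixes A :: "'i \<Rightarrow> complex^'n^'n"
  assumes irr: "irr I A" and I: "finite I" and nz: "\<exists>k\<in>I. A k \<noteq> 0"
  obtains X \<rho> where "X \<in> dset" "pd X" "0 < \<rho>" "dmap I A X = \<rho> *\<^sub>R X"
proof -
  define s where "s X = Re (trace (X + dmap I A X))" for X
  define f where "f X = (of_nat CARD('n) / s X) *\<^sub>R (X + dmap I A X)" for X
  have D: "0 < (of_nat CARD('n) :: real)" by (simp add: card_gt_0_iff)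
  have s: "of_nat CARD('n) \<le> s X" if "X \<in> dset" for X
  proof -
    have "s X = of_nat CARD('n) + Re (trace (dmap I A X))"
      using that by (simp add: s_def trace_add' dset_def)
    moreover have "0 \<le> Re (trace (dmap I A X))"
      using that psd_trace[OF psd_dmap, of X I A] by (simp add: dset_def)
    ultimately show ?thesis by simp
  qed
  have sp: "0 < s X" if "X \<in> dset" for X using s[OF that] D by linarith
  have c: "continuous_on dset (\<lambda>X. X $ i $ j)" for i j by (intro continuous_intros)
  have cd: "continuous_on dset (\<lambda>X. dmap I A X)"
    by (intro continuous_on_matrix continuous.C_dmap c continuous_on_const)
  have "continuous_on dset s"
    unfolding s_def trace_def by (intro continuous_intros cd)
  then have "continuous_on dset f"
    unfolding f_def using sp by (intro continuous_intros cd) (auto dest: sp)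
  moreover have "f X \<in> dset" if X: "X \<in> dset" for X
  proof -
    have p: "psd (X + dmap I A X)" using X by (simp add: dset_def psd_add psd_dmap)
    have "trace (f X) = of_real (of_nat CARD('n) / s X) * trace (X + dmap I A X)"
      by (simp add: f_def trace_scaleR scaleR_conv_of_real[where 'a=complex])
    also have "trace (X + dmap I A X) = of_real (s X)"
      using psd_trace[OF p] by (simp add: s_def)
    finally have "trace (f X) = of_nat CARD('n)" using sp[OF X] by simp
    then show ?thesis using p sp[OF X] by (simp add: dset_def f_def psd_scaleR)
  qed
  ultimately obtain X where X: "X \<in> dset" "f X = X"
    using brouwer[OF compact_dset convex_dset, of f] mat_1_dset by auto
  define \<rho> where "\<rho> = s X / of_nat CARD('n) - 1"
  have eig: "dmap I A X = \<rho> *\<^sub>R X"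
  proof -
    have "s X *\<^sub>R X = s X *\<^sub>R f X" by (simp add: X(2))
    also have "\<dots> = of_nat CARD('n) *\<^sub>R (X + dmap I A X)"
      using sp[OF X(1)] by (simp add: f_def)
    finally have *: "s X *\<^sub>R X = of_nat CARD('n) *\<^sub>R (X + dmap I A X)" .
    have "(s X / of_nat CARD('n)) *\<^sub>R X = (1 / of_nat CARD('n)) *\<^sub>R (s X *\<^sub>R X)" by simp
    also have "\<dots> = X + dmap I A X" unfolding * using D by simp
    finally have "(s X / of_nat CARD('n)) *\<^sub>R X = X + dmap I A X" .
    then show ?thesis by (simp add: \<rho>_def scaleR_diff_left)
  qed
  have "X \<noteq> 0" using X(1) by (auto simp: dset_def trace_zero)
  then have pd: "pd X" using psd_eigenvector_pd[OF irr I _ _ eig] X(1) by (simp add: dset_def)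
  have "0 \<le> \<rho>" using s[OF X(1)] D by (simp add: \<rho>_def)
  moreover have "\<rho> \<noteq> 0"
  proof
    assume "\<rho> = 0"
    obtain k where k: "k \<in> I" "A k \<noteq> 0" using nz by blast
    then obtain v where v: "A k *v v \<noteq> 0" by (auto simp: matrix_eq_iff_vec)
    have "(\<Sum>k\<in>I. Re (cip (A k *v v) (X *v (A k *v v)))) = Re (cip v (dmap I A X *v v))"
      by (simp add: cip_dmap)
    also have "\<dots> = 0" by (simp add: eig \<open>\<rho> = 0\<close>)
    finally have "Re (cip (A k *v v) (X *v (A k *v v))) = 0"
      using I k(1) X(1) by (subst (asm) sum_nonneg_eq_0_iff) (auto simp: psd_def dset_def)
    then show False using pd v by (auto simp: pd_def)
  qed
  ultimately have "0 < \<rho>" by simp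
  then show ?thesis by (rule that[OF X(1) pd _ eig])
qed

text \<open>Let c be the minimum over unit vectors of the ratio of the two quadratic forms, attained
  at \<open>v0\<close>. Then Y = X - c X' is positive semidefinite with <v0, Y v0> = 0. Evaluating
  the image of Y at \<open>v0\<close> gives (\<rho> - \<rho>') <v0, X v0> \<ge> 0. For equal
  eigenvalues Y would be an eigenvector that is not positive definite, so Y = 0.\<close>

lemma perron_compare:
  fixes A :: "'i \<Rightarrow> complex^'n^'n"
  assumes irr: "irr I A" and I: "finite I" and X: "pd X" "dmap I A X = \<rho> *\<^sub>R X"
    and X': "pd X'" "dmap I A X' = \<rho>' *\<^sub>R X'"
  shows "\<rho>' \<le> \<rho>" and "\<rho> = \<rho>' \<Longrightarrow> \<exists>c. X = c *\<^sub>R X'"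
proof -
  define S where "S = sphere (0 :: complex^'n) 1"
  define h where "h v = Re (cip v (X *v v)) / Re (cip v (X' *v v))" for v
  have nz: "v \<noteq> 0" if "v \<in> S" for v using that by (auto simp: S_def)
  have pos: "0 < Re (cip v (X *v v))" "0 < Re (cip v (X' *v v))" if "v \<noteq> 0" for v
    using X(1) X'(1) that by (auto simp: pd_def)
  have cv: "continuous_on S (\<lambda>v. v $ i)" for i by (intro continuous_intros)
  have "continuous_on S h"
    unfolding h_def
    by (intro continuous_on_divide continuous_on_Re continuous.C_cip continuous.C_matrix_vec cv continuous_on_const)
       (metis nz pos(2) less_irrefl)
  moreover have "compact S" by (simp add: S_def)
  moreover have "S \<noteq> {}"
  proof -
    have "norm (axis i 1 :: complex^'n) = 1" for i
      by (simp add: norm_vec_def L2_set_def axis_def if_distrib[of norm] if_distrib[of "\<lambda>x. x\<^sup>2"] cong: if_cong)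
    then have "axis undefined 1 \<in> S" by (simp add: S_def)
    then show ?thesis by blast
  qed
  ultimately obtain v0 where v0: "v0 \<in> S" "\<And>v. v \<in> S \<Longrightarrow> h v0 \<le> h v"
    using continuous_attains_inf[of S h] by blast
  define c where "c = h v0"
  define Y where "Y = X - c *\<^sub>R X'"
  have qY: "Re (cip v (Y *v v)) = Re (cip v (X *v v)) - c * Re (cip v (X' *v v))" for v
    by (simp add: Y_def matrix_vector_mult_diff_rdistrib cip_diff_right scaleR_matrix_vec cip_scaleR_right)
  have adjY: "adj Y = Y" using X(1) X'(1) by (simp add: Y_def pd_def adj_diff adj_scaleR)
  have "0 \<le> Re (cip v (Y *v v))" for v
  proof (cases "v = 0")
    case False
    define u where "u = (1 / norm v) *\<^sub>R v"
    have u: "u \<in> S" using False by (simp add: u_def S_def)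
    have v: "v = norm v *\<^sub>R u" using False by (simp add: u_def)
    have "c \<le> h u" using v0(2)[OF u] by (simp add: c_def)
    then have "0 \<le> Re (cip u (Y *v u))"
      using pos(2)[OF nz[OF u]] unfolding qY h_def by (simp add: pos_le_divide_eq)
    moreover have "Re (cip (n *\<^sub>R u) (Y *v (n *\<^sub>R u))) = n * n * Re (cip u (Y *v u))" for n
      by (simp add: scaleR_matrix_vec_right cip_scaleR_left cip_scaleR_right)
    from this[of "norm v", folded v] have "Re (cip v (Y *v v)) = (norm v * norm v) * Re (cip u (Y *v u))" .
    ultimately show ?thesis by simp
  qed simp
  then have psdY: "psd Y" using adjY by (simp add: psd_def)
  have v0z: "v0 \<noteq> 0" by (rule nz[OF v0(1)])
  have cq: "c * Re (cip v0 (X' *v v0)) = Re (cip v0 (X *v v0))"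
    using pos(2)[OF v0z] by (simp add: c_def h_def)
  have "0 \<le> Re (cip v0 (dmap I A Y *v v0))" using psd_dmap[OF psdY, of I A] by (simp add: psd_def)
  also have "dmap I A Y = \<rho> *\<^sub>R X - (c * \<rho>') *\<^sub>R X'"
    by (simp add: Y_def dmap_diff dmap_scaleR X(2) X'(2))
  also have "Re (cip v0 ((\<rho> *\<^sub>R X - (c * \<rho>') *\<^sub>R X') *v v0)) = (\<rho> - \<rho>') * Re (cip v0 (X *v v0))"
    by (simp add: matrix_vector_mult_diff_rdistrib cip_diff_right scaleR_matrix_vec cip_scaleR_right
        cq[symmetric] algebra_simps)
  finally show "\<rho>' \<le> \<rho>" using pos(1)[OF v0z] by (simp add: zero_le_mult_iff)
  assume eq: "\<rho> = \<rho>'"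
  have "dmap I A Y = \<rho> *\<^sub>R Y"
    by (simp add: Y_def dmap_diff dmap_scaleR X(2) X'(2) eq scaleR_diff_right)
  then have "Y \<noteq> 0 \<Longrightarrow> pd Y" by (intro psd_eigenvector_pd[OF irr I psdY])
  moreover have "\<not> pd Y" using v0z cq by (auto simp: pd_def qY)
  ultimately show "\<exists>c. X = c *\<^sub>R X'" by (auto simp: Y_def)
qed

text \<open>Comparison in both directions equates the eigenvalues; the common trace fixes the
  scale.\<close>

lemma perron_unique:
  fixes A :: "'i \<Rightarrow> complex^'n^'n"
  assumes irr: "irr I A" and I: "finite I" and X: "X \<in> dset" "dmap I A X = \<rho> *\<^sub>R X"
    and X': "X' \<in> dset" "dmap I A X' = \<rho>' *\<^sub>R X'"
  shows "X = X'" and "\<rho> = \<rho>'"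
proof -
  have tr: "Y \<noteq> 0" if "Y \<in> dset" for Y :: "complex^'n^'n"
    using that by (auto simp: dset_def trace_zero)
  have pd: "pd X" "pd X'"
    using psd_eigenvector_pd[OF irr I _ tr X(2)] psd_eigenvector_pd[OF irr I _ tr X'(2)] X(1) X'(1)
    by (auto simp: dset_def)
  show \<rho>: "\<rho> = \<rho>'"
    using perron_compare(1)[OF irr I pd(1) X(2) pd(2) X'(2)] perron_compare(1)[OF irr I pd(2) X'(2) pd(1) X(2)]
    by simp
  obtain c where c: "X = c *\<^sub>R X'"
    using perron_compare(2)[OF irr I pd(1) X(2) pd(2) X'(2) \<rho>] by blast
  have "trace X = trace X'" "trace X' \<noteq> 0" using X(1) X'(1) by (simp_all add: dset_def)
  then have "of_real c = (1 :: complex)"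
    unfolding c trace_scaleR scaleR_conv_of_real[where 'a=complex] by simp
  then show "X = X'" by (simp add: c)
qed

text \<open>By uniqueness the graph of the eigenvector is the zero set of a continuous function on
  \<open>T \<times> dset\<close>, hence closed, and a map with closed graph into a compact set is
  continuous.\<close>

lemma perron_continuous:
  fixes A :: "real \<Rightarrow> 'i \<Rightarrow> complex^'n^'n"
  assumes irr: "\<And>t. t \<in> T \<Longrightarrow> irr I (A t)" and I: "finite I" and nz: "\<And>t. t \<in> T \<Longrightarrow> \<exists>k\<in>I. A t k \<noteq> 0"
    and T: "closed T" and cont: "\<And>k i j. k \<in> I \<Longrightarrow> continuous_on T (\<lambda>t. A t k $ i $ j)"
  shows "\<exists>X \<rho>. (\<forall>t\<in>T. X t \<in> dset \<and> pd (X t) \<and> 0 < \<rho> t \<and> dmap I (A t) (X t) = \<rho> t *\<^sub>R X t)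
    \<and> continuous_on T X \<and> continuous_on T \<rho>"
proof -
  have "\<forall>t. \<exists>p. t \<in> T \<longrightarrow> fst p \<in> dset \<and> pd (fst p) \<and> 0 < snd p \<and> dmap I (A t) (fst p) = snd p *\<^sub>R fst p"
    using perron_exists[OF irr I nz] by (metis fst_conv snd_conv)
  from choice[OF this] obtain p where p: "\<And>t. t \<in> T \<Longrightarrow> fst (p t) \<in> dset \<and> pd (fst (p t)) \<and> 0 < snd (p t)
      \<and> dmap I (A t) (fst (p t)) = snd (p t) *\<^sub>R fst (p t)" by blast
  define X where "X t = fst (p t)" for t
  define \<rho> where "\<rho> t = snd (p t)" for t
  have X: "X t \<in> dset" "pd (X t)" "0 < \<rho> t" "dmap I (A t) (X t) = \<rho> t *\<^sub>R X t" if "t \<in> T" for t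
    using p[OF that] by (auto simp: X_def \<rho>_def)
  have D: "(of_nat CARD('n) :: real) \<noteq> 0" by simp
  \<comment> \<open>Since matrices in \<open>dset\<close> have trace D, the eigenvalue can be read
    off from the eigenvector. This makes the eigenvalue equation one in \<open>t\<close> and
    \<open>Y\<close> alone.\<close>
  define r where "r t Y = Re (trace (dmap I (A t) Y)) / of_nat CARD('n)" for t Y
  have r: "r t Y = c" if "Y \<in> dset" "dmap I (A t) Y = c *\<^sub>R Y" for t Y c
    using that D by (simp add: r_def trace_scaleR dset_def)
  define G where "G x = dmap I (A (fst x)) (snd x) - r (fst x) (snd x) *\<^sub>R snd x" for x
  have graph: "(\<lambda>t. (t, X t)) ` T = {x \<in> T \<times> dset. G x = 0}"
  proof (intro set_eqI iffI)
    fix x assume "x \<in> (\<lambda>t. (t, X t)) ` T"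
    then obtain t where "t \<in> T" "x = (t, X t)" by blast
    then show "x \<in> {x \<in> T \<times> dset. G x = 0}"
      using X[of t] r[OF X(1,4), of t] by (simp add: G_def)
  next
    fix x assume "x \<in> {x \<in> T \<times> dset. G x = 0}"
    then obtain t Y where x: "x = (t, Y)" "t \<in> T" "Y \<in> dset" "dmap I (A t) Y = r t Y *\<^sub>R Y"
      by (auto simp: G_def)
    have "Y = X t"
      by (rule perron_unique(1)[OF irr[OF x(2)] I x(3,4) X(1)[OF x(2)] X(4)[OF x(2)]])
    then show "x \<in> (\<lambda>t. (t, X t)) ` T" using x by blast
  qed
  have c1: "continuous_on (T \<times> dset) (\<lambda>x. A (fst x) k $ i $ j)" if "k \<in> I" for k i j
    by (rule continuous_on_compose2[OF cont[OF that]]) (auto intro: continuous_intros)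
  have c2: "continuous_on (T \<times> dset) (\<lambda>x. snd x $ i $ j)" for i j :: 'n
    by (intro continuous_intros)
  have c3: "continuous_on (T \<times> dset) (\<lambda>x. dmap I (A (fst x)) (snd x))"
    by (intro continuous_on_matrix continuous.C_dmap c1 c2)
  have "continuous_on (T \<times> dset) G"
    unfolding G_def r_def trace_def by (intro continuous_intros c3) (use D in auto)
  then have "closed ((\<lambda>t. (t, X t)) ` T)"
    unfolding graph
    by (intro continuous_closed_preimage_constant closed_Times T compact_imp_closed compact_dset)
  then have cX: "continuous_on T X"
    by (intro continuous_from_closed_graph[OF compact_dset]) (auto simp: X(1))
  have cXe: "continuous_on T (\<lambda>t. X t $ i $ j)" for i j by (rule continuous_on_entry[OF cX])
  have "continuous_on T (\<lambda>t. dmap I (A t) (X t))"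
    by (intro continuous_on_matrix continuous.C_dmap cont cXe)
  then have "continuous_on T (\<lambda>t. r t (X t))"
    unfolding r_def trace_def by (intro continuous_intros) (use D in auto)
  then have "continuous_on T \<rho>"
    by (rule continuous_on_eq) (use r X in auto)
  then show ?thesis using X cX by blast
qed

section \<open>Trace-preserving maps\<close>

lemma trace_outer: "trace (S ** outer u v) = cip v (S *v u)"
  by (simp add: trace_def matrix_matrix_mult_def outer_def cip_def matrix_vector_mult_def
      sum_distrib_left sum_distrib_right mult_ac)

lemma trace_sum: "trace (sum f S :: complex^'n^'n) = (\<Sum>x\<in>S. trace (f x))"
  by (induction S rule: infinite_finite_induct) (auto simp: trace_zero trace_add')

lemma trace_preserving_kmap: "trace_preserving (kmap I A) \<longleftrightarrow> dmap I A (mat 1) = mat 1"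
proof -
  have tr: "trace (apply_map (kmap I A) X) = trace (dmap I A (mat 1) ** X)" for X
  proof -
    have "trace (A k ** X ** adj (A k)) = trace (adj (A k) ** A k ** X)" for k
      using trace_mul_sym[of "A k ** X" "adj (A k)"] by (simp add: matrix_mul_assoc)
    then show ?thesis
      by (simp add: apply_kmap dmap_def trace_sum matrix_mult_sum_left)
  qed
  show ?thesis
  proof
    assume "trace_preserving (kmap I A)"
    then have eq: "trace (dmap I A (mat 1) ** X) = trace (mat 1 ** X)" for X
      by (simp add: trace_preserving_def tr)
    show "dmap I A (mat 1) = mat 1"
      by (rule matrix_eqI_cip) (simp only: trace_outer[symmetric] eq)
  qed (simp add: trace_preserving_def tr)
qed

definition rmat :: "('k \<Rightarrow> complex^'n^'n) \<Rightarrow> complex^('n \<times> 'n)^'k" where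
  "rmat A = (\<chi> k p. A k $ fst p $ snd p)"

lemma rowmat_rmat [simp]: "rowmat (rmat A) = A"
  by (rule ext) (simp add: rowmat_def rmat_def vec_eq_iff)

lemma rmat_rowmat [simp]: "rmat (rowmat M) = M"
  by (simp add: rowmat_def rmat_def vec_eq_iff)

lemma det_iff_full: "det (M :: complex^('n \<times> 'n)^('n::finite \<times> 'n)) \<noteq> 0 \<longleftrightarrow> spanning UNIV (rowmat M)"
  by (simp add: full_rowmat_iff det_nz_iff_ker vec_eq_iff)

text \<open>Multiplying from both sides by invertible matrices is a bijection of the matrix space
  and takes a basis to a basis.\<close>

lemma det_rmat_sandwich:
  fixes M :: "complex^('n \<times> 'n)^('n::finite \<times> 'n)"
  assumes M: "det M \<noteq> 0" and "H ** H' = mat 1" "G' ** G = mat 1" "c \<noteq> 0"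
  shows "det (rmat (\<lambda>k. c *\<^sub>R (H ** rowmat M k ** G))) \<noteq> 0"
  unfolding det_iff_full rowmat_rmat spanning_def
proof (intro allI impI)
  fix X :: "complex^'n^'n"
  assume X: "\<forall>k\<in>UNIV. trace ((c *\<^sub>R (H ** rowmat M k ** G)) ** X) = 0"
  have "trace (rowmat M k ** (G ** X ** H)) = 0" for k
  proof -
    have "trace (rowmat M k ** (G ** X ** H)) = trace ((rowmat M k ** G ** X) ** H)"
      by (simp add: matrix_mul_assoc)
    also have "\<dots> = trace (H ** (rowmat M k ** G ** X))" by (rule trace_mul_sym)
    also have "\<dots> = trace (H ** rowmat M k ** G ** X)" by (simp add: matrix_mul_assoc)
    finally show ?thesis using X[rule_format, of k] assms(4) by (simp add: scaleR_matrix_mult_left trace_scaleR)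
  qed
  then have 0: "G ** X ** H = 0" using M unfolding det_iff_full spanning_def by blast
  have "X = (G' ** G) ** X ** (H ** H')" by (simp add: assms)
  also have "\<dots> = G' ** (G ** X ** H) ** H'" by (simp only: matrix_mul_assoc)
  finally show "X = 0" by (simp add: 0)
qed

lemma det_rowmat_nz:
  fixes M :: "complex^('n \<times> 'n)^('n::finite \<times> 'n)"
  assumes "det M \<noteq> 0" "I \<noteq> {}"
  shows "\<exists>k\<in>I. rowmat M k \<noteq> 0"
proof (rule ccontr)
  assume "\<not> ?thesis"
  then obtain k where "rowmat M k = 0" using assms(2) by blast
  then have "M $ k = 0" by (simp add: rowmat_def vec_eq_iff)
  then have "det M = 0" by (intro det_zero_row(1)[of k]) (simp add: row_def vec_eq_iff)
  then show False using assms(1) by simp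
qed

section \<open>Two normalisations that enforce trace preservation\<close>

abbreviation gram :: "'i set \<Rightarrow> ('i \<Rightarrow> complex^'n^'n) \<Rightarrow> complex^'n^'n" where
  "gram I A \<equiv> dmap I A (mat 1)"

text \<open>Depends analytically on \<open>M\<close> and keeps the rows independent, but is not a
  similarity: primitivity and irreducibility must be secured otherwise, by openness or by the
  identity theorem.\<close>

definition normalised :: "'k set \<Rightarrow> complex^('n::finite \<times> 'n)^'k \<Rightarrow> complex^('n \<times> 'n)^'k" where
  "normalised I M = rmat (\<lambda>k. rowmat M k ** gsmat (gram I (rowmat M)))"

lemma gram_normalised:
  assumes "pd (gram I (rowmat M))"
  shows "gram I (rowmat (normalised I M)) = mat 1"
proof -
  let ?G = "gsmat (gram I (rowmat M))"
  have "gram I (rowmat (normalised I M)) = adj ?G ** gram I (rowmat M) ** ?G"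
    by (simp add: normalised_def dmap_def adj_mult matrix_mult_sum_left matrix_mult_sum_right matrix_mul_assoc)
  then show ?thesis using gsmat[OF assms] by simp
qed

lemma normalised_id: "gram I (rowmat M) = mat 1 \<Longrightarrow> normalised I M = M"
  by (simp add: normalised_def)

lemma det_normalised:
  fixes M :: "complex^('n \<times> 'n)^('n::finite \<times> 'n)"
  assumes "pd (gram I (rowmat M))" "det M \<noteq> 0"
  shows "det (normalised I M) \<noteq> 0"
  using det_rmat_sandwich[OF assms(2), of "mat 1" "mat 1" "adj (gsmat (gram I (rowmat M))) ** gram I (rowmat M)"
      "gsmat (gram I (rowmat M))" 1] gsmat[OF assms(1)]
  by (simp add: normalised_def)

lemma normalised_CP_rank_TP:
  fixes M :: "complex^('n \<times> 'n)^('n::finite \<times> 'n)"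
  assumes "pd (gram I (rowmat M))" "det M \<noteq> 0"
  shows "kmap I (rowmat (normalised I M)) \<in> CP_rank_TP (card I)"
  using CP_rank_kmap[OF det_normalised[OF assms]] gram_normalised[OF assms(1)]
  by (simp add: CP_rank_TP_def trace_preserving_kmap)

text \<open>The common kernel of the Kraus operators is an invariant subspace, and not the whole
  space.\<close>

lemma irr_gram_pd:
  fixes A :: "'i \<Rightarrow> complex^'n^'n"
  assumes irr: "irr I A" and I: "finite I" and nz: "\<exists>k\<in>I. A k \<noteq> 0"
  shows "pd (gram I A)"
proof -
  have q: "Re (cip v (gram I A *v v)) = (\<Sum>k\<in>I. (norm (A k *v v))\<^sup>2)" for v
    by (simp add: cip_dmap cip_self)
  have S: "vec.subspace {v. \<forall>k\<in>I. A k *v v = 0}"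
    by (auto simp: vec.subspace_def matrix_vector_right_distrib vector_scalar_commute)
  have "{v. \<forall>k\<in>I. A k *v v = 0} = {0} \<or> {v. \<forall>k\<in>I. A k *v v = 0} = UNIV"
    by (rule irrD[OF irr S]) auto
  moreover have "{v. \<forall>k\<in>I. A k *v v = 0} \<noteq> UNIV"
    using nz by (auto simp: matrix_eq_iff_vec set_eq_iff)
  ultimately have ker: "{v. \<forall>k\<in>I. A k *v v = 0} = {0}" by blast
  have "0 < Re (cip v (gram I A *v v))" if "v \<noteq> 0" for v
  proof -
    have "\<exists>k\<in>I. A k *v v \<noteq> 0" using ker that by blast
    then have "(\<Sum>k\<in>I. (norm (A k *v v))\<^sup>2) \<noteq> 0"
      using I by (subst sum_nonneg_eq_0_iff) auto
    moreover have "0 \<le> (\<Sum>k\<in>I. (norm (A k *v v))\<^sup>2)" by (simp add: sum_nonneg)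
    ultimately show ?thesis unfolding q by simp
  qed
  then show ?thesis by (simp add: pd_def adj_dmap)
qed

text \<open>If \<open>X\<close> is the Perron eigenvector of the dual map and \<open>G* X G = 1\<close>, then conjugation by \<open>G\<close> and
  division by the eigenvalue make the map trace preserving.\<close>

definition perron_normal :: "complex^'n::finite^'n \<Rightarrow> real \<Rightarrow> complex^('n \<times> 'n)^'k \<Rightarrow> complex^('n \<times> 'n)^'k" where
  "perron_normal X \<rho> M = rmat (\<lambda>k. (1 / sqrt \<rho>) *\<^sub>R ((adj (gsmat X) ** X) ** rowmat M k ** gsmat X))"

lemma gram_perron_normal:
  assumes X: "pd X" "0 < \<rho>" "dmap I (rowmat M) X = \<rho> *\<^sub>R X"
  shows "gram I (rowmat (perron_normal X \<rho> M)) = mat 1"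
proof -
  let ?G = "gsmat X"
  let ?H = "adj ?G ** X"
  \<comment> \<open>So \<open>adj ?G ** X\<close> is the inverse of \<open>?G\<close>, which makes
    \<open>perron_normal\<close> a similarity up to the scalar; and X is recovered as
    \<open>adj ?H ** ?H\<close>.\<close>
  have HG: "?H ** ?G = mat 1" by (rule gsmat[OF X(1)])
  then have GH: "?G ** ?H = mat 1" using matrix_left_right_inverse by blast
  have "adj ?H ** ?H = X ** (?G ** ?H)"
    using X(1) by (simp add: adj_mult pd_def matrix_mul_assoc)
  then have HH: "adj ?H ** ?H = X" by (simp add: GH)
  have "gram I (rowmat (perron_normal X \<rho> M))
     = (\<Sum>k\<in>I. (1 / sqrt \<rho> * (1 / sqrt \<rho>)) *\<^sub>R (adj ?G ** (adj (rowmat M k) ** (adj ?H ** ?H) ** rowmat M k) ** ?G))"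
    by (simp add: perron_normal_def dmap_def adj_mult adj_scaleR scaleR_matrix_mult_left scaleR_matrix_mult_right
        matrix_mul_assoc)
  also have "\<dots> = (1 / sqrt \<rho> * (1 / sqrt \<rho>)) *\<^sub>R (adj ?G ** dmap I (rowmat M) X ** ?G)"
    unfolding HH by (simp add: dmap_def scaleR_sum_right matrix_mult_sum_left matrix_mult_sum_right)
  also have "\<dots> = (1 / sqrt \<rho> * (1 / sqrt \<rho>) * \<rho>) *\<^sub>R (adj ?G ** X ** ?G)"
    by (simp add: X(3) scaleR_matrix_mult_left scaleR_matrix_mult_right)
  also have "1 / sqrt \<rho> * (1 / sqrt \<rho>) * \<rho> = 1" using X(2) by simp
  finally show ?thesis by (simp add: HG)
qed

lemma det_perron_normal:
  fixes M :: "complex^('n \<times> 'n)^('n::finite \<times> 'n)"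
  assumes X: "pd X" "0 < \<rho>" and M: "det M \<noteq> 0"
  shows "det (perron_normal X \<rho> M) \<noteq> 0"
proof -
  have HG: "(adj (gsmat X) ** X) ** gsmat X = mat 1" by (rule gsmat[OF X(1)])
  show ?thesis
    unfolding perron_normal_def
    by (rule det_rmat_sandwich[OF M HG HG]) (use X(2) in simp)
qed

lemma perron_normal_id: "perron_normal (mat 1) 1 M = M"
  by (simp add: perron_normal_def)

section \<open>Paths and density in the trace-preserving case\<close>

text \<open>Summing D^2 entries gives the crude bound that |<v, E v>| is at most D^2 times the norm
  of E times the squared norm of v; hence the constant 1/D^2.\<close>

lemma pd_near_1:
  fixes H :: "complex^'n^'n"
  assumes "adj H = H" "norm (H - mat 1) < 1 / (of_nat CARD('n) * of_nat CARD('n))"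
  shows "pd H"
proof -
  define E where "E = H - mat 1"
  have "0 < Re (cip v (H *v v))" if v: "v \<noteq> 0" for v
  proof -
    have "norm (cip v (E *v v)) \<le> (\<Sum>i\<in>UNIV. \<Sum>j\<in>UNIV. norm (v $ i) * (norm (E $ i $ j) * norm (v $ j)))"
      unfolding cip_def matrix_vector_mult_def
      by (simp add: sum_distrib_left) (intro order.trans[OF norm_sum] sum_mono, simp add: norm_mult)
    also have "\<dots> \<le> (\<Sum>i\<in>(UNIV :: 'n set). \<Sum>j\<in>(UNIV :: 'n set). norm v * (norm E * norm v))"
      by (intro sum_mono mult_mono Finite_Cartesian_Product.norm_nth_le mult_nonneg_nonneg norm_ge_zero
          order.trans[OF Finite_Cartesian_Product.norm_nth_le Finite_Cartesian_Product.norm_nth_le])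
    also have "\<dots> = (of_nat CARD('n) * of_nat CARD('n) * norm E) * (norm v)\<^sup>2"
      by (simp add: power2_eq_square)
    also have "\<dots> < 1 * (norm v)\<^sup>2"
    proof (rule mult_strict_right_mono)
      have "0 < (of_nat CARD('n) * of_nat CARD('n) :: real)" by simp
      then show "of_nat CARD('n) * of_nat CARD('n) * norm E < 1"
        using assms(2) by (simp add: E_def pos_less_divide_eq mult_ac)
    qed (use v in simp)
    finally have "norm (cip v (E *v v)) < (norm v)\<^sup>2" by simp
    moreover have "cip v (H *v v) = of_real ((norm v)\<^sup>2) + cip v (E *v v)"
      by (simp add: E_def matrix_vector_mult_diff_rdistrib cip_diff_right cip_self)
    ultimately show ?thesis using abs_Re_le_cmod[of "cip v (E *v v)"] by simp
  qed
  then show ?thesis using assms(1) by (simp add: pd_def)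
qed

lemma (in star_alg) C_gram:
  assumes "\<And>i j. C (\<lambda>x. M x $ i $ j)"
  shows "C (\<lambda>x. gram I (rowmat (M x)) $ i $ j)"
  by (rule C_dmap) (simp_all add: rowmat_def assms C_const)

lemma (in star_alg) C_kmap_normalised:
  assumes M: "\<And>i j. C (\<lambda>x. M x $ i $ j)" and pd: "\<And>x. x \<in> S \<Longrightarrow> pd (gram I (rowmat (M x)))"
  shows "C (\<lambda>x. kmap I (rowmat (normalised I (M x))) $ p $ q)"
proof (rule C_kmap)
  fix k i j
  have "C (\<lambda>x. rowmat (M x) k $ i $ j)" for i j by (simp add: rowmat_def M)
  then show "C (\<lambda>x. rowmat (normalised I (M x)) k $ i $ j)"
    unfolding normalised_def rowmat_rmat by (intro C_matrix_mult C_gsmat C_gram M pd)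
qed

lemma ra_real_polynomial:
  assumes "real_polynomial_function f"
  shows "real_analytic_at t0 (\<lambda>t. of_real (f t))"
  using assms
proof induction
  case (linear f)
  have "f t = f 1 * t" for t
    using linear_cmul[OF bounded_linear.linear[OF linear], of t 1] by simp
  then have "(\<lambda>t. complex_of_real (f t)) = (\<lambda>t. of_real (f 1) * of_real t)"
    by (metis of_real_mult)
  then show ?case
    using ra_holomorphic[of "\<lambda>z. of_real (f 1) * z" t0] by (simp add: holomorphic_intros)
qed (auto intro: ra_const ra_add ra_mult)

lemma ra_polynomial_entry:
  fixes p :: "real \<Rightarrow> complex^'k^'m"
  assumes "polynomial_function p"
  shows "real_analytic_at t0 (\<lambda>t. p t $ i $ j)"
proof -
  have bl: "bounded_linear (\<lambda>M :: complex^'k^'m. M $ i $ j)"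
    by (rule bounded_linear_compose[OF bounded_linear_vec_nth bounded_linear_vec_nth])
  have "real_polynomial_function ((\<lambda>M. Re (M $ i $ j)) \<circ> p)" "real_polynomial_function ((\<lambda>M. Im (M $ i $ j)) \<circ> p)"
    using assms bounded_linear_compose[OF bounded_linear_Re bl] bounded_linear_compose[OF bounded_linear_Im bl]
    unfolding polynomial_function_def by blast+
  then have "real_analytic_at t0 (\<lambda>t. of_real (Re (p t $ i $ j)) + \<i> * of_real (Im (p t $ i $ j)))"
    by (intro ra_add ra_mult ra_const) (auto dest: ra_real_polynomial simp: o_def)
  then show ?thesis by (simp add: complex_eq[symmetric])
qed

text \<open>\<open>Q\<close> stands for primitivity or irreducibility. The argument uses that
  \<open>Q\<close> is open within rank \<open>r\<close>, lies between primitivity and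
  irreducibility, and is stable under similarity and scaling.\<close>

lemma TP_paths:
  fixes Q :: "'n::finite supop \<Rightarrow> bool"
  assumes D: "CARD('n) \<ge> 2" and r: "r \<ge> 2" and Ob: "open Ob" "\<And>L. L \<in> CP_rank r \<Longrightarrow> Q L \<longleftrightarrow> L \<in> Ob"
    and prim: "\<And>L. primitive_map L \<Longrightarrow> Q L" and irr: "\<And>L. Q L \<Longrightarrow> irreducible_map L"
    and sim: "\<And>(I :: ('n \<times> 'n) set) A H G c. H ** G = mat 1 \<Longrightarrow> c \<noteq> 0 \<Longrightarrow> Q (kmap I A)
      \<Longrightarrow> Q (kmap I (\<lambda>k. c *\<^sub>R (H ** A k ** G)))"
  shows "analytic_path_connected {L \<in> CP_rank_TP r. Q L} \<and> path_connected {L \<in> CP_rank_TP r. Q L}"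
proof (rule analytic_pathsI)
  fix L0 L1 assume "L0 \<in> {L \<in> CP_rank_TP r. Q L}" "L1 \<in> {L \<in> CP_rank_TP r. Q L}"
  then have L: "L0 \<in> CP_rank r" "L1 \<in> CP_rank r" "Q L0" "Q L1" "trace_preserving L0" "trace_preserving L1"
    by (auto simp: CP_rank_TP_def)
  obtain I :: "('n \<times> 'n) set" where I: "card I = r"
    using index_set[OF r CP_rank_bound[OF L(1)]] by metis
  obtain M0 where M0: "det M0 \<noteq> 0" "L0 = kmap I (rowmat M0)" using CP_rank_obtain[OF L(1) I] by metis
  obtain M1 where M1: "det M1 \<noteq> 0" "L1 = kmap I (rowmat M1)" using CP_rank_obtain[OF L(2) I] by metis
  have I2: "card I \<ge> 2" "I \<noteq> {}" using I r by auto
  obtain M where M: "M 0 = M0" "M 1 = M1" "\<And>t0 i j. real_analytic_at t0 (\<lambda>t. M t $ i $ j)"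
     "\<And>t. 0 < t \<Longrightarrow> t < 1 \<Longrightarrow> det (M t) \<noteq> 0"
     "\<And>t. 0 < t \<Longrightarrow> t < 1 \<Longrightarrow> kmap I (rowmat (M t)) \<in> Prim_rank (card I)"
    using CP_rank_path[OF D I2(1), of M0 M1] by blast
  have ends: "t = 0 \<or> t = 1 \<or> (0 < t \<and> t < 1)" if "t \<in> {0..1}" for t :: real
    using that by auto
  have det: "det (M t) \<noteq> 0" if "t \<in> {0..1}" for t
    using ends[OF that] M M0(1) M1(1) by auto
  have QM: "Q (kmap I (rowmat (M t)))" if "t \<in> {0..1}" for t
    using ends[OF that] M M0 M1 L prim by (auto simp: Prim_rank_def)
  have irrM: "irr I (rowmat (M t))" if "t \<in> {0..1}" for t
    using irr[OF QM[OF that]] by (simp add: irreducible_kmap_iff)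
  have nz: "\<exists>k\<in>I. rowmat (M t) k \<noteq> 0" if "t \<in> {0..1}" for t
    by (rule det_rowmat_nz[OF det[OF that] I2(2)])
  have cM: "continuous_on {0..1} (\<lambda>t. M t $ i $ j)" for i j
    by (intro continuous_at_imp_continuous_on ballI ra_isCont M(3))
  have cA: "continuous_on {0..1} (\<lambda>t. rowmat (M t) k $ i $ j)" for k i j
    by (simp add: rowmat_def cM)
  have "\<exists>X \<rho>. (\<forall>t\<in>{0..1}. X t \<in> dset \<and> pd (X t) \<and> 0 < \<rho> t \<and> dmap I (rowmat (M t)) (X t) = \<rho> t *\<^sub>R X t)
    \<and> continuous_on {0..1} X \<and> continuous_on {0..1} \<rho>"
    by (rule perron_continuous[of "{0..1}" I "\<lambda>t. rowmat (M t)"])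
       (rule irrM nz cA closed_atLeastAtMost finite, assumption?)+
  then obtain X \<rho> where X: "\<And>t. t \<in> {0..1} \<Longrightarrow> X t \<in> dset" "\<And>t. t \<in> {0..1} \<Longrightarrow> pd (X t)"
    "\<And>t. t \<in> {0..1} \<Longrightarrow> 0 < \<rho> t" "\<And>t. t \<in> {0..1} \<Longrightarrow> dmap I (rowmat (M t)) (X t) = \<rho> t *\<^sub>R X t"
    "continuous_on {0..1} X" "continuous_on {0..1} \<rho>"
    by blast
  define N where "N t = perron_normal (X t) (\<rho> t) (M t)" for t
  \<comment> \<open>At a trace-preserving map the identity is an eigenvector of the dual map with
    eigenvalue 1, so uniqueness makes the normalisation trivial there; this pins the
    endpoints.\<close>
  have fixpt: "N t = M t" if t: "t \<in> {0..1}" and TP: "trace_preserving (kmap I (rowmat (M t)))" for t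
  proof -
    have 1: "dmap I (rowmat (M t)) (mat 1) = 1 *\<^sub>R mat 1" using TP by (simp add: trace_preserving_kmap)
    have "X t = mat 1" "\<rho> t = 1"
      using perron_unique[OF irrM[OF t] _ X(1)[OF t] X(4)[OF t] mat_1_dset 1] by simp_all
    then show ?thesis by (simp add: N_def perron_normal_id)
  qed
  have N0: "N 0 = M0" using fixpt[of 0] M(1) M0(2) L(5) by simp
  have N1: "N 1 = M1" using fixpt[of 1] M(2) M1(2) L(6) by simp
  have gramN: "gram I (rowmat (N t)) = mat 1" if "t \<in> {0..1}" for t
    unfolding N_def using X that by (intro gram_perron_normal)
  have detN: "det (N t) \<noteq> 0" if "t \<in> {0..1}" for t
    unfolding N_def using X det that by (intro det_perron_normal)
  have QN: "Q (kmap I (rowmat (N t)))" if t: "t \<in> {0..1}" for t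
    unfolding N_def perron_normal_def rowmat_rmat
    using gsmat[OF X(2)[OF t]] X(3)[OF t] QM[OF t] by (intro sim) auto
  have cX: "continuous_on {0..1} (\<lambda>t. X t $ i $ j)" for i j by (rule continuous_on_entry[OF X(5)])
  have "continuous_on {0..1} N"
  proof (rule continuous_on_matrix)
    fix k p
    have "continuous_on {0..1} (\<lambda>t. of_real (1 / sqrt (\<rho> t)) *
       ((adj (gsmat (X t)) ** X t) ** rowmat (M t) k ** gsmat (X t)) $ fst p $ snd p)"
    proof (intro continuous_on_mult continuous.C_matrix_mult continuous.C_adj continuous.C_gsmat cX cA X(2))
      show "continuous_on {0..1} (\<lambda>t. complex_of_real (1 / sqrt (\<rho> t)))"
        using X(3) by (intro continuous_intros X(6)) force
    qed
    then show "continuous_on {0..1} (\<lambda>t. N t $ k $ p)"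
      by (simp add: N_def perron_normal_def rmat_def scaleR_conv_of_real[where 'a=complex])
  qed
  then have pathN: "path N" by (simp add: path_def)
  \<comment> \<open>\<open>h\<close> is the repaired map of a tuple. It is continuous on
    \<open>V\<close>, where the Gram matrix stays positive definite, and on the path
    \<open>N\<close> the repair changes nothing.\<close>
  define h where "h P = kmap I (rowmat (normalised I P))" for P :: "complex^('n \<times> 'n)^('n \<times> 'n)"
  define V where "V = {P :: complex^('n \<times> 'n)^('n \<times> 'n).
      norm (gram I (rowmat P) - mat 1) < 1 / (of_nat CARD('n) * of_nat CARD('n))}"
  have cid: "continuous_on U (\<lambda>P :: complex^('n \<times> 'n)^('n \<times> 'n). P $ i $ j)" for U i j
    by (intro continuous_intros)
  have "continuous_on UNIV (\<lambda>P :: complex^('n \<times> 'n)^('n \<times> 'n). gram I (rowmat P))"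
    by (rule continuous_on_matrix) (rule continuous.C_gram[OF cid])
  then have "open V"
    unfolding V_def
    by (intro open_Collect_less continuous_on_norm continuous_on_diff continuous_on_const)
  have pdV: "pd (gram I (rowmat P))" if "P \<in> V" for P
    using that by (intro pd_near_1) (simp_all add: V_def adj_dmap)
  have "continuous_on V h"
    unfolding h_def by (intro continuous_on_matrix continuous.C_kmap_normalised cid pdV)
  then have "open (V \<inter> h -` Ob)"
    using \<open>open V\<close> Ob(1) by (simp add: continuous_open_preimage)
  moreover have "open {P :: complex^('n \<times> 'n)^('n \<times> 'n). det P \<noteq> 0}"
    by (intro open_Collect_neq continuous.C_det cid continuous_on_const)
  ultimately have "open ((V \<inter> h -` Ob) \<inter> {P. det P \<noteq> 0})" by blast
  moreover have "path_image N \<subseteq> (V \<inter> h -` Ob) \<inter> {P. det P \<noteq> 0}"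
  proof
    fix P assume "P \<in> path_image N"
    then obtain t where t: "t \<in> {0..1}" "P = N t" by (auto simp: path_image_def)
    have "h P = kmap I (rowmat (N t))" by (simp add: h_def t(2) normalised_id[OF gramN[OF t(1)]])
    moreover have "kmap I (rowmat (N t)) \<in> CP_rank r" using CP_rank_kmap[OF detN[OF t(1)], of I] I by simp
    ultimately have "h P \<in> Ob" using QN[OF t(1)] Ob(2) by simp
    then show "P \<in> (V \<inter> h -` Ob) \<inter> {P. det P \<noteq> 0}"
      using detN[OF t(1)] gramN[OF t(1)] by (simp add: V_def t(2))
  qed
  moreover have "compact (path_image N)" using pathN by (rule compact_path_image)
  ultimately obtain e where e: "e > 0" "(\<Union>x\<in>path_image N. ball x e) \<subseteq> (V \<inter> h -` Ob) \<inter> {P. det P \<noteq> 0}"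
    using compact_subset_open_imp_ball_epsilon_subset by metis
  obtain p where p: "polynomial_function p" "pathstart p = pathstart N" "pathfinish p = pathfinish N"
      "\<And>t. t \<in> {0..1} \<Longrightarrow> norm (p t - N t) < e"
    using path_approx_polynomial_function[OF pathN e(1)] by blast
  have pV: "p t \<in> V" "h (p t) \<in> Ob" "det (p t) \<noteq> 0" if t: "t \<in> {0..1}" for t
  proof -
    have "p t \<in> ball (N t) e" using p(4)[OF t] by (simp add: dist_norm norm_minus_commute)
    moreover have "N t \<in> path_image N" using t by (auto simp: path_image_def)
    ultimately have "p t \<in> (V \<inter> h -` Ob) \<inter> {P. det P \<noteq> 0}" using e(2) by blast
    then show "p t \<in> V" "h (p t) \<in> Ob" "det (p t) \<noteq> 0" by auto
  qed
  have "\<forall>t0\<in>{0..1}. real_analytic_at t0 (\<lambda>t. p t $ i $ j)" for i j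
    using ra_polynomial_entry[OF p(1)] by blast
  then have "\<forall>t0\<in>{0..1}. real_analytic_at t0 (\<lambda>t. h (p t) $ a $ b)" for a b
    unfolding h_def by (rule analytic.C_kmap_normalised) (rule pdV[OF pV(1)])
  moreover have "h (p 0) = L0"
  proof -
    have "p 0 = M0" using p(2) N0 by (simp add: pathstart_def)
    moreover have "gram I (rowmat M0) = mat 1" using L(5) M0(2) by (simp add: trace_preserving_kmap)
    ultimately show ?thesis by (simp add: h_def normalised_id M0(2))
  qed
  moreover have "h (p 1) = L1"
  proof -
    have "p 1 = M1" using p(3) N1 by (simp add: pathfinish_def)
    moreover have "gram I (rowmat M1) = mat 1" using L(6) M1(2) by (simp add: trace_preserving_kmap)
    ultimately show ?thesis by (simp add: h_def normalised_id M1(2))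
  qed
  moreover have "h (p t) \<in> {L \<in> CP_rank_TP r. Q L}" if t: "t \<in> {0..1}" for t
  proof -
    have "h (p t) \<in> CP_rank_TP r"
      unfolding h_def using normalised_CP_rank_TP[OF pdV[OF pV(1)[OF t]] pV(3)[OF t]] I by simp
    then show ?thesis using pV(2)[OF t] Ob(2) by (auto simp: CP_rank_TP_def)
  qed
  ultimately show "\<exists>g. g 0 = L0 \<and> g 1 = L1 \<and> (\<forall>t\<in>{0..1}. g t \<in> {L \<in> CP_rank_TP r. Q L})
      \<and> (\<forall>a b. \<forall>t0\<in>{0..1}. real_analytic_at t0 (\<lambda>t. g t $ a $ b))"
    by (intro exI[of _ "\<lambda>t. h (p t)"]) blast
qed

lemma primitive_similar:
  fixes A :: "'i \<Rightarrow> complex^'n^'n" and H G :: "complex^'n^'n"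
  assumes "finite I" "H ** G = mat 1" "c \<noteq> 0" "primitive_map (kmap I A)"
  shows "primitive_map (kmap I (\<lambda>k. c *\<^sub>R (H ** A k ** G)))"
  using assms full_similar[OF assms(2,3)] by (auto simp: primitive_kmap_iff)

lemma irreducible_similar:
  fixes A :: "'i \<Rightarrow> complex^'n^'n" and H G :: "complex^'n^'n"
  assumes "finite I" "H ** G = mat 1" "c \<noteq> 0" "irreducible_map (kmap I A)"
  shows "irreducible_map (kmap I (\<lambda>k. c *\<^sub>R (H ** A k ** G)))"
  using assms irr_similar[OF assms(2,3)] by (simp add: irreducible_kmap_iff)

text \<open>The explicit primitive tuple is made trace preserving by the Perron similarity, which
  keeps it primitive.\<close>

lemma Prim_rank_TP_nonempty:
  fixes I :: "('n::finite \<times> 'n) set"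
  assumes D: "CARD('n) \<ge> 2" and I: "card I \<ge> 2"
  obtains M where "det M \<noteq> 0" "gram I (rowmat M) = mat 1" "primitive_map (kmap I (rowmat M))"
proof -
  obtain k l where kl: "k \<in> I" "l \<in> I" "k \<noteq> l"
    using I by (metis One_nat_def Suc_1 card_le_Suc0_iff_eq finite not_less_eq_eq)
  obtain E :: "complex^('n \<times> 'n)^('n \<times> 'n)" where E: "det E \<noteq> 0" "wdet k l (rowmat E) \<noteq> 0"
    using exists_primitive_matrix[OF D kl(3)] by blast
  have prim: "primitive_map (kmap I (rowmat E))"
    using wdet_full[OF E(2) kl(1,2)] by (auto simp: primitive_kmap_iff)
  have irr: "irr I (rowmat E)"
    using primitive_imp_irreducible[OF prim] by (simp add: irreducible_kmap_iff)
  have nz: "\<exists>k\<in>I. rowmat E k \<noteq> 0" using det_rowmat_nz[OF E(1), of I] kl by blast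
  obtain X \<rho> where X: "pd X" "0 < \<rho>" "dmap I (rowmat E) X = \<rho> *\<^sub>R X"
    using perron_exists[OF irr finite nz] by metis
  show ?thesis
  proof (rule that[of "perron_normal X \<rho> E"])
    show "det (perron_normal X \<rho> E) \<noteq> 0" by (rule det_perron_normal[OF X(1,2) E(1)])
    show "gram I (rowmat (perron_normal X \<rho> E)) = mat 1" by (rule gram_perron_normal[OF X])
    show "primitive_map (kmap I (rowmat (perron_normal X \<rho> E)))"
      unfolding perron_normal_def rowmat_rmat
      using X(2) by (intro primitive_similar[OF _ gsmat[OF X(1)] _ prim]) auto
  qed
qed

lemma Prim_TP_dense:
  assumes D: "CARD('n::finite) \<ge> 2" and r: "r \<ge> 2"
  shows "(CP_rank_TP r :: 'n supop set) \<subseteq> closure (Prim_rank_TP r)"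
proof
  fix L0 :: "'n supop" assume "L0 \<in> CP_rank_TP r"
  then have L: "L0 \<in> CP_rank r" "trace_preserving L0" by (auto simp: CP_rank_TP_def)
  obtain I :: "('n \<times> 'n) set" where I: "card I = r"
    using index_set[OF r CP_rank_bound[OF L(1)]] by metis
  have I2: "card I \<ge> 2" "I \<noteq> {}" using I r by auto
  obtain M0 where M0: "det M0 \<noteq> 0" "L0 = kmap I (rowmat M0)" using CP_rank_obtain[OF L(1) I] by metis
  have g0: "gram I (rowmat M0) = mat 1" using L(2) M0(2) by (simp add: trace_preserving_kmap)
  obtain M1 :: "complex^('n \<times> 'n)^('n \<times> 'n)" where M1: "det M1 \<noteq> 0" "gram I (rowmat M1) = mat 1" "primitive_map (kmap I (rowmat M1))"
    using Prim_rank_TP_nonempty[OF D I2(1)] by blast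
  obtain M where M: "M 0 = M0" "M 1 = M1" "\<And>t0 i j. real_analytic_at t0 (\<lambda>t. M t $ i $ j)"
     "\<And>t. 0 < t \<Longrightarrow> t < 1 \<Longrightarrow> det (M t) \<noteq> 0"
     "\<And>t. 0 < t \<Longrightarrow> t < 1 \<Longrightarrow> kmap I (rowmat (M t)) \<in> Prim_rank (card I)"
    using CP_rank_path[OF D I2(1), of M0 M1] by blast
  have ends: "t = 0 \<or> t = 1 \<or> (0 < t \<and> t < 1)" if "t \<in> {0..1}" for t :: real
    using that by auto
  have det: "det (M t) \<noteq> 0" if "t \<in> {0..1}" for t
    using ends[OF that] M M0(1) M1(1) by auto
  \<comment> \<open>Inside the interval primitivity excludes a common kernel of the Kraus operators,
    so Gram-Schmidt applies; at both ends the Gram matrix is the identity.\<close>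
  have inner: "pd (gram I (rowmat (M t)))" if t: "0 < t" "t < 1" for t
  proof (rule irr_gram_pd)
    have "primitive_map (kmap I (rowmat (M t)))" using M(5)[OF t] by (simp add: Prim_rank_def)
    then show "irr I (rowmat (M t))"
      by (auto dest: primitive_imp_irreducible simp: irreducible_kmap_iff)
    show "\<exists>k\<in>I. rowmat (M t) k \<noteq> 0" by (rule det_rowmat_nz[OF M(4)[OF t] I2(2)])
  qed simp
  have pd: "pd (gram I (rowmat (M t)))" if "t \<in> {0..1}" for t
    using ends[OF that] M(1,2) g0 M1(2) inner by (auto simp: pd_mat_1)
  define g where "g t = kmap I (rowmat (normalised I (M t)))" for t
  have an: "\<forall>t0\<in>{0..1}. real_analytic_at t0 (\<lambda>t. g t $ a $ b)" for a b
    unfolding g_def using M(3) pd by (intro analytic.C_kmap_normalised) auto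
  have gTP: "g t \<in> CP_rank_TP r" if "t \<in> {0..1}" for t
    unfolding g_def using normalised_CP_rank_TP[OF pd[OF that] det[OF that]] I by simp
  have g0': "g 0 = L0" by (simp add: g_def M(1) normalised_id g0 M0(2))
  have "primitive_map (g 1)" by (simp add: g_def M(2) normalised_id M1)
  \<comment> \<open>Freezing the exponent found at t = 1 turns primitivity into the non-vanishing of
    one analytic function of t.\<close>
  then obtain n where n: "det (choi (map_pow (g 1) n)) \<noteq> 0" by (auto simp: primitive_iff_choi)
  have rp: "\<forall>t0\<in>{0..1}. real_analytic_at t0 (\<lambda>t. det (choi (map_pow (g t) n)))"
    by (rule analytic.C_det_choi[OF an])
  have "g 0 \<in> closure (Prim_rank_TP r)"
  proof (rule closure_from_path)
    show "isCont g 0" using an by (intro ra_isCont_matrix) auto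
    fix \<epsilon> :: real assume "\<epsilon> > 0"
    then obtain t where t: "0 < t" "t < \<epsilon>" "t \<le> 1" "det (choi (map_pow (g t) n)) \<noteq> 0"
      using ra_nonzero_near_0[of "\<lambda>t. det (choi (map_pow (g t) n))" \<epsilon>] rp n by blast
    have "g t \<in> CP_rank_TP r" using t by (intro gTP) auto
    then have "g t \<in> Prim_rank_TP r"
      using t(4) by (auto simp: CP_rank_TP_def Prim_rank_TP_def Prim_rank_def CP_rank_def primitive_iff_choi)
    then show "\<exists>t. 0 < t \<and> t < \<epsilon> \<and> g t \<in> Prim_rank_TP r" using t by blast
  qed
  then show "L0 \<in> closure (Prim_rank_TP r)" by (simp add: g0')
qed

lemma dense_open_inI:
  assumes "P = T \<inter> U" "open U" "T \<subseteq> closure P"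
  shows "dense_open_in P T"
  using assms by (auto simp: dense_open_in_def openin_open)

theorem theorem1:
  fixes r :: nat
  assumes "CARD('n::finite) \<ge> 2" and "r \<ge> 2"
  shows "path_connected (CP_rank r :: 'n supop set)
    \<and> path_connected (Prim_rank r :: 'n supop set) \<and> dense_open_in (Prim_rank r) (CP_rank r :: 'n supop set)
    \<and> path_connected (Prim_rank_TP r :: 'n supop set) \<and> dense_open_in (Prim_rank_TP r) (CP_rank_TP r :: 'n supop set)
    \<and> path_connected (Irr_rank r :: 'n supop set) \<and> dense_open_in (Irr_rank r) (CP_rank r :: 'n supop set)
    \<and> path_connected (Irr_rank_TP r :: 'n supop set) \<and> dense_open_in (Irr_rank_TP r) (CP_rank_TP r :: 'n supop set)
    \<and> analytic_path_connected (CP_rank r :: 'n supop set)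
    \<and> analytic_path_connected (Prim_rank r :: 'n supop set)
    \<and> analytic_path_connected (Irr_rank r :: 'n supop set)
    \<and> analytic_path_connected (Prim_rank_TP r :: 'n supop set)
    \<and> analytic_path_connected (Irr_rank_TP r :: 'n supop set)"
proof -
  let ?Ob = "{L :: 'n supop. \<exists>n. det (choi (map_pow L n)) \<noteq> 0}"
  have sub: "Prim_rank r \<subseteq> (CP_rank r :: 'n supop set)" "Irr_rank r \<subseteq> (CP_rank r :: 'n supop set)"
    by (auto simp: Prim_rank_def Irr_rank_def)
  have oR: "open (- reducible :: 'n supop set)" by (rule open_Compl[OF closed_reducible])
  have PTP: "Prim_rank_TP r = {L \<in> CP_rank_TP r. primitive_map L}"
    by (auto simp: Prim_rank_TP_def Prim_rank_def CP_rank_TP_def)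
  have ITP: "Irr_rank_TP r = {L \<in> CP_rank_TP r. irreducible_map L}"
    by (auto simp: Irr_rank_TP_def Irr_rank_def CP_rank_TP_def)
  have PTPo: "Prim_rank_TP r = CP_rank_TP r \<inter> ?Ob"
    by (auto simp: PTP CP_rank_TP_def CP_rank_def primitive_iff_choi)
  have ITPo: "Irr_rank_TP r = CP_rank_TP r \<inter> - (reducible :: 'n supop set)"
    by (auto simp: ITP CP_rank_TP_def CP_rank_def irreducible_iff)
  have "(Prim_rank_TP r :: 'n supop set) \<subseteq> Irr_rank_TP r"
    by (auto simp: PTP ITP primitive_imp_irreducible)
  then have ITPd: "(CP_rank_TP r :: 'n supop set) \<subseteq> closure (Irr_rank_TP r)"
    using Prim_TP_dense[OF assms] closure_mono by blast
  note nonTP = paths_between_Prim_CP[OF assms]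
  have P: "analytic_path_connected (Prim_rank_TP r :: 'n supop set) \<and> path_connected (Prim_rank_TP r :: 'n supop set)"
    unfolding PTP
    by (rule TP_paths[OF assms open_primitive])
       (auto simp: CP_rank_def primitive_iff_choi[symmetric] primitive_imp_irreducible intro: primitive_similar
         , auto simp: primitive_iff_choi)
  have Ir: "analytic_path_connected (Irr_rank_TP r :: 'n supop set) \<and> path_connected (Irr_rank_TP r :: 'n supop set)"
    unfolding ITP
    by (rule TP_paths[OF assms oR])
       (auto simp: CP_rank_def irreducible_iff[symmetric] primitive_imp_irreducible intro: irreducible_similar
         , auto simp: irreducible_iff)
  show ?thesis
    using nonTP[OF sub(1) order.refl] nonTP[OF order.refl sub(1)] nonTP[OF Prim_subset_Irr sub(2)] P Ir
      dense_open_inI[OF Prim_rank_open open_primitive Prim_dense[OF assms order.refl]]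
      dense_open_inI[OF PTPo open_primitive Prim_TP_dense[OF assms]]
      dense_open_inI[OF Irr_rank_open oR Prim_dense[OF assms Prim_subset_Irr]]
      dense_open_inI[OF ITPo oR ITPd]
    by blast
qed

end
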